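(* Let $\mathcal{A}=\mathcal{A}_n^{\bar q,\Lambda}(\mathbb{K})$ and $\mathcal{C}=\mathcal{A}_m^{\bar q',\Lambda'}(\mathbb{K})$ (generators $x'_i,y'_i$), with no $q_i$ and no $q'_i$ a root of unity. Then $\mathcal{A}[t]\cong\mathcal{C}[t]$ as $\mathbb{K}$-algebras if and only if $m=n$ and there exist a partition $\{1,\dots,n\}=P_1\cup P_2$ and a permutation $\sigma$ of $\{1,\dots,n\}$ such that: $q'_{\sigma(i)}=q_i$ for $i\in P_1$; $q'_{\sigma(i)}=q_i^{-1}$ for $i\in P_2$; $\lambda'_{\sigma(i)\sigma(j)}=\lambda_{ij}$ whenever $i,j$ lie in the same part; $\lambda'_{\sigma(j)\sigma(i)}=\lambda_{ij}$ whenever $i\in P_1,j\in P_2$. In that case, for any $\alpha_1,\dots,\alpha_n,a\in\mathbb{K}^*$ and $b\in\mathbb{K}$, an isomorphism $\varphi:\mathcal{A}[t]\to\mathcal{C}[t]$ is given by $\varphi(x_i)=\alpha_ix'_{\sigma(i)},\ \varphi(y_i)=\alpha_i^{-1}y'_{\sigma(i)}$ ($i\in P_1$), $\varphi(x_i)=\alpha_iy'_{\sigma(i)},\ \varphi(y_i)=-q_i^{-1}\alpha_i^{-1}x'_{\sigma(i)}$ ($i\in P_2$), $\varphi(t)=at+b$.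
   Context: For a field $\mathbb{K}$, $n\ge 1$, $\bar q=(q_1,\dots,q_n)\in(\mathbb{K}^* )^n$, and $\Lambda=(\lambda_{ij})$ an $n\times n$ matrix over $\mathbb{K}^*$ with $\lambda_{ij}=\lambda_{ji}^{-1}$, $\lambda_{ii}=1$, $\mathcal{A}_n^{\bar q,\Lambda}(\mathbb{K})$ is the $\mathbb{K}$-algebra generated by $x_1,y_1,\dots,x_n,y_n$ with relations: for $1\le i<j\le n$, $x_ix_j=\lambda_{ij}x_jx_i$, $y_jy_i=\lambda_{ji}y_iy_j$, $x_iy_j=\lambda_{ji}y_jx_i$, $x_jy_i=\lambda_{ij}y_ix_j$; and $x_iy_i-q_iy_ix_i=1$ for all $i$. $\mathcal{C}$ is defined likewise from $(m,\bar q',\Lambda')$. For an algebra $R$, $R[t]=R\otimes_{\mathbb{K}}\mathbb{K}[t]$. *)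

theory Defs
  imports Main
begin

text \<open>An element of the free associative K-algebra on a generator set G is a finitely
supported function from words (lists of generators) to K, supported on words over G.\<close>

type_synonym ('g, 'k) fa = "'g list \<Rightarrow> 'k"

definition FA :: "'g set \<Rightarrow> ('g, 'k::field) fa set" where
  "FA G = {f. finite {w. f w \<noteq> 0} \<and> (\<forall>w. f w \<noteq> 0 \<longrightarrow> set w \<subseteq> G)}"

definition fa_zero :: "('g, 'k::field) fa" where
  "fa_zero = (\<lambda>w. 0)"

definition fa_add :: "('g, 'k::field) fa \<Rightarrow> ('g, 'k) fa \<Rightarrow> ('g, 'k) fa" where
  "fa_add f g = (\<lambda>w. f w + g w)"

definition fa_sub :: "('g, 'k::field) fa \<Rightarrow> ('g, 'k) fa \<Rightarrow> ('g, 'k) fa" where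
  "fa_sub f g = (\<lambda>w. f w - g w)"

definition fa_smult :: "'k::field \<Rightarrow> ('g, 'k) fa \<Rightarrow> ('g, 'k) fa" where
  "fa_smult c f = (\<lambda>w. c * f w)"

definition fa_mult :: "('g, 'k::field) fa \<Rightarrow> ('g, 'k) fa \<Rightarrow> ('g, 'k) fa" where
  "fa_mult f g = (\<lambda>w. \<Sum>i\<le>length w. f (take i w) * g (drop i w))"

definition fa_one :: "('g, 'k::field) fa" where
  "fa_one = (\<lambda>w. if w = [] then 1 else 0)"

definition fa_gen :: "'g \<Rightarrow> ('g, 'k::field) fa" where
  "fa_gen a = (\<lambda>w. if w = [a] then 1 else 0)"

inductive_set ideal_of :: "'g set \<Rightarrow> ('g, 'k::field) fa set \<Rightarrow> ('g, 'k) fa set"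
  for G :: "'g set" and R :: "('g, 'k) fa set" where
  base: "r \<in> R \<Longrightarrow> r \<in> ideal_of G R"
| zero: "fa_zero \<in> ideal_of G R"
| add: "f \<in> ideal_of G R \<Longrightarrow> g \<in> ideal_of G R \<Longrightarrow> fa_add f g \<in> ideal_of G R"
| lmult: "a \<in> FA G \<Longrightarrow> f \<in> ideal_of G R \<Longrightarrow> fa_mult a f \<in> ideal_of G R"
| rmult: "a \<in> FA G \<Longrightarrow> f \<in> ideal_of G R \<Longrightarrow> fa_mult f a \<in> ideal_of G R"

definition fa_cong :: "'g set \<Rightarrow> ('g, 'k::field) fa set \<Rightarrow> ('g, 'k) fa \<Rightarrow> ('g, 'k) fa \<Rightarrow> bool" where
  "fa_cong G R f g \<longleftrightarrow> fa_sub f g \<in> ideal_of G R"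

text \<open>A map \<open>\<phi>\<close> between free algebras induces a K-algebra isomorphism
  \<open>K<G1>/(R1) \<cong> K<G2>/(R2)\<close>: it is K-linear, multiplicative and unital modulo the relations,
  well defined and injective on classes, and surjective on classes.\<close>
definition is_alg_iso ::
  "'g1 set \<Rightarrow> ('g1, 'k::field) fa set \<Rightarrow> 'g2 set \<Rightarrow> ('g2, 'k) fa set
     \<Rightarrow> (('g1, 'k) fa \<Rightarrow> ('g2, 'k) fa) \<Rightarrow> bool" where
  "is_alg_iso G1 R1 G2 R2 \<phi> \<longleftrightarrow>
     (\<forall>f\<in>FA G1. \<phi> f \<in> FA G2) \<and>
     (\<forall>f\<in>FA G1. \<forall>g\<in>FA G1. fa_cong G2 R2 (\<phi> (fa_add f g)) (fa_add (\<phi> f) (\<phi> g))) \<and>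
     (\<forall>c. \<forall>f\<in>FA G1. fa_cong G2 R2 (\<phi> (fa_smult c f)) (fa_smult c (\<phi> f))) \<and>
     (\<forall>f\<in>FA G1. \<forall>g\<in>FA G1. fa_cong G2 R2 (\<phi> (fa_mult f g)) (fa_mult (\<phi> f) (\<phi> g))) \<and>
     fa_cong G2 R2 (\<phi> fa_one) fa_one \<and>
     (\<forall>f\<in>FA G1. \<forall>g\<in>FA G1. fa_cong G1 R1 f g \<longleftrightarrow> fa_cong G2 R2 (\<phi> f) (\<phi> g)) \<and>
     (\<forall>h\<in>FA G2. \<exists>f\<in>FA G1. fa_cong G2 R2 (\<phi> f) h)"

definition alg_isomorphic ::
  "'g1 set \<Rightarrow> ('g1, 'k::field) fa set \<Rightarrow> 'g2 set \<Rightarrow> ('g2, 'k) fa set \<Rightarrow> bool" where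
  "alg_isomorphic G1 R1 G2 R2 \<longleftrightarrow> (\<exists>\<phi>. is_alg_iso G1 R1 G2 R2 \<phi>)"

definition fa_word_img :: "('g1 \<Rightarrow> ('g2, 'k::field) fa) \<Rightarrow> 'g1 list \<Rightarrow> ('g2, 'k) fa" where
  "fa_word_img \<psi> u = foldr (\<lambda>a acc. fa_mult (\<psi> a) acc) u fa_one"

definition fa_ext :: "('g1 \<Rightarrow> ('g2, 'k::field) fa) \<Rightarrow> ('g1, 'k) fa \<Rightarrow> ('g2, 'k) fa" where
  "fa_ext \<psi> f = (\<lambda>w. \<Sum>u\<in>{u. f u \<noteq> 0}. f u * fa_word_img \<psi> u w)"

datatype qgen = X nat | Y nat | T

definition qw_gens :: "nat \<Rightarrow> qgen set" where
  "qw_gens n = X ` {1..n} \<union> Y ` {1..n}"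

definition qwt_gens :: "nat \<Rightarrow> qgen set" where
  "qwt_gens n = qw_gens n \<union> {T}"

definition mon2 :: "qgen \<Rightarrow> qgen \<Rightarrow> (qgen, 'k::field) fa" where
  "mon2 a b = fa_mult (fa_gen a) (fa_gen b)"

definition qw_rels :: "nat \<Rightarrow> (nat \<Rightarrow> 'k::field) \<Rightarrow> (nat \<Rightarrow> nat \<Rightarrow> 'k) \<Rightarrow> (qgen, 'k) fa set" where
  "qw_rels n q lam =
     {fa_sub (mon2 (X i) (X j)) (fa_smult (lam i j) (mon2 (X j) (X i))) | i j. 1 \<le> i \<and> i < j \<and> j \<le> n}
   \<union> {fa_sub (mon2 (Y j) (Y i)) (fa_smult (lam j i) (mon2 (Y i) (Y j))) | i j. 1 \<le> i \<and> i < j \<and> j \<le> n}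
   \<union> {fa_sub (mon2 (X i) (Y j)) (fa_smult (lam j i) (mon2 (Y j) (X i))) | i j. 1 \<le> i \<and> i < j \<and> j \<le> n}
   \<union> {fa_sub (mon2 (X j) (Y i)) (fa_smult (lam i j) (mon2 (Y i) (X j))) | i j. 1 \<le> i \<and> i < j \<and> j \<le> n}
   \<union> {fa_sub (fa_sub (mon2 (X i) (Y i)) (fa_smult (q i) (mon2 (Y i) (X i)))) fa_one | i. 1 \<le> i \<and> i \<le> n}"

text \<open>Relators of \<open>A[t] = A \<otimes> K[t]\<close>: those of A plus centrality of t.\<close>
definition qwt_rels :: "nat \<Rightarrow> (nat \<Rightarrow> 'k::field) \<Rightarrow> (nat \<Rightarrow> nat \<Rightarrow> 'k) \<Rightarrow> (qgen, 'k) fa set" where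
  "qwt_rels n q lam = qw_rels n q lam \<union> {fa_sub (mon2 T g) (mon2 g T) | g. g \<in> qw_gens n}"

definition qw_params :: "nat \<Rightarrow> (nat \<Rightarrow> 'k::field) \<Rightarrow> (nat \<Rightarrow> nat \<Rightarrow> 'k) \<Rightarrow> bool" where
  "qw_params n q lam \<longleftrightarrow>
     (\<forall>i\<in>{1..n}. q i \<noteq> 0 \<and> lam i i = 1) \<and>
     (\<forall>i\<in>{1..n}. \<forall>j\<in>{1..n}. lam i j \<noteq> 0 \<and> lam i j = inverse (lam j i))"

definition not_root_of_unity :: "'k::field \<Rightarrow> bool" where
  "not_root_of_unity c \<longleftrightarrow> (\<forall>k::nat. k > 0 \<longrightarrow> c ^ k \<noteq> 1)"

end

theory Submission
  imports Defs "HOL-Library.Function_Algebras" "HOL-Library.Poly_Mapping" "HOL-Library.Multiset"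
begin

text \<open>Put \<open>z\<^sub>i = x\<^sub>i y\<^sub>i - y\<^sub>i x\<^sub>i = 1 + (q\<^sub>i - 1) y\<^sub>i x\<^sub>i\<close>. Since \<open>y\<^sub>i = (z\<^sub>i - 1) x\<^sub>i\<^sup>-\<^sup>1 / (q\<^sub>i - 1)\<close>, the
  algebra \<open>A[t]\<close> embeds into the quantum torus on \<open>x\<^sub>i\<^sup>\<plusminus>\<^sup>1\<close>, \<open>z\<^sub>i\<^sup>\<plusminus>\<^sup>1\<close>, \<open>t\<^sup>\<plusminus>\<^sup>1\<close>, a domain with
  additive degrees. If no \<open>q\<^sub>i\<close> is a root of unity, every nonzero normal element of \<open>A[t]\<close> has the
  form \<open>f(t) z\<^sup>k\<close>. An isomorphism \<open>\<Phi>\<close> preserves normal elements and their factorizations, so it sends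
  each \<open>z\<^sub>i\<close> to \<open>f\<^sub>i(t) z'\<^sub>\<sigma>\<^sub>(\<^sub>i\<^sub>)\<close> for a bijection \<open>\<sigma>\<close>. Comparing degrees in
  \<open>(q\<^sub>i - 1) \<Phi>(y\<^sub>i) \<Phi>(x\<^sub>i) = \<Phi>(z\<^sub>i) - 1\<close> shows that \<open>\<Phi>(x\<^sub>i)\<close> has weight \<open>\<plusminus>1\<close> in the index \<open>\<sigma>(i)\<close> and
  weight 0 elsewhere; the sign decides between \<open>P\<^sub>1\<close> and \<open>P\<^sub>2\<close>, and the conditions on the parameters
  are read off from the commutation relations.\<close>

text \<open>The presentation alone does not show when an element is nonzero. Straightening writes
  every class as a combination of sorted words, and the torus images of distinct sorted words have
  distinct leading exponents; together these make the map to the torus injective, so an isomorphism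
  becomes a map between sets of finitely supported functions, with equality in place of congruence.
  The torus is larger than the algebra: there x_k is invertible and every monomial is normal. The
  argument therefore rests on x_k^{-1} being absent from A[t], and uses this twice. It forces a
  normal element to commute with z_k by the scalar 1, hence to have x_k-weight 0 because q_k is no
  root of unity. And a nonzero element of A[t] with x_k-weight -r, r > 0, must have z_k-degree at
  least r; since z_i has z-degree 1, the weight of the image of x_i is at most 1 in absolute value,
  and it is not 0 because q_i is not 1. The factors f_i(t) stay undetermined. They do no harm, since
  t contributes nothing to commutation factors and only the exponents of x and z are
  compared.\<close>

declare plus_fun_apply [simp del] zero_fun_apply [simp del] minus_apply [simp del] uminus_apply [simp del]

lemmas fun_apply = plus_fun_apply zero_fun_apply minus_apply uminus_apply

section \<open>Algebras over a field and homomorphisms out of the free algebra\<close>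

text \<open>The operations are parameters because the torus product depends on q and lam, so it
  cannot be a type class instance. \<open>ext\<close>, the homomorphism fixed by the images of the
  generators, is used with two targets: the free algebra, for the explicit maps, and the torus, for
  the embedding.\<close>

locale kalg =
  fixes sc :: "'k::field \<Rightarrow> 'v::ab_group_add \<Rightarrow> 'v"
    and mu :: "'v \<Rightarrow> 'v \<Rightarrow> 'v"
    and un :: 'v
  assumes sc_add_right: "sc c (u + v) = sc c u + sc c v"
    and sc_add_left: "sc (c + d) u = sc c u + sc d u"
    and sc_sc [simp]: "sc c (sc d u) = sc (c * d) u"
    and sc_one [simp]: "sc 1 u = u"
    and mu_add_left: "mu (u + v) w = mu u w + mu v w"
    and mu_add_right: "mu u (v + w) = mu u v + mu u w"
    and mu_sc_left [simp]: "mu (sc c u) v = sc c (mu u v)"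
    and mu_sc_right [simp]: "mu u (sc c v) = sc c (mu u v)"
    and mu_assoc: "mu (mu u v) w = mu u (mu v w)"
    and mu_un_left [simp]: "mu un v = v"
    and mu_un_right [simp]: "mu v un = v"
begin

lemma sc_zero_right [simp]: "sc c 0 = 0"
  using sc_add_right[of c 0 0] by simp

lemma sc_zero_left [simp]: "sc 0 u = 0"
  using sc_add_left[of 0 0 u] by simp

lemma mu_zero_left [simp]: "mu 0 u = 0"
  using mu_add_left[of 0 0 u] by simp

lemma mu_zero_right [simp]: "mu u 0 = 0"
  using mu_add_right[of u 0 0] by simp

lemma sc_minus_right: "sc c (- u) = - sc c u"
  using sc_add_right[of c u "- u"] by (simp add: eq_neg_iff_add_eq_0 add.commute)

lemma sc_minus_left: "sc (- c) u = - sc c u"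
  using sc_add_left[of c "- c" u] by (simp add: eq_neg_iff_add_eq_0 add.commute)

lemma mu_minus_left: "mu (- u) v = - mu u v"
  using mu_add_left[of u "- u" v] by (simp add: eq_neg_iff_add_eq_0 add.commute)

lemma mu_minus_right: "mu u (- v) = - mu u v"
  using mu_add_right[of u v "- v"] by (simp add: eq_neg_iff_add_eq_0 add.commute)

lemma sc_diff_right: "sc c (u - v) = sc c u - sc c v"
  using sc_add_right[of c u "- v"] by (simp add: sc_minus_right)

lemma sc_diff_left: "sc (c - d) u = sc c u - sc d u"
  using sc_add_left[of c "- d" u] by (simp add: sc_minus_left)

lemma mu_diff_left: "mu (u - v) w = mu u w - mu v w"
  using mu_add_left[of u "- v" w] by (simp add: mu_minus_left)

lemma mu_diff_right: "mu u (v - w) = mu u v - mu u w"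
  using mu_add_right[of u v "- w"] by (simp add: mu_minus_right)

lemmas bilinear = sc_add_right sc_add_left sc_diff_right sc_diff_left
  mu_add_left mu_add_right mu_diff_left mu_diff_right
  sc_minus_left sc_minus_right mu_minus_left mu_minus_right

definition wimg :: "('g \<Rightarrow> 'v) \<Rightarrow> 'g list \<Rightarrow> 'v" where
  "wimg \<psi> u = foldr (\<lambda>a. mu (\<psi> a)) u un"

definition ext :: "('g \<Rightarrow> 'v) \<Rightarrow> ('g, 'k) fa \<Rightarrow> 'v" where
  "ext \<psi> f = (\<Sum>u\<in>{u. f u \<noteq> 0}. sc (f u) (wimg \<psi> u))"

lemma wimg_Nil [simp]: "wimg \<psi> [] = un"
  and wimg_Cons [simp]: "wimg \<psi> (a # u) = mu (\<psi> a) (wimg \<psi> u)"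
  by (simp_all add: wimg_def)

lemma wimg_append: "wimg \<psi> (u @ v) = mu (wimg \<psi> u) (wimg \<psi> v)"
  by (induction u) (simp_all add: mu_assoc)

end

section \<open>The free algebra on words\<close>

definition fa_word :: "'g list \<Rightarrow> ('g, 'k::field) fa" where
  "fa_word u = (\<lambda>w. if w = u then 1 else 0)"

lemma fa_zero_eq: "fa_zero = 0"
  and fa_add_eq: "fa_add f g = f + g"
  and fa_sub_eq: "fa_sub f g = f - g"
  by (simp_all add: fun_eq_iff fun_apply fa_zero_def fa_add_def fa_sub_def)

lemma fa_one_eq: "fa_one = fa_word []"
  and fa_gen_eq: "fa_gen a = fa_word [a]"
  by (auto simp: fa_one_def fa_gen_def fa_word_def)

lemma fa_mult_assoc: "fa_mult (fa_mult f g) h = fa_mult f (fa_mult g h)"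
proof
  fix w :: "'a list"
  let ?n = "length w"
  have "fa_mult (fa_mult f g) h w =
      (\<Sum>i\<le>?n. \<Sum>j\<le>i. f (take j w) * g (drop j (take i w)) * h (drop i w))"
    unfolding fa_mult_def by (intro sum.cong) (auto simp: sum_distrib_right min_def)
  also have "\<dots> = (\<Sum>(i, j)\<in>(SIGMA i:{..?n}. {..i}).
      f (take j w) * g (drop j (take i w)) * h (drop i w))"
    by (subst sum.Sigma) auto
  \<comment> \<open>Both sums run over the pairs of cut positions j \<le> i of w; the new one counts
    the second cut from the first.\<close>
  also have "\<dots> = (\<Sum>(j, i)\<in>(SIGMA j:{..?n}. {..?n - j}).
      f (take j w) * (g (take i (drop j w)) * h (drop i (drop j w))))"
    by (rule sum.reindex_bij_witness
          [where i = "\<lambda>(j, i). (i + j, j)" and j = "\<lambda>(i, j). (j, i - j)"])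
       (auto simp: drop_take mult.assoc)
  also have "\<dots> = (\<Sum>j\<le>?n. \<Sum>i\<le>?n - j. f (take j w) * (g (take i (drop j w)) * h (drop i (drop j w))))"
    by (subst sum.Sigma) auto
  also have "\<dots> = fa_mult f (fa_mult g h) w"
    unfolding fa_mult_def by (intro sum.cong) (auto simp: sum_distrib_left)
  finally show "fa_mult (fa_mult f g) h w = fa_mult f (fa_mult g h) w" .
qed

lemma fa_mult_word_left:
  "fa_mult (fa_word u) f w = (if take (length u) w = u then f (drop (length u) w) else 0)"
proof -
  have "fa_mult (fa_word u) f w =
      (\<Sum>i\<le>length w. if i = length u then (if take i w = u then f (drop i w) else 0) else 0)"
    unfolding fa_mult_def fa_word_def by (intro sum.cong) auto
  also have "\<dots> = (if take (length u) w = u then f (drop (length u) w) else 0)"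
    by (subst sum.delta) auto
  finally show ?thesis .
qed

lemma fa_mult_word_right:
  "fa_mult f (fa_word []) w = f w"
proof -
  have "fa_mult f (fa_word []) w = (\<Sum>i\<le>length w. if i = length w then f w else 0)"
    unfolding fa_mult_def fa_word_def by (intro sum.cong) auto
  also have "\<dots> = f w"
    by simp
  finally show ?thesis .
qed

lemma fa_mult_word_word [simp]:
  "fa_mult (fa_word u) (fa_word v) = fa_word (u @ v)"
proof
  fix w
  show "fa_mult (fa_word u) (fa_word v) w = (fa_word (u @ v) :: ('a, 'b) fa) w"
    unfolding fa_mult_word_left unfolding fa_word_def using append_eq_conv_conj[of u v w] by auto
qed

interpretation fa: kalg fa_smult fa_mult fa_one
proof
  fix c d :: "'k::field" and u v w :: "('g, 'k) fa"
  show "fa_smult c (u + v) = fa_smult c u + fa_smult c v"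
    by (intro ext) (simp add: fun_apply fa_smult_def algebra_simps)
  show "fa_smult (c + d) u = fa_smult c u + fa_smult d u"
    by (intro ext) (simp add: fun_apply fa_smult_def algebra_simps)
  show "fa_smult c (fa_smult d u) = fa_smult (c * d) u"
    by (intro ext) (simp add: fun_apply fa_smult_def algebra_simps)
  show "fa_smult 1 u = u"
    by (intro ext) (simp add: fun_apply fa_smult_def)
  show "fa_mult (u + v) w = fa_mult u w + fa_mult v w"
    by (intro ext) (simp add: fun_apply fa_mult_def algebra_simps sum.distrib)
  show "fa_mult u (v + w) = fa_mult u v + fa_mult u w"
    by (intro ext) (simp add: fun_apply fa_mult_def algebra_simps sum.distrib)
  show "fa_mult (fa_smult c u) v = fa_smult c (fa_mult u v)"
    by (intro ext) (simp add: fun_apply fa_mult_def fa_smult_def sum_distrib_left algebra_simps)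
  show "fa_mult u (fa_smult c v) = fa_smult c (fa_mult u v)"
    by (intro ext) (simp add: fun_apply fa_mult_def fa_smult_def sum_distrib_left algebra_simps)
  show "fa_mult (fa_mult u v) w = fa_mult u (fa_mult v w)"
    by (rule fa_mult_assoc)
  show "fa_mult fa_one v = v"
    by (auto simp: fa_one_eq fa_mult_word_left)
  show "fa_mult v fa_one = v"
    by (auto simp: fa_one_eq fa_mult_word_right)
qed

lemma sum_fun_apply: "sum F A x = (\<Sum>a\<in>A. F a x)"
  for F :: "'a \<Rightarrow> 'b \<Rightarrow> 'c::comm_monoid_add"
  by (induction A rule: infinite_finite_induct) (auto simp: fun_apply)

lemma fa_word_img_eq: "fa_word_img \<psi> u = fa.wimg \<psi> u"
  by (simp add: fa_word_img_def fa.wimg_def)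

lemma fa_ext_eq: "fa_ext \<psi> f = fa.ext \<psi> f"
  by (auto simp: fa_ext_def fa.ext_def sum_fun_apply fa_word_img_eq fa_smult_def)

lemma FA_finite: "f \<in> FA G \<Longrightarrow> finite {w. f w \<noteq> 0}"
  by (simp add: FA_def)

lemma FA_0 [simp]: "0 \<in> FA G"
  by (simp add: FA_def fun_apply)

lemma FA_word [simp]: "set w \<subseteq> G \<Longrightarrow> fa_word w \<in> FA G"
  by (auto simp: FA_def fa_word_def)

lemma FA_one [simp]: "fa_one \<in> FA G"
  by (simp add: fa_one_eq)

lemma FA_add [simp]: "f \<in> FA G \<Longrightarrow> g \<in> FA G \<Longrightarrow> f + g \<in> FA G"
proof -
  assume *: "f \<in> FA G" "g \<in> FA G"
  have "{w. (f + g) w \<noteq> 0} \<subseteq> {w. f w \<noteq> 0} \<union> {w. g w \<noteq> 0}"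
    by (auto simp: fun_apply)
  then have "finite {w. (f + g) w \<noteq> 0}"
    by (rule finite_subset) (use * in \<open>simp add: FA_def\<close>)
  then show ?thesis
    using * by (auto simp: FA_def fun_apply) (metis add_0 subsetD)
qed

lemma FA_smult [simp]: "f \<in> FA G \<Longrightarrow> fa_smult c f \<in> FA G"
  unfolding FA_def fa_smult_def by (auto elim: rev_finite_subset)

lemma FA_minus [simp]: "f \<in> FA G \<Longrightarrow> - f \<in> FA G"
  using FA_smult[of f G "-1"] by (simp add: fa.sc_minus_left)

lemma FA_diff [simp]: "f \<in> FA G \<Longrightarrow> g \<in> FA G \<Longrightarrow> f - g \<in> FA G"
  using FA_add[of f G "- g"] by simp

lemma FA_mult [simp]:
  assumes "f \<in> FA G" "g \<in> FA G"
  shows "fa_mult f g \<in> FA G"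
proof -
  have *: "\<exists>u v. w = u @ v \<and> f u \<noteq> 0 \<and> g v \<noteq> 0" if "fa_mult f g w \<noteq> 0" for w
  proof -
    obtain i where "f (take i w) * g (drop i w) \<noteq> 0"
      using \<open>fa_mult f g w \<noteq> 0\<close> unfolding fa_mult_def by (meson sum.neutral)
    then show ?thesis
      by (intro exI[of _ "take i w"] exI[of _ "drop i w"]) auto
  qed
  have "{w. fa_mult f g w \<noteq> 0} \<subseteq> (\<lambda>(u, v). u @ v) ` ({w. f w \<noteq> 0} \<times> {w. g w \<noteq> 0})"
    using * by fastforce
  moreover have "finite \<dots>"
    using assms by (simp add: FA_def)
  ultimately have "finite {w. fa_mult f g w \<noteq> 0}"
    by (rule finite_subset)
  moreover have "set w \<subseteq> G" if "fa_mult f g w \<noteq> 0" for w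
    using *[OF that] assms unfolding FA_def by fastforce
  ultimately show ?thesis
    by (simp add: FA_def)
qed

lemma FA_sum: "(\<And>a. a \<in> A \<Longrightarrow> F a \<in> FA G) \<Longrightarrow> sum F A \<in> FA G"
  by (induction A rule: infinite_finite_induct) auto

lemma FA_decomp: "f \<in> FA G \<Longrightarrow> f = (\<Sum>w\<in>{w. f w \<noteq> 0}. fa_smult (f w) (fa_word w))"
proof
  fix x assume "f \<in> FA G"
  then have "finite {w. f w \<noteq> 0}"
    by (rule FA_finite)
  then show "f x = (\<Sum>w\<in>{w. f w \<noteq> 0}. fa_smult (f w) (fa_word w)) x"
    by (auto simp: sum_fun_apply fa_smult_def fa_word_def if_distrib cong: if_cong)
qed

lemma FA_induct [consumes 1, case_names zero word add]:
  assumes "f \<in> FA G" and "P 0"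
    and word: "\<And>c w. set w \<subseteq> G \<Longrightarrow> P (fa_smult c (fa_word w))"
    and add: "\<And>f g. f \<in> FA G \<Longrightarrow> g \<in> FA G \<Longrightarrow> P f \<Longrightarrow> P g \<Longrightarrow> P (f + g)"
  shows "P f"
proof -
  have "finite {w. f w \<noteq> 0}" "\<forall>w\<in>{w. f w \<noteq> 0}. set w \<subseteq> G"
    using assms(1) by (auto simp: FA_def)
  then have "P (\<Sum>w\<in>{w. f w \<noteq> 0}. fa_smult (f w) (fa_word w))"
  proof (induction rule: finite_induct)
    case (insert x F)
    then show ?case
      by (subst sum.insert) (auto intro!: add word FA_sum)
  qed (simp add: \<open>P 0\<close>)
  then show ?thesis
    using FA_decomp[OF assms(1)] by simp
qed

context kalg
begin

lemma ext_superset: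
  assumes "finite A" "{u. f u \<noteq> 0} \<subseteq> A"
  shows "ext \<psi> f = (\<Sum>u\<in>A. sc (f u) (wimg \<psi> u))"
  unfolding ext_def using assms by (intro sum.mono_neutral_left) auto

lemma ext_0 [simp]: "ext \<psi> 0 = 0"
  by (simp add: ext_def fun_apply)

lemma ext_word [simp]: "ext \<psi> (fa_word w) = wimg \<psi> w"
  by (subst ext_superset[of "{w}"]) (auto simp: fa_word_def)

lemma ext_one [simp]: "ext \<psi> fa_one = un"
  by (simp add: fa_one_eq)

lemma ext_add:
  assumes "f \<in> FA G" "g \<in> FA G"
  shows "ext \<psi> (f + g) = ext \<psi> f + ext \<psi> g"
proof -
  let ?A = "{w. f w \<noteq> 0} \<union> {w. g w \<noteq> 0}"
  have "finite ?A"
    using assms by (simp add: FA_def)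
  then show ?thesis
    by (subst (1 2 3) ext_superset[of ?A]) (auto simp: fun_apply sc_add_left sum.distrib)
qed

lemma sc_sum: "sc c (sum F A) = (\<Sum>a\<in>A. sc c (F a))"
  by (induction A rule: infinite_finite_induct) (simp_all add: sc_add_right)

lemma ext_smult:
  assumes "f \<in> FA G"
  shows "ext \<psi> (fa_smult c f) = sc c (ext \<psi> f)"
  by (subst (1 2) ext_superset[of "{w. f w \<noteq> 0}"])
     (use assms in \<open>auto simp: FA_def sc_sum fa_smult_def\<close>)

lemma ext_minus:
  assumes "f \<in> FA G"
  shows "ext \<psi> (- f) = - ext \<psi> f"
  using ext_smult[OF assms, of \<psi> "-1"] by (simp add: fa.sc_minus_left sc_minus_left)

lemma ext_diff:
  assumes "f \<in> FA G" "g \<in> FA G"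
  shows "ext \<psi> (f - g) = ext \<psi> f - ext \<psi> g"
  using ext_add[OF assms(1) FA_minus[OF assms(2)], of \<psi>] ext_minus[OF assms(2), of \<psi>] by simp

lemma ext_mult:
  assumes "f \<in> FA G" "g \<in> FA G"
  shows "ext \<psi> (fa_mult f g) = mu (ext \<psi> f) (ext \<psi> g)"
  using assms(1)
proof (induction rule: FA_induct)
  case (word c u)
  from assms(2) show ?case
  proof (induction rule: FA_induct)
    case (word d v)
    then show ?case
      using \<open>set u \<subseteq> G\<close> by (simp add: ext_smult[of _ UNIV] wimg_append mult.commute)
  next
    case (add f g)
    then show ?case
      using \<open>set u \<subseteq> G\<close> by (simp add: fa.mu_add_right mu_add_right sc_add_right fa.sc_add_right ext_add[of _ G])
  qed simp
next
  case (add f' g')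
  then show ?case
    using assms(2) by (simp add: fa.mu_add_left mu_add_left ext_add[of _ G])
qed simp

end

lemma fa_ext_FA:
  assumes "\<And>g. g \<in> G \<Longrightarrow> \<psi> g \<in> FA H" "f \<in> FA G"
  shows "fa.ext \<psi> f \<in> FA H"
proof -
  have "fa.wimg \<psi> w \<in> FA H" if "set w \<subseteq> G" for w
    using that by (induction w) (simp_all add: assms(1))
  then show ?thesis
    using assms(2) unfolding fa.ext_def by (intro FA_sum FA_smult) (auto simp: FA_def)
qed

lemma fa_ext_fa_ext:
  assumes "\<And>g. g \<in> G \<Longrightarrow> \<psi> g \<in> FA H" "\<And>g. g \<in> G \<Longrightarrow> fa.ext \<psi>' (\<psi> g) = fa_word [g]" "f \<in> FA G"
  shows "fa.ext \<psi>' (fa.ext \<psi> f) = f"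
  using assms(3)
proof (induction rule: FA_induct)
  case (word c w)
  have "fa.wimg \<psi> w \<in> FA H \<and> fa.ext \<psi>' (fa.wimg \<psi> w) = fa_word w"
    using word by (induction w) (simp_all add: assms(1,2) fa.ext_mult[of _ H] flip: fa_one_eq)
  then show ?case
    using word by (simp add: fa.ext_smult[of _ UNIV] fa.ext_smult[of _ H])
next
  case (add f g)
  then show ?case
    by (simp add: fa.ext_add[of _ G] fa.ext_add[of _ H] fa_ext_FA[OF assms(1)])
qed simp

section \<open>Congruence modulo the ideal of relators\<close>

lemma ideal_smult:
  assumes "f \<in> ideal_of G R"
  shows "fa_smult c f \<in> ideal_of G R"
  using ideal_of.lmult[of "fa_smult c fa_one" G f R] assms by simp

lemma ideal_0 [simp]: "0 \<in> ideal_of G R"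
  using ideal_of.zero by (simp add: fa_zero_eq)

lemma ideal_add: "f \<in> ideal_of G R \<Longrightarrow> g \<in> ideal_of G R \<Longrightarrow> f + g \<in> ideal_of G R"
  using ideal_of.add[of f G R g] by (simp add: fa_add_eq)

lemma ideal_minus: "f \<in> ideal_of G R \<Longrightarrow> - f \<in> ideal_of G R"
  using ideal_smult[of f G R "-1"] by (simp add: fa.sc_minus_left)

lemma ideal_FA: "R \<subseteq> FA G \<Longrightarrow> f \<in> ideal_of G R \<Longrightarrow> f \<in> FA G"
  by (erule ideal_of.induct) (auto simp: fa_zero_eq fa_add_eq)

lemma cong_iff: "fa_cong G R f g \<longleftrightarrow> f - g \<in> ideal_of G R"
  by (simp add: fa_cong_def fa_sub_eq)

lemma cong_refl [simp]: "fa_cong G R f f"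
  by (simp add: cong_iff)

lemma cong_sym: "fa_cong G R f g \<Longrightarrow> fa_cong G R g f"
  using ideal_minus[of "f - g" G R] by (simp add: cong_iff)

lemma cong_trans [trans]: "fa_cong G R f g \<Longrightarrow> fa_cong G R g h \<Longrightarrow> fa_cong G R f h"
  using ideal_add[of "f - g" G R "g - h"] by (simp add: cong_iff)

lemma cong_add: "fa_cong G R f g \<Longrightarrow> fa_cong G R f' g' \<Longrightarrow> fa_cong G R (f + f') (g + g')"
  using ideal_add[of "f - g" G R "f' - g'"] by (simp add: cong_iff add.commute add.left_commute diff_diff_eq add_diff_eq diff_add_eq)

lemma cong_smult: "fa_cong G R f g \<Longrightarrow> fa_cong G R (fa_smult c f) (fa_smult c g)"
  using ideal_smult[of "f - g" G R c] by (simp add: cong_iff fa.sc_diff_right)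

lemma cong_mult_left: "a \<in> FA G \<Longrightarrow> fa_cong G R f g \<Longrightarrow> fa_cong G R (fa_mult a f) (fa_mult a g)"
  using ideal_of.lmult[of a G "f - g" R] by (simp add: cong_iff fa.mu_diff_right)

lemma cong_mult_right: "a \<in> FA G \<Longrightarrow> fa_cong G R f g \<Longrightarrow> fa_cong G R (fa_mult f a) (fa_mult g a)"
  using ideal_of.rmult[of a G "f - g" R] by (simp add: cong_iff fa.mu_diff_left)

lemma fa_ext_ideal:
  assumes \<psi>: "\<And>g. g \<in> G \<Longrightarrow> \<psi> g \<in> FA H" and R: "R \<subseteq> FA G"
    and rel: "\<And>r. r \<in> R \<Longrightarrow> fa.ext \<psi> r \<in> ideal_of H R'"
    and f: "f \<in> ideal_of G R"
  shows "fa.ext \<psi> f \<in> ideal_of H R'"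
  using f
proof (induction rule: ideal_of.induct)
  case (add f g)
  then show ?case
    by (simp add: fa_add_eq fa.ext_add[of _ G] ideal_FA[OF R] ideal_add)
next
  case (lmult a f)
  then show ?case
    by (simp add: fa.ext_mult[of _ G] ideal_FA[OF R] ideal_of.lmult fa_ext_FA[OF \<psi>])
next
  case (rmult a f)
  then show ?case
    by (simp add: fa.ext_mult[of _ G] ideal_FA[OF R] ideal_of.rmult fa_ext_FA[OF \<psi>])
qed (simp_all add: rel fa_zero_eq)

lemma (in kalg) ext_ideal:
  assumes R: "R \<subseteq> FA G" and rel: "\<And>r. r \<in> R \<Longrightarrow> ext \<psi> r = 0" and f: "f \<in> ideal_of G R"
  shows "ext \<psi> f = 0"
  using f
  by (induction rule: ideal_of.induct)
     (simp_all add: rel fa_zero_eq fa_add_eq ext_add[of _ G] ext_mult[of _ G] ideal_FA[OF R])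

section \<open>The relations of \<open>A[t]\<close>\<close>

text \<open>Sorted words read t^a y_1^{b_1} x_1^{c_1} y_2^{b_2} and so on; these are the normal
  forms. The offsets 1 and 2 keep the rank injective at index 0, where the value 0 is taken by
  \<open>T\<close>.\<close>

primrec qgen_rank :: "qgen \<Rightarrow> nat" where
  "qgen_rank (X k) = 2 * k + 2"
| "qgen_rank (Y k) = 2 * k + 1"
| "qgen_rank T = 0"

lemma qgen_rank_inj: "qgen_rank a = qgen_rank b \<Longrightarrow> a = b"
  by (cases a; cases b; simp; presburger)

instantiation qgen :: linorder
begin

definition "a \<le> b \<longleftrightarrow> qgen_rank a \<le> qgen_rank b"
definition "a < b \<longleftrightarrow> qgen_rank a < qgen_rank b"

instance
  by standard (auto simp: less_eq_qgen_def less_qgen_def intro: qgen_rank_inj)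

end

lemma mon2_eq: "mon2 a b = fa_word [a, b]"
  by (simp add: mon2_def fa_gen_eq)

lemma qwt_gens_simps [simp]:
  "X i \<in> qwt_gens n \<longleftrightarrow> i \<in> {1..n}" "Y i \<in> qwt_gens n \<longleftrightarrow> i \<in> {1..n}" "T \<in> qwt_gens n"
  by (auto simp: qwt_gens_def qw_gens_def)

lemma qwt_rels_FA: "qwt_rels n q lam \<subseteq> FA (qwt_gens n)"
  by (auto simp: qwt_rels_def qw_rels_def mon2_eq fa_sub_eq)
     (auto simp: qw_gens_def)

locale qparams =
  fixes n :: nat and q :: "nat \<Rightarrow> 'k::field" and lam :: "nat \<Rightarrow> nat \<Rightarrow> 'k"
  assumes params: "qw_params n q lam"
begin

abbreviation G where "G \<equiv> qwt_gens n"
abbreviation R where "R \<equiv> qwt_rels n q lam"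
abbreviation eqv (infix \<open>\<approx>\<close> 50) where "f \<approx> g \<equiv> fa_cong G R f g"

lemma q_nz: "i \<in> {1..n} \<Longrightarrow> q i \<noteq> 0"
  and lam_diag: "i \<in> {1..n} \<Longrightarrow> lam i i = 1"
  and lam_nz: "i \<in> {1..n} \<Longrightarrow> j \<in> {1..n} \<Longrightarrow> lam i j \<noteq> 0"
  and lam_inv: "i \<in> {1..n} \<Longrightarrow> j \<in> {1..n} \<Longrightarrow> inverse (lam i j) = lam j i"
  using params unfolding qw_params_def by metis+

text \<open>The relators are listed for i < j only. Solving for the reversed product inverts the
  factor, and \<open>lam j i\<close> is the inverse of \<open>lam i j\<close>, so each relation
  extends to all distinct indices.\<close>

lemma eqv_flip:
  assumes "f \<approx> fa_smult c g" "c \<noteq> 0"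
  shows "g \<approx> fa_smult (inverse c) f"
  using cong_sym[OF cong_smult[OF assms(1), of "inverse c"]] assms(2) by simp

lemma rel_xx:
  assumes "i \<in> {1..n}" "j \<in> {1..n}" "i \<noteq> j"
  shows "fa_word [X i, X j] \<approx> fa_smult (lam i j) (fa_word [X j, X i])"
proof -
  have *: "fa_word [X i, X j] \<approx> fa_smult (lam i j) (fa_word [X j, X i])"
    if "i < j" "i \<in> {1..n}" "j \<in> {1..n}" for i j
    unfolding cong_iff
    by (rule ideal_of.base) (use that in \<open>force simp: qwt_rels_def qw_rels_def mon2_eq fa_sub_eq\<close>)
  show ?thesis
    using assms eqv_flip[OF *[of j i]] by (cases "i < j") (auto simp: * lam_nz lam_inv)
qed

lemma rel_yy:
  assumes "i \<in> {1..n}" "j \<in> {1..n}" "i \<noteq> j"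
  shows "fa_word [Y i, Y j] \<approx> fa_smult (lam i j) (fa_word [Y j, Y i])"
proof -
  have *: "fa_word [Y i, Y j] \<approx> fa_smult (lam i j) (fa_word [Y j, Y i])"
    if "j < i" "i \<in> {1..n}" "j \<in> {1..n}" for i j
    unfolding cong_iff
    by (rule ideal_of.base) (use that in \<open>force simp: qwt_rels_def qw_rels_def mon2_eq fa_sub_eq\<close>)
  show ?thesis
    using assms eqv_flip[OF *[of i j]] eqv_flip[OF *[of j i]]
    by (cases "i < j") (auto simp: * lam_nz lam_inv)
qed

lemma rel_xy:
  assumes "i \<in> {1..n}" "j \<in> {1..n}" "i \<noteq> j"
  shows "fa_word [X i, Y j] \<approx> fa_smult (lam j i) (fa_word [Y j, X i])"
proof -
  have "i < j \<or> j < i"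
    using assms by auto
  then show ?thesis
    unfolding cong_iff
    by (intro ideal_of.base) (use assms in \<open>force simp: qwt_rels_def qw_rels_def mon2_eq fa_sub_eq\<close>)
qed

lemma rel_yx:
  assumes "i \<in> {1..n}" "j \<in> {1..n}" "i \<noteq> j"
  shows "fa_word [Y j, X i] \<approx> fa_smult (lam i j) (fa_word [X i, Y j])"
  using eqv_flip[OF rel_xy[OF assms]] assms by (simp add: lam_nz lam_inv)

lemma rel_weyl:
  assumes "i \<in> {1..n}"
  shows "fa_word [X i, Y i] \<approx> fa_smult (q i) (fa_word [Y i, X i]) + fa_one"
  unfolding cong_iff
  by (rule ideal_of.base)
     (use assms in \<open>force simp: qwt_rels_def qw_rels_def mon2_eq fa_sub_eq diff_diff_eq\<close>)

lemma rel_T: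
  assumes "g \<in> G"
  shows "fa_word [T, g] \<approx> fa_word [g, T]"
proof (cases "g = T")
  case False
  then show ?thesis
    unfolding cong_iff
    by (intro ideal_of.base)
       (use assms in \<open>force simp: qwt_rels_def qwt_gens_def mon2_eq fa_sub_eq\<close>)
qed simp

section \<open>Sorted words span modulo the relations\<close>

text \<open>Only the pair x_i, y_i produces a constant term. That term is two letters shorter than
  the word it comes from, which lets straightening recur on the length.\<close>

lemma eqv_swap:
  assumes "g \<in> G" "h \<in> G"
  shows "\<exists>c d. fa_word [g, h] \<approx> fa_smult c (fa_word [h, g]) + fa_smult d fa_one"
proof -
  have *: ?thesis if "fa_word [g, h] \<approx> fa_smult c (fa_word [h, g])" for c
    using that by (intro exI[of _ c] exI[of _ 0]) simp
  have **: ?thesis if "fa_word [g, h] \<approx> fa_word [h, g]"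
    using that *[of 1] by simp
  have yx: "fa_word [Y i, X i] \<approx> fa_smult (inverse (q i)) (fa_word [X i, Y i])
      + fa_smult (- inverse (q i)) fa_one" if "i \<in> {1..n}" for i
    using cong_sym[OF cong_smult[OF cong_add[OF rel_weyl[OF that] cong_refl[of _ _ "- fa_one"]], of "inverse (q i)"]]
      q_nz[OF that]
    by (simp add: fa.bilinear)
  show ?thesis
  proof (cases "g = h \<or> g = T \<or> h = T")
    case True
    then show ?thesis
      using ** rel_T[of h] cong_sym[OF rel_T[of g]] assms by auto
  next
    case False
    then show ?thesis
    proof (cases g; cases h)
      fix i j assume gh: "g = X i" "h = Y j"
      show ?thesis
      proof (cases "i = j")
        case True
        then show ?thesis
          using rel_weyl[of i] assms gh by (intro exI[of _ "q i"] exI[of _ 1]) auto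
      qed (use *[of "lam j i"] rel_xy[of i j] assms gh in auto)
    next
      fix i j assume gh: "g = Y i" "h = X j"
      show ?thesis
      proof (cases "i = j")
        case True
        then show ?thesis
          using yx[of i] assms gh by (intro exI[of _ "inverse (q i)"] exI[of _ "- inverse (q i)"]) auto
      qed (use *[of "lam j i"] rel_yx[of j i] assms gh in auto)
    next
      fix i j assume "g = X i" "h = X j"
      then show ?thesis
        using False assms *[of "lam i j"] rel_xx[of i j] by simp
    next
      fix i j assume "g = Y i" "h = Y j"
      then show ?thesis
        using False assms *[of "lam i j"] rel_yy[of i j] by simp
    qed (use False in simp_all)
  qed
qed

text \<open>The set of letters is recorded besides the length: once a smallest letter has been moved
  to the front, straightening the rest brings in no smaller letter, so the front letter can
  stay.\<close>

definition sorted_span :: "qgen set \<Rightarrow> nat \<Rightarrow> (qgen, 'k) fa set" where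
  "sorted_span A l = {h \<in> FA A. \<forall>u. h u \<noteq> 0 \<longrightarrow> sorted u \<and> length u \<le> l}"

lemma sorted_span_0: "0 \<in> sorted_span A l"
  by (simp add: sorted_span_def fun_apply)

lemma sorted_span_word:
  "sorted w \<Longrightarrow> set w \<subseteq> A \<Longrightarrow> length w \<le> l \<Longrightarrow> fa_word w \<in> sorted_span A l"
  by (simp add: sorted_span_def) (simp add: fa_word_def)

lemma sorted_span_add:
  assumes "f \<in> sorted_span A l" "g \<in> sorted_span A l"
  shows "f + g \<in> sorted_span A l"
proof -
  have "sorted u \<and> length u \<le> l" if "(f + g) u \<noteq> 0" for u
    using that assms by (cases "f u = 0") (auto simp: sorted_span_def fun_apply)
  then show ?thesis
    using assms by (simp add: sorted_span_def)
qed

lemma sorted_span_smult: "f \<in> sorted_span A l \<Longrightarrow> fa_smult c f \<in> sorted_span A l"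
  by (simp add: sorted_span_def) (auto simp: fa_smult_def)

lemma FA_mono: "A \<subseteq> B \<Longrightarrow> f \<in> FA A \<Longrightarrow> f \<in> FA B"
  by (auto simp: FA_def)

lemma sorted_span_mono: "A \<subseteq> B \<Longrightarrow> l \<le> l' \<Longrightarrow> f \<in> sorted_span A l \<Longrightarrow> f \<in> sorted_span B l'"
  by (auto simp: sorted_span_def intro: FA_mono order_trans)

text \<open>The prefix a serves for putting a letter in front of a straightened tail and, as
  \<open>fa_one\<close>, for plain combinations of words.\<close>

lemma eqv_linear_extend:
  assumes "f \<in> FA A" and "\<And>u. f u \<noteq> 0 \<Longrightarrow> \<exists>h\<in>sorted_span B l. fa_mult a (fa_word u) \<approx> h"
  shows "\<exists>h\<in>sorted_span B l. fa_mult a f \<approx> h"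
proof -
  have "\<exists>h\<in>sorted_span B l. fa_mult a (\<Sum>w\<in>W. fa_smult (f w) (fa_word w)) \<approx> h"
    if "finite W" "\<forall>w\<in>W. f w \<noteq> 0" for W
    using that
  proof (induction rule: finite_induct)
    case empty
    show ?case
      by (rule bexI[OF _ sorted_span_0]) simp
  next
    case (insert w W)
    obtain h1 where h1: "h1 \<in> sorted_span B l" "fa_mult a (\<Sum>w\<in>W. fa_smult (f w) (fa_word w)) \<approx> h1"
      using insert by auto
    obtain h2 where h2: "h2 \<in> sorted_span B l" "fa_mult a (fa_word w) \<approx> h2"
      using insert assms(2) by auto
    show ?case
      using insert cong_add[OF cong_smult[OF h2(2), of "f w"] h1(2)]
      by (intro bexI[of _ "fa_smult (f w) h2 + h1"])
         (simp_all add: fa.mu_add_right sorted_span_add sorted_span_smult h1 h2)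
  qed
  from this[OF FA_finite[OF assms(1)]] show ?thesis
    using FA_decomp[OF assms(1)] by simp
qed

text \<open>Induction on the length alone. If the sorted tail starts with b < g, a swap leaves b
  followed by g v', plus a multiple of v'. Both g v' and v' are shorter than w, so they straighten
  by induction; the letters of g v' are all at least b, so the words obtained from it remain sorted
  with b in front.\<close>

lemma word_sorted_span: "set w \<subseteq> G \<Longrightarrow> \<exists>h\<in>sorted_span (set w) (length w). fa_word w \<approx> h"
proof (induction "length w" arbitrary: w rule: less_induct)
  case less
  show ?case
  proof (cases w)
    case Nil
    then show ?thesis
      by (intro bexI[of _ "fa_word []"] sorted_span_word) simp_all
  next
    case (Cons g w')
    obtain h' where h': "h' \<in> sorted_span (set w') (length w')" "fa_word w' \<approx> h'"
      using less.hyps[of w'] less.prems Cons by auto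
    have key: "\<exists>h\<in>sorted_span (set w) (length w). fa_word (g # v) \<approx> h"
      if v: "sorted v" "set v \<subseteq> set w'" "length v \<le> length w'" for v
    proof (cases "sorted (g # v)")
      case True
      then show ?thesis
        using Cons v by (intro bexI[of _ "fa_word (g # v)"] sorted_span_word) auto
    next
      case False
      with \<open>sorted v\<close> obtain b v' where v': "v = b # v'" "b < g"
        by (cases v) fastforce+
      have GG: "g \<in> G" "b \<in> G" "set v' \<subseteq> G"
        using less.prems Cons v v' by auto
      have "length v' < length w" "length (g # v') < length w"
        using v v' Cons by auto
      then obtain h1 h2 where h1: "h1 \<in> sorted_span (set v') (length v')" "fa_word v' \<approx> h1"
        and h2: "h2 \<in> sorted_span (set (g # v')) (length (g # v'))" "fa_word (g # v') \<approx> h2"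
        using less.hyps[of v'] less.hyps[of "g # v'"] GG by auto
      obtain c d where "fa_word [g, b] \<approx> fa_smult c (fa_word [b, g]) + fa_smult d fa_one"
        using eqv_swap GG by blast
      from cong_mult_right[OF _ this, of "fa_word v'"] GG
      have "fa_word (g # v) \<approx> fa_smult c (fa_word (b # g # v')) + fa_smult d (fa_word v')"
        by (simp add: fa.mu_add_left v')
      also have "fa_smult c (fa_word (b # g # v')) + fa_smult d (fa_word v')
          \<approx> fa_smult c (fa_mult (fa_word [b]) h2) + fa_smult d h1"
        using cong_mult_left[of "fa_word [b]" G R "fa_word (g # v')" h2] GG h1 h2
        by (intro cong_add cong_smult) auto
      finally have "fa_word (g # v) \<approx> fa_smult c (fa_mult (fa_word [b]) h2) + fa_smult d h1" .
      moreover have "fa_mult (fa_word [b]) h2 \<in> sorted_span (set w) (length w)"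
      proof -
        have "sorted u \<and> length u \<le> length w" if "fa_mult (fa_word [b]) h2 u \<noteq> 0" for u
        proof -
          have "take 1 u = [b]" and nz: "h2 (drop 1 u) \<noteq> 0"
            using that by (auto simp: fa_mult_word_left split: if_splits)
          then obtain u' where u': "u = b # u'"
            by (cases u) auto
          then have u'': "sorted u'" "length u' \<le> length (g # v')" "set u' \<subseteq> set (g # v')"
            using h2(1) nz by (auto simp: sorted_span_def FA_def)
          moreover have "\<forall>x\<in>set (g # v'). b \<le> x"
            using v v' by auto
          ultimately show ?thesis
            using u' v v' Cons by auto
        qed
        moreover have "fa_mult (fa_word [b]) h2 \<in> FA (set w)"
          using h2(1) v v' Cons FA_mono[of "set (g # v')" "set w" h2]
          by (intro FA_mult FA_word) (auto simp: sorted_span_def)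
        ultimately show ?thesis
          by (simp add: sorted_span_def)
      qed
      moreover have "h1 \<in> sorted_span (set w) (length w)"
        using v v' Cons by (intro sorted_span_mono[OF _ _ h1(1)]) auto
      ultimately show ?thesis
        by (intro bexI[of _ "fa_smult c (fa_mult (fa_word [b]) h2) + fa_smult d h1"]
            sorted_span_add sorted_span_smult)
    qed
    have "\<exists>h\<in>sorted_span (set w) (length w). fa_mult (fa_word [g]) h' \<approx> h"
      using h'(1) key by (intro eqv_linear_extend[of h' "set w'"]) (auto simp: sorted_span_def FA_def)
    moreover have "fa_word w \<approx> fa_mult (fa_word [g]) h'"
      using cong_mult_left[OF _ h'(2), of "fa_word [g]"] less.prems Cons by simp
    ultimately show ?thesis
      using cong_trans by blast
  qed
qed

lemma eqv_sorted:
  assumes "f \<in> FA G"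
  obtains h where "h \<in> FA G" "f \<approx> h" "\<And>u. h u \<noteq> 0 \<Longrightarrow> sorted u"
proof -
  have fin: "finite {w. f w \<noteq> 0}"
    using assms by (rule FA_finite)
  define L where "L = Max (length ` {w. f w \<noteq> 0})"
  have "\<exists>h\<in>sorted_span G L. fa_mult fa_one (fa_word u) \<approx> h" if u: "f u \<noteq> 0" for u
  proof -
    have "set u \<subseteq> G"
      using assms u by (simp add: FA_def)
    moreover have "length u \<le> L"
      unfolding L_def using fin u by (intro Max_ge) auto
    ultimately show ?thesis
      using word_sorted_span[of u] sorted_span_mono[of "set u" G "length u" L] by auto
  qed
  from eqv_linear_extend[OF assms this] obtain h where "h \<in> sorted_span G L" "f \<approx> h"
    by auto
  then show ?thesis
    using that by (auto simp: sorted_span_def)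
qed

end

section \<open>The explicit isomorphisms\<close>

text \<open>Injectivity on classes comes from the inverse substitution, which carries the target
  ideal back into the source ideal. The two substitutions are required to be inverse already in the
  free algebras; the explicit maps satisfy this because they only permute and scale generators and
  shift t.\<close>

lemma is_alg_iso_fa_ext:
  assumes \<psi>: "\<And>g. g \<in> G \<Longrightarrow> \<psi> g \<in> FA H" and \<psi>': "\<And>g. g \<in> H \<Longrightarrow> \<psi>' g \<in> FA G"
    and R: "R \<subseteq> FA G" "R' \<subseteq> FA H"
    and rel: "\<And>r. r \<in> R \<Longrightarrow> fa.ext \<psi> r \<in> ideal_of H R'"
    and rel': "\<And>r. r \<in> R' \<Longrightarrow> fa.ext \<psi>' r \<in> ideal_of G R"
    and inv: "\<And>g. g \<in> G \<Longrightarrow> fa.ext \<psi>' (\<psi> g) = fa_word [g]"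
    and inv': "\<And>g. g \<in> H \<Longrightarrow> fa.ext \<psi> (\<psi>' g) = fa_word [g]"
  shows "is_alg_iso G R H R' (fa_ext \<psi>)"
proof -
  have img: "fa.ext \<psi> f \<in> ideal_of H R'" if "f \<in> ideal_of G R" for f
    using fa_ext_ideal[OF \<psi> R(1) rel that] by blast
  have img': "fa.ext \<psi>' f \<in> ideal_of G R" if "f \<in> ideal_of H R'" for f
    using fa_ext_ideal[OF \<psi>' R(2) rel' that] by blast
  have retract: "fa.ext \<psi>' (fa.ext \<psi> f) = f" if "f \<in> FA G" for f
    using fa_ext_fa_ext[OF \<psi> inv that] by blast
  have "fa_cong G R f g \<longleftrightarrow> fa_cong H R' (fa.ext \<psi> f) (fa.ext \<psi> g)" if fg: "f \<in> FA G" "g \<in> FA G" for f g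
    unfolding cong_iff fa.ext_diff[OF fg, symmetric]
    using img[of "f - g"] img'[of "fa.ext \<psi> (f - g)"] retract[OF FA_diff[OF fg]] by auto
  moreover have "\<exists>f\<in>FA G. fa_cong H R' (fa.ext \<psi> f) h" if "h \<in> FA H" for h
  proof
    show "fa.ext \<psi>' h \<in> FA G"
      by (rule fa_ext_FA[of H]) (simp_all add: \<psi>' that)
    have "fa.ext \<psi> (fa.ext \<psi>' h) = h"
      using fa_ext_fa_ext[OF \<psi>' inv' that] by blast
    then show "fa_cong H R' (fa.ext \<psi> (fa.ext \<psi>' h)) h"
      by simp
  qed
  ultimately show ?thesis
    unfolding is_alg_iso_def fa_ext_eq
    by (simp add: fa_add_eq fa.ext_add[of _ G] fa.ext_smult[of _ G] fa.ext_mult[of _ G] fa_ext_FA[OF \<psi>])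
qed

text \<open>Outside \<open>P1\<close> the scalar on \<open>Y i\<close> is forced by the Weyl
  relation: with parameter \<open>inverse (q i)\<close> in the target one has y' x' - q_i x' y' =
  -q_i, so the scalars of \<open>X i\<close> and \<open>Y i\<close> must have product
  \<open>- inverse (q i)\<close>.\<close>

definition iso_gen ::
  "(nat \<Rightarrow> 'k::field) \<Rightarrow> nat set \<Rightarrow> (nat \<Rightarrow> nat) \<Rightarrow> (nat \<Rightarrow> 'k) \<Rightarrow> 'k \<Rightarrow> 'k \<Rightarrow> qgen \<Rightarrow> (qgen, 'k) fa" where
  "iso_gen q P1 \<sigma> \<alpha> a b g = (case g of
       X i \<Rightarrow> if i \<in> P1 then fa_smult (\<alpha> i) (fa_gen (X (\<sigma> i)))
              else fa_smult (\<alpha> i) (fa_gen (Y (\<sigma> i)))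
     | Y i \<Rightarrow> if i \<in> P1 then fa_smult (inverse (\<alpha> i)) (fa_gen (Y (\<sigma> i)))
              else fa_smult (- inverse (q i * \<alpha> i)) (fa_gen (X (\<sigma> i)))
     | T \<Rightarrow> fa_add (fa_smult a (fa_gen T)) (fa_smult b fa_one))"

definition compatible ::
  "nat \<Rightarrow> (nat \<Rightarrow> 'k::field) \<Rightarrow> (nat \<Rightarrow> nat \<Rightarrow> 'k) \<Rightarrow> (nat \<Rightarrow> 'k) \<Rightarrow> (nat \<Rightarrow> nat \<Rightarrow> 'k)
    \<Rightarrow> nat set \<Rightarrow> nat set \<Rightarrow> (nat \<Rightarrow> nat) \<Rightarrow> bool" where
  "compatible n q lam q' lam' P1 P2 \<sigma> \<longleftrightarrow>
     P1 \<union> P2 = {1..n} \<and> P1 \<inter> P2 = {} \<and> bij_betw \<sigma> {1..n} {1..n} \<and>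
     (\<forall>i\<in>P1. q' (\<sigma> i) = q i) \<and>
     (\<forall>i\<in>P2. q' (\<sigma> i) = inverse (q i)) \<and>
     (\<forall>i\<in>P1. \<forall>j\<in>P1. lam' (\<sigma> i) (\<sigma> j) = lam i j) \<and>
     (\<forall>i\<in>P2. \<forall>j\<in>P2. lam' (\<sigma> i) (\<sigma> j) = lam i j) \<and>
     (\<forall>i\<in>P1. \<forall>j\<in>P2. lam' (\<sigma> j) (\<sigma> i) = lam i j)"

text \<open>The inverse of an explicit isomorphism is again of the explicit form, so
  \<open>iso_gen_rels\<close> can be used in both directions. Only the mixed condition turns round,
  and inverting the entries of both matrices restores its direction.\<close>

lemma compatible_inverse:
  assumes c: "compatible n q lam q' lam' P1 P2 \<sigma>"
    and "qw_params n q lam" "qw_params n q' lam'"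
  shows "compatible n q' lam' q lam (\<sigma> ` P1) (\<sigma> ` P2) (inv_into {1..n} \<sigma>)"
proof -
  have bij: "bij_betw \<sigma> {1..n} {1..n}" and P: "P1 \<union> P2 = {1..n}" "P1 \<inter> P2 = {}"
    using c by (auto simp: compatible_def)
  then have inj: "inj_on \<sigma> {1..n}"
    by (simp add: bij_betw_def)
  define \<tau> where "\<tau> = inv_into {1..n} \<sigma>"
  have tau: "\<tau> (\<sigma> i) = i" if "i \<in> P1 \<or> i \<in> P2" for i
    unfolding \<tau>_def using inj P that by (intro inv_into_f_f) auto
  have im: "\<sigma> ` P1 \<union> \<sigma> ` P2 = {1..n}" "\<sigma> ` P1 \<inter> \<sigma> ` P2 = {}"
    using P bij inj_on_image_Int[OF inj, of P1 P2] by (auto simp: bij_betw_def simp flip: image_Un)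
  interpret A: qparams n q lam by unfold_locales fact
  interpret C: qparams n q' lam' by unfold_locales fact
  have "lam j i = lam' (\<sigma> i) (\<sigma> j)" if "i \<in> P1" "j \<in> P2" for i j
  proof -
    have "i \<in> {1..n}" "j \<in> {1..n}" "\<sigma> i \<in> {1..n}" "\<sigma> j \<in> {1..n}" "lam' (\<sigma> j) (\<sigma> i) = lam i j"
      using that P im c by (auto simp: compatible_def)
    then show ?thesis
      using A.lam_inv[of i j] C.lam_inv[of "\<sigma> j" "\<sigma> i"] by simp
  qed
  then show ?thesis
    using c im bij_betw_inv_into[OF bij] unfolding \<tau>_def[symmetric]
    by (auto simp: compatible_def tau)
qed

text \<open>\<open>compatible\<close> describes the mixed case with one fixed order of the parts.
  Here \<open>lam'\<close> always carries \<sigma> i first, which for i in \<open>P1\<close> costs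
  an inversion of both entries.\<close>

lemma compatible_lam:
  assumes c: "compatible n q lam q' lam' P1 P2 \<sigma>"
    and "qw_params n q lam" "qw_params n q' lam'"
    and ij: "i \<in> {1..n}" "j \<in> {1..n}"
  shows "(i \<in> P1) = (j \<in> P1) \<Longrightarrow> lam' (\<sigma> i) (\<sigma> j) = lam i j"
    and "(i \<in> P1) \<noteq> (j \<in> P1) \<Longrightarrow> lam' (\<sigma> i) (\<sigma> j) = lam j i"
proof -
  interpret A: qparams n q lam by unfold_locales fact
  interpret C: qparams n q' lam' by unfold_locales fact
  have P: "i \<in> P1 \<or> i \<in> P2" "j \<in> P1 \<or> j \<in> P2" "\<sigma> i \<in> {1..n}" "\<sigma> j \<in> {1..n}"
    using c ij by (auto simp: compatible_def bij_betw_def)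
  show "lam' (\<sigma> i) (\<sigma> j) = lam i j" if "(i \<in> P1) = (j \<in> P1)"
    using that P c by (auto simp: compatible_def)
  show "lam' (\<sigma> i) (\<sigma> j) = lam j i" if "(i \<in> P1) \<noteq> (j \<in> P1)"
  proof (cases "i \<in> P1")
    case True
    then have "lam' (\<sigma> j) (\<sigma> i) = lam i j"
      using that P c by (auto simp: compatible_def)
    then show ?thesis
      using A.lam_inv[of i j] C.lam_inv[of "\<sigma> j" "\<sigma> i"] P ij by simp
  next
    case False
    then show ?thesis
      using that P c by (auto simp: compatible_def)
  qed
qed

lemma iso_gen_FA:
  assumes "bij_betw \<sigma> {1..n} {1..n}" "g \<in> qwt_gens n"
  shows "iso_gen q P1 \<sigma> \<alpha> a b g \<in> FA (qwt_gens n)"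
proof -
  have "\<sigma> i \<in> {1..n}" if "i \<in> {1..n}" for i
    using assms that by (auto simp: bij_betw_def)
  then show ?thesis
    using assms(2) by (cases g) (simp_all add: iso_gen_def fa_gen_eq fa_add_eq)
qed

text \<open>Each x_i and y_i goes to a multiple of a single generator. Relations between different
  indices are homogeneous in each generator, so the multiples factor out of them; only the Weyl
  relation constrains the scalars.\<close>

lemma iso_gen_rels:
  assumes c: "compatible n q lam q' lam' P1 P2 \<sigma>"
    and par: "qw_params n q lam" "qw_params n q' lam'"
    and \<alpha>: "\<forall>i\<in>{1..n}. \<alpha> i \<noteq> 0"
    and r: "r \<in> qwt_rels n q lam"
  shows "fa.ext (iso_gen q P1 \<sigma> \<alpha> a b) r \<in> ideal_of (qwt_gens n) (qwt_rels n q' lam')"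
proof -
  interpret A: qparams n q lam by unfold_locales fact
  interpret C: qparams n q' lam' by unfold_locales fact
  let ?\<psi> = "iso_gen q P1 \<sigma> \<alpha> a b"
  let ?I = "ideal_of (qwt_gens n) (qwt_rels n q' lam')"
  define hX where "hX i = (if i \<in> P1 then X (\<sigma> i) else Y (\<sigma> i))" for i
  define hY where "hY i = (if i \<in> P1 then Y (\<sigma> i) else X (\<sigma> i))" for i
  define cY where "cY i = (if i \<in> P1 then inverse (\<alpha> i) else - inverse (q i * \<alpha> i))" for i
  have \<psi>X: "?\<psi> (X i) = fa_smult (\<alpha> i) (fa_word [hX i])"
    and \<psi>Y: "?\<psi> (Y i) = fa_smult (cY i) (fa_word [hY i])" for i
    by (simp_all add: iso_gen_def hX_def hY_def cY_def fa_gen_eq)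
  have \<psi>T: "?\<psi> T = fa_smult a (fa_word [T]) + fa_smult b fa_one"
    by (simp add: iso_gen_def fa_gen_eq fa_add_eq)
  have bij: "bij_betw \<sigma> {1..n} {1..n}"
    using c unfolding compatible_def by blast
  have inj: "\<sigma> i \<noteq> \<sigma> j" if "i \<in> {1..n}" "j \<in> {1..n}" "i \<noteq> j" for i j
    using bij that unfolding bij_betw_def inj_on_def by blast
  have \<sigma>: "\<sigma> i \<in> {1..n}" if "i \<in> {1..n}" for i
    using bij that by (rule bij_betw_apply)
  have word2: "fa.ext ?\<psi> (fa_word [g, h] - fa_smult d (fa_word [h, g])) =
      fa_mult (?\<psi> g) (?\<psi> h) - fa_smult d (fa_mult (?\<psi> h) (?\<psi> g))" for g h d
    by (simp add: fa.ext_diff[of _ UNIV] fa.ext_smult[of _ UNIV])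
  have scal: "fa_mult (fa_smult s (fa_word [g])) (fa_smult t (fa_word [h]))
      - fa_smult d (fa_mult (fa_smult t (fa_word [h])) (fa_smult s (fa_word [g]))) \<in> ?I"
    if "C.eqv (fa_word [g, h]) (fa_smult d (fa_word [h, g]))" for s t d g h
    using ideal_smult[OF that[unfolded cong_iff], of "s * t"]
    by (simp add: fa.sc_diff_right mult_ac)
  \<comment> \<open>In the mixed cases two inversions cancel: x' and y' of different index commute
    by the inverse of the factor for x' and x', and \<open>compatible_lam\<close> inverts the entry
    of \<open>lam'\<close>.\<close>
  have XX: "C.eqv (fa_word [hX i, hX j]) (fa_smult (lam i j) (fa_word [hX j, hX i]))"
    if "i \<in> {1..n}" "j \<in> {1..n}" "i \<noteq> j" for i j
    using that compatible_lam[OF c par, of i j] compatible_lam[OF c par, of j i]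
      C.rel_xx[of "\<sigma> i" "\<sigma> j"] C.rel_yy[of "\<sigma> i" "\<sigma> j"] C.rel_xy[of "\<sigma> i" "\<sigma> j"]
      C.rel_yx[of "\<sigma> j" "\<sigma> i"] inj[of i j] \<sigma>
    by (cases "i \<in> P1"; cases "j \<in> P1") (simp_all add: hX_def)
  have YY: "C.eqv (fa_word [hY i, hY j]) (fa_smult (lam i j) (fa_word [hY j, hY i]))"
    if "i \<in> {1..n}" "j \<in> {1..n}" "i \<noteq> j" for i j
    using that compatible_lam[OF c par, of i j] compatible_lam[OF c par, of j i]
      C.rel_xx[of "\<sigma> i" "\<sigma> j"] C.rel_yy[of "\<sigma> i" "\<sigma> j"] C.rel_xy[of "\<sigma> i" "\<sigma> j"]
      C.rel_yx[of "\<sigma> j" "\<sigma> i"] inj[of i j] \<sigma>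
    by (cases "i \<in> P1"; cases "j \<in> P1") (simp_all add: hY_def)
  have XY: "C.eqv (fa_word [hX i, hY j]) (fa_smult (lam j i) (fa_word [hY j, hX i]))"
    if "i \<in> {1..n}" "j \<in> {1..n}" "i \<noteq> j" for i j
    using that compatible_lam[OF c par, of i j] compatible_lam[OF c par, of j i]
      C.rel_xx[of "\<sigma> i" "\<sigma> j"] C.rel_yy[of "\<sigma> i" "\<sigma> j"] C.rel_xy[of "\<sigma> i" "\<sigma> j"]
      C.rel_yx[of "\<sigma> j" "\<sigma> i"] inj[of i j] \<sigma>
    by (cases "i \<in> P1"; cases "j \<in> P1") (simp_all add: hX_def hY_def)
  have TT: "fa_mult (?\<psi> T) (fa_smult s (fa_word [h])) - fa_mult (fa_smult s (fa_word [h])) (?\<psi> T) \<in> ?I"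
    if "h \<in> qwt_gens n" for s h
    using ideal_smult[OF C.rel_T[OF that, unfolded cong_iff], of "a * s"]
    by (simp add: \<psi>T fa.bilinear mult_ac)
  have weyl: "fa_mult (?\<psi> (X i)) (?\<psi> (Y i)) - fa_smult (q i) (fa_mult (?\<psi> (Y i)) (?\<psi> (X i))) - fa_one \<in> ?I"
    if i: "i \<in> {1..n}" for i
  proof (cases "i \<in> P1")
    case True
    then have "q' (\<sigma> i) = q i"
      using c by (simp add: compatible_def)
    then show ?thesis
      using C.rel_weyl[OF \<sigma>[OF i]] \<alpha> i True
      by (simp add: \<psi>X \<psi>Y hX_def hY_def cY_def cong_iff diff_diff_eq mult_ac)
  next
    case False
    then have "q' (\<sigma> i) = inverse (q i)"
      using c i by (auto simp: compatible_def)
    moreover have "\<alpha> i \<noteq> 0" "q i \<noteq> 0"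
      using \<alpha> i A.q_nz by auto
    ultimately have "\<alpha> i * cY i = - inverse (q i)" "cY i * \<alpha> i = - inverse (q i)"
      using False by (simp_all add: cY_def field_simps)
    \<comment> \<open>The scalar \<open>- inverse (q i)\<close> turns the term -q_i y_i x_i into x'
      y', so the two monomials change roles and the Weyl relator for \<open>inverse (q i)\<close>
      appears.\<close>
    then have "fa_mult (?\<psi> (X i)) (?\<psi> (Y i)) - fa_smult (q i) (fa_mult (?\<psi> (Y i)) (?\<psi> (X i))) - fa_one
        = fa_word [X (\<sigma> i), Y (\<sigma> i)] - (fa_smult (inverse (q i)) (fa_word [Y (\<sigma> i), X (\<sigma> i)]) + fa_one)"
      using False \<open>q i \<noteq> 0\<close>
      by (simp add: \<psi>X \<psi>Y hX_def hY_def fa.sc_minus_left fa.sc_minus_right algebra_simps)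
    then show ?thesis
      using C.rel_weyl[OF \<sigma>[OF i]] \<open>q' (\<sigma> i) = inverse (q i)\<close>
      by (simp add: cong_iff diff_diff_eq)
  qed
  have hG: "hX i \<in> qwt_gens n" "hY i \<in> qwt_gens n" if "i \<in> {1..n}" for i
    using \<sigma>[OF that] by (auto simp: hX_def hY_def)
  have T_rel: "fa.ext ?\<psi> (fa_word [T, g] - fa_word [g, T]) \<in> ?I" if "g \<in> qw_gens n" for g
    using that TT hG word2[of T g 1] by (auto simp: qw_gens_def \<psi>X \<psi>Y)
  have "fa.ext ?\<psi> (fa_word [X i, X j] - fa_smult (lam i j) (fa_word [X j, X i])) \<in> ?I"
    "fa.ext ?\<psi> (fa_word [Y i, Y j] - fa_smult (lam i j) (fa_word [Y j, Y i])) \<in> ?I"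
    "fa.ext ?\<psi> (fa_word [X i, Y j] - fa_smult (lam j i) (fa_word [Y j, X i])) \<in> ?I"
    if "i \<in> {1..n}" "j \<in> {1..n}" "i \<noteq> j" for i j
    unfolding word2 \<psi>X \<psi>Y by (intro scal XX YY XY that)+
  moreover have "fa.ext ?\<psi> (fa_word [X i, Y i] - fa_smult (q i) (fa_word [Y i, X i]) - fa_one) \<in> ?I"
    if "i \<in> {1..n}" for i
    using weyl[OF that] by (subst fa.ext_diff[of _ UNIV]) (simp_all add: word2)
  ultimately show ?thesis
    using r T_rel unfolding qwt_rels_def qw_rels_def mon2_eq fa_sub_eq
    by (elim UnE CollectE exE conjE) simp_all
qed

text \<open>For j = \<sigma> i with i outside \<open>P1\<close>, x'_j has to return to -q_i
  \<alpha>_i y_i, which fixes \<open>\<beta> j\<close>. Since q'_j is the inverse of q_i, the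
  formula of \<open>iso_gen\<close> then sends y'_j to x_i divided by \<alpha>_i, as it must. The
  scalars for \<open>T\<close> invert the substitution of a t + b for t.\<close>

lemma iso_gen_inverse:
  fixes b :: "'k::field"
  assumes c: "compatible n q lam q' lam' P1 P2 \<sigma>"
    and par: "qw_params n q lam" "qw_params n q' lam'"
    and \<alpha>: "\<forall>i\<in>{1..n}. \<alpha> i \<noteq> 0" and a: "a \<noteq> 0"
  defines "\<tau> \<equiv> inv_into {1..n} \<sigma>"
  defines "\<beta> \<equiv> \<lambda>j. if j \<in> \<sigma> ` P1 then inverse (\<alpha> (\<tau> j)) else - (q (\<tau> j) * \<alpha> (\<tau> j))"
  defines "\<psi> \<equiv> iso_gen q P1 \<sigma> \<alpha> a b"
    and "\<psi>' \<equiv> iso_gen q' (\<sigma> ` P1) \<tau> \<beta> (inverse a) (- (b / a))"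
  shows "g \<in> qwt_gens n \<Longrightarrow> fa.ext \<psi>' (\<psi> g) = fa_word [g]"
    and "g \<in> qwt_gens n \<Longrightarrow> fa.ext \<psi> (\<psi>' g) = fa_word [g]"
    and "\<forall>j\<in>{1..n}. \<beta> j \<noteq> 0"
proof -
  interpret A: qparams n q lam by unfold_locales fact
  have bij: "bij_betw \<sigma> {1..n} {1..n}" and P: "P1 \<union> P2 = {1..n}" "P1 \<inter> P2 = {}"
    using c by (auto simp: compatible_def)
  have tau: "\<tau> (\<sigma> i) = i" "\<sigma> i \<in> {1..n}" "\<sigma> i \<in> \<sigma> ` P1 \<longleftrightarrow> i \<in> P1" if "i \<in> {1..n}" for i
  proof -
    show "\<tau> (\<sigma> i) = i" "\<sigma> i \<in> {1..n}"
      using bij that unfolding \<tau>_def by (auto simp: bij_betw_inv_into_left dest: bij_betw_apply)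
    show "\<sigma> i \<in> \<sigma> ` P1 \<longleftrightarrow> i \<in> P1"
      using bij P(1) that by (intro inj_on_image_mem_iff[of \<sigma> "{1..n}"]) (auto simp: bij_betw_def)
  qed
  have sig: "\<exists>i\<in>{1..n}. j = \<sigma> i" if "j \<in> {1..n}" for j
    using bij that by (auto simp: bij_betw_def)
  have nz: "\<alpha> i \<noteq> 0" "q i \<noteq> 0" if "i \<in> {1..n}" for i
    using \<alpha> A.q_nz that by auto
  have q': "i \<notin> P1 \<Longrightarrow> q' (\<sigma> i) = inverse (q i)" if "i \<in> {1..n}" for i
    using c that P unfolding compatible_def by blast
  note ext1 = fa.ext_smult[of _ UNIV] fa.ext_add[of _ UNIV] fa.ext_diff[of _ UNIV]
  show "\<forall>j\<in>{1..n}. \<beta> j \<noteq> 0"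
  proof
    fix j assume "j \<in> {1..n}"
    then obtain i where "i \<in> {1..n}" "j = \<sigma> i"
      using sig by blast
    then show "\<beta> j \<noteq> 0"
      by (simp add: \<beta>_def tau nz)
  qed
  show "fa.ext \<psi>' (\<psi> g) = fa_word [g]" if "g \<in> qwt_gens n"
  proof (cases g)
    case (X i)
    then have i: "i \<in> {1..n}"
      using that by simp
    then have "\<alpha> i * (q i * (inverse (q i) * inverse (\<alpha> i))) = 1"
      using nz[OF i] by (simp add: field_simps)
    then show ?thesis
      using i by (simp add: X \<psi>_def \<psi>'_def iso_gen_def fa_gen_eq ext1 tau nz q' \<beta>_def)
  next
    case (Y i)
    then have i: "i \<in> {1..n}"
      using that by simp
    then have "inverse (q i) * inverse (\<alpha> i) * (q i * \<alpha> i) = 1"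
      using nz[OF i] by (simp add: field_simps)
    then show ?thesis
      using i by (simp add: Y \<psi>_def \<psi>'_def iso_gen_def fa_gen_eq ext1 tau nz q' \<beta>_def)
  next
    case T
    have *: "a * (b * inverse a) = b"
      using a by simp
    show ?thesis
      using a by (simp add: * T \<psi>_def \<psi>'_def iso_gen_def fa_gen_eq fa_add_eq ext1 fa.bilinear divide_inverse)
  qed
  show "fa.ext \<psi> (\<psi>' g) = fa_word [g]" if g: "g \<in> qwt_gens n"
  proof (cases g)
    case (X j)
    then obtain i where i: "i \<in> {1..n}" "j = \<sigma> i"
      using sig[of j] g by auto
    then have "q i * \<alpha> i * (inverse (q i) * inverse (\<alpha> i)) = 1"
      using nz[OF i(1)] by (simp add: field_simps)
    then show ?thesis
      using i by (simp add: X \<psi>_def \<psi>'_def iso_gen_def fa_gen_eq ext1 tau nz \<beta>_def)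
  next
    case (Y j)
    then obtain i where i: "i \<in> {1..n}" "j = \<sigma> i"
      using sig[of j] g by auto
    then have "q i * (inverse (q i) * inverse (\<alpha> i)) * \<alpha> i = 1"
      using nz[OF i(1)] by (simp add: field_simps)
    then show ?thesis
      using i by (simp add: Y \<psi>_def \<psi>'_def iso_gen_def fa_gen_eq ext1 tau nz q' \<beta>_def)
  next
    case T
    then show ?thesis
      using a by (simp add: \<psi>_def \<psi>'_def iso_gen_def fa_gen_eq fa_add_eq ext1 fa.bilinear divide_inverse mult.commute)
  qed
qed

lemma is_alg_iso_iso_gen:
  assumes c: "compatible n q lam q' lam' P1 P2 \<sigma>"
    and par: "qw_params n q lam" "qw_params n q' lam'"
    and \<alpha>: "\<forall>i\<in>{1..n}. \<alpha> i \<noteq> 0" and a: "a \<noteq> 0"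
  shows "is_alg_iso (qwt_gens n) (qwt_rels n q lam) (qwt_gens n) (qwt_rels n q' lam')
           (fa_ext (iso_gen q P1 \<sigma> \<alpha> a b))"
proof -
  note c' = compatible_inverse[OF c par]
  have bij: "bij_betw \<sigma> {1..n} {1..n}" "bij_betw (inv_into {1..n} \<sigma>) {1..n} {1..n}"
    using c c' by (auto simp: compatible_def)
  note inv = iso_gen_inverse[OF c par \<alpha> a]
  show ?thesis
    by (rule is_alg_iso_fa_ext[OF iso_gen_FA iso_gen_FA qwt_rels_FA qwt_rels_FA
          iso_gen_rels[OF c par \<alpha>] iso_gen_rels[OF c' par(2,1) inv(3)] inv(1,2)])
       (rule bij | assumption)+
qed

section \<open>Twisted group algebras of ordered groups\<close>

text \<open>Monomials are to multiply by x^a x^b = \<chi>(a,b) x^{a+b}. Multiplicativity in both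
  arguments makes this associative with unit x^0; the order on exponents makes the resulting algebra
  a domain.\<close>

locale bichar =
  fixes \<chi> :: "'i::linordered_ab_group_add \<Rightarrow> 'i \<Rightarrow> 'k::field"
  assumes chi_add_left: "\<chi> (a + b) c = \<chi> a c * \<chi> b c"
    and chi_add_right: "\<chi> a (b + c) = \<chi> a b * \<chi> a c"
    and chi_nz [simp]: "\<chi> a b \<noteq> 0"
begin

lemma chi_zero_left [simp]: "\<chi> 0 a = 1"
  using chi_add_left[of 0 0 a] by simp

lemma chi_zero_right [simp]: "\<chi> a 0 = 1"
  using chi_add_right[of a 0 0] by simp

definition tsc :: "'k \<Rightarrow> ('i \<Rightarrow>\<^sub>0 'k) \<Rightarrow> 'i \<Rightarrow>\<^sub>0 'k" where
  "tsc c f = Poly_Mapping.map ((*) c) f"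

text \<open>A separate operation, because \<open>*\<close> on this type is the untwisted
  convolution.\<close>

definition tm :: "('i \<Rightarrow>\<^sub>0 'k) \<Rightarrow> ('i \<Rightarrow>\<^sub>0 'k) \<Rightarrow> 'i \<Rightarrow>\<^sub>0 'k" where
  "tm f g = (\<Sum>a\<in>Poly_Mapping.keys f. \<Sum>b\<in>Poly_Mapping.keys g.
     Poly_Mapping.single (a + b) (\<chi> a b * (Poly_Mapping.lookup f a * Poly_Mapping.lookup g b)))"

end

text \<open>The unit of \<open>tm\<close> is written \<open>single 0 1\<close>;
  \<open>single_one\<close> would rewrite it to \<open>1\<close>, and the rules for
  \<open>tm\<close> on monomials would no longer match.\<close>

declare single_one [simp del]

abbreviation "keys \<equiv> Poly_Mapping.keys"
abbreviation "lookup \<equiv> Poly_Mapping.lookup"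
abbreviation "single \<equiv> Poly_Mapping.single"

lemma poly_mapping_sum_single: "f = (\<Sum>a\<in>keys f. single a (lookup f a))"
  by (rule poly_mapping_eqI) (simp add: lookup_sum lookup_single when_def in_keys_iff)

lemma poly_mapping_add_induct [case_names zero single add]:
  fixes f :: "'a \<Rightarrow>\<^sub>0 'b::comm_monoid_add"
  assumes "P 0" and single: "\<And>a c. P (single a c)" and add: "\<And>f g. P f \<Longrightarrow> P g \<Longrightarrow> P (f + g)"
  shows "P f"
proof -
  have "P (\<Sum>a\<in>A. single a (lookup f a))" if "finite A" for A
    using that by (induction rule: finite_induct) (auto simp: assms)
  from this[OF finite_keys[of f]] show ?thesis
    by (simp only: poly_mapping_sum_single[symmetric])
qed

context bichar
begin

lemma lookup_tsc [simp]: "lookup (tsc c f) a = c * lookup f a"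
  by (simp add: tsc_def map.rep_eq when_def)

lemma tsc_single [simp]: "tsc c (single a d) = single a (c * d)"
  by (rule poly_mapping_eqI) (simp add: lookup_single when_def)

lemma tsc_add: "tsc c (f + g) = tsc c f + tsc c g"
  by (rule poly_mapping_eqI) (simp add: lookup_add algebra_simps)

lemma tm_superset:
  assumes "finite A" "keys f \<subseteq> A" "finite B" "keys g \<subseteq> B"
  shows "tm f g = (\<Sum>a\<in>A. \<Sum>b\<in>B. single (a + b) (\<chi> a b * (lookup f a * lookup g b)))"
proof -
  have "tm f g = (\<Sum>a\<in>keys f. \<Sum>b\<in>B. single (a + b) (\<chi> a b * (lookup f a * lookup g b)))"
    unfolding tm_def using assms
    by (intro sum.cong sum.mono_neutral_left) (auto simp: in_keys_iff)
  also have "\<dots> = (\<Sum>a\<in>A. \<Sum>b\<in>B. single (a + b) (\<chi> a b * (lookup f a * lookup g b)))"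
    using assms by (intro sum.mono_neutral_left) (auto simp: in_keys_iff)
  finally show ?thesis .
qed

lemma tm_single [simp]: "tm (single a c) (single b d) = single (a + b) (\<chi> a b * (c * d))"
  by (subst tm_superset[of "{a}" _ "{b}"]) auto

lemma tm_add_left: "tm (f + g) h = tm f h + tm g h"
  using keys_add[of f g]
  by (subst (1 2 3) tm_superset[of "keys f \<union> keys g" _ "keys h"])
     (auto simp: lookup_add distrib_left distrib_right single_add sum.distrib)

lemma tm_add_right: "tm h (f + g) = tm h f + tm h g"
  using keys_add[of f g]
  by (subst (1 2 3) tm_superset[of "keys h" _ "keys f \<union> keys g"])
     (auto simp: lookup_add distrib_left distrib_right single_add sum.distrib)

lemma tm_zero [simp]: "tm 0 f = 0" "tm f 0 = 0"
  by (simp_all add: tm_def)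

lemma tsc_zero [simp]: "tsc c 0 = 0"
  by (rule poly_mapping_eqI) simp

lemma tm_tsc_left: "tm (tsc c f) g = tsc c (tm f g)"
proof (induction f rule: poly_mapping_add_induct)
  case (single a d)
  show ?case
    by (induction g rule: poly_mapping_add_induct) (simp_all add: tsc_add tm_add_right ac_simps)
qed (simp_all add: tsc_add tm_add_left)

lemma tm_tsc_right: "tm f (tsc c g) = tsc c (tm f g)"
proof (induction f rule: poly_mapping_add_induct)
  case (single a d)
  show ?case
    by (induction g rule: poly_mapping_add_induct) (simp_all add: tsc_add tm_add_right ac_simps)
qed (simp_all add: tsc_add tm_add_left)

lemma tm_assoc: "tm (tm f g) h = tm f (tm g h)"
proof (induction f rule: poly_mapping_add_induct)
  case (single a c)
  show ?case
  proof (induction g rule: poly_mapping_add_induct)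
    case (single b d)
    show ?case
      by (induction h rule: poly_mapping_add_induct)
         (simp_all add: chi_add_left chi_add_right tm_add_right ac_simps)
  qed (simp_all add: tm_add_left tm_add_right)
qed (simp_all add: tm_add_left)

sublocale kalg tsc tm "single 0 1"
proof
  fix c d :: 'k and u v w :: "'i \<Rightarrow>\<^sub>0 'k"
  show "tsc (c + d) u = tsc c u + tsc d u"
    by (rule poly_mapping_eqI) (simp add: lookup_add algebra_simps)
  show "tsc c (tsc d u) = tsc (c * d) u"
    by (rule poly_mapping_eqI) simp
  show "tsc 1 u = u"
    by (rule poly_mapping_eqI) simp
  show "tm (single 0 1) v = v"
    by (induction v rule: poly_mapping_add_induct) (simp_all add: tm_add_right)
  show "tm v (single 0 1) = v"
    by (induction v rule: poly_mapping_add_induct) (simp_all add: tm_add_left)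
qed (simp_all add: tsc_add tm_add_left tm_add_right tm_tsc_left tm_tsc_right tm_assoc)

section \<open>Supports, top weights and commutation in twisted group algebras\<close>

lemma keys_tsc: "c \<noteq> 0 \<Longrightarrow> keys (tsc c f) = keys f"
  by (auto simp: in_keys_iff)

lemma tsc_eq_0_iff: "tsc c f = 0 \<longleftrightarrow> c = 0 \<or> f = 0"
  by (auto simp: poly_mapping_eq_iff fun_eq_iff)

lemma lookup_tm_single_right [simp]:
  "lookup (tm f (single e c)) (a + e) = \<chi> a e * (lookup f a * c)"
  by (induction f rule: poly_mapping_add_induct)
     (simp_all add: tm_add_left lookup_add lookup_single when_def algebra_simps)

lemma lookup_tm_single_left [simp]:
  "lookup (tm (single e c) f) (e + a) = \<chi> e a * (c * lookup f a)"
  by (induction f rule: poly_mapping_add_induct)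
     (simp_all add: tm_add_right lookup_add lookup_single when_def algebra_simps)

lemma keys_tm:
  assumes "c \<in> keys (tm f g)"
  obtains a b where "a \<in> keys f" "b \<in> keys g" "c = a + b"
proof -
  have "lookup (tm f g) c = (\<Sum>a\<in>keys f. \<Sum>b\<in>keys g.
      (\<chi> a b * (lookup f a * lookup g b) when a + b = c))"
    by (simp add: tm_def lookup_sum lookup_single)
  moreover have "lookup (tm f g) c \<noteq> 0"
    using assms by (simp add: in_keys_iff)
  ultimately have "\<exists>a\<in>keys f. (\<Sum>b\<in>keys g. (\<chi> a b * (lookup f a * lookup g b) when a + b = c)) \<noteq> 0"
    by (metis (mono_tags, lifting) sum.neutral)
  then obtain a where a: "a \<in> keys f" "(\<Sum>b\<in>keys g. (\<chi> a b * (lookup f a * lookup g b) when a + b = c)) \<noteq> 0"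
    by blast
  then obtain b where "b \<in> keys g" "(\<chi> a b * (lookup f a * lookup g b) when a + b = c) \<noteq> 0"
    by (meson sum.neutral)
  then have "\<exists>a\<in>keys f. \<exists>b\<in>keys g. a + b = c"
    using a by auto
  then show ?thesis
    using that by blast
qed

text \<open>Ties of the weight \<omega> are broken by the order of the group. With both exponents
  chosen maximal in this sense, a + b arises from no other pair, so nothing can cancel it. Hence top
  weights add and, with the negative of \<omega>, bottom weights add too.\<close>

lemma tm_top:
  fixes \<omega> :: "'i \<Rightarrow> int"
  assumes "f \<noteq> 0" "g \<noteq> 0" and add: "\<And>a b. \<omega> (a + b) = \<omega> a + \<omega> b"
  obtains a b where "a \<in> keys f" "b \<in> keys g" "a + b \<in> keys (tm f g)"
    "\<And>a'. a' \<in> keys f \<Longrightarrow> \<omega> a' \<le> \<omega> a" "\<And>b'. b' \<in> keys g \<Longrightarrow> \<omega> b' \<le> \<omega> b"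
proof -
  have ex: "\<exists>a\<in>keys h. \<forall>a'\<in>keys h. \<omega> a' \<le> \<omega> a \<and> (\<omega> a' = \<omega> a \<longrightarrow> a' \<le> a)"
    if "h \<noteq> 0" for h :: "'i \<Rightarrow>\<^sub>0 'k"
  proof -
    define K where "K = {a \<in> keys h. \<omega> a = Max (\<omega> ` keys h)}"
    have ne: "keys h \<noteq> {}"
      using that by simp
    have "Max (\<omega> ` keys h) \<in> \<omega> ` keys h"
      using ne by (intro Max_in) auto
    then have K: "K \<noteq> {}" "finite K"
      by (auto simp: K_def)
    then have "Max K \<in> K"
      by simp
    moreover have "\<omega> a' \<le> Max (\<omega> ` keys h)" if "a' \<in> keys h" for a'
      using that by simp
    moreover have "a' \<le> Max K" if "a' \<in> K" for a'
      using that K by simp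
    ultimately show ?thesis
      by (intro bexI[of _ "Max K"]) (auto simp: K_def)
  qed
  obtain a where a: "a \<in> keys f" "\<And>a'. a' \<in> keys f \<Longrightarrow> \<omega> a' \<le> \<omega> a \<and> (\<omega> a' = \<omega> a \<longrightarrow> a' \<le> a)"
    using ex[OF \<open>f \<noteq> 0\<close>] by blast
  obtain b where b: "b \<in> keys g" "\<And>b'. b' \<in> keys g \<Longrightarrow> \<omega> b' \<le> \<omega> b \<and> (\<omega> b' = \<omega> b \<longrightarrow> b' \<le> b)"
    using ex[OF \<open>g \<noteq> 0\<close>] by blast
  have uniq: "a' = a \<and> b' = b" if "a' \<in> keys f" "b' \<in> keys g" "a' + b' = a + b" for a' b'
  proof -
    have "\<omega> a' + \<omega> b' = \<omega> a + \<omega> b"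
      using that(3) add by metis
    then have "\<omega> a' = \<omega> a" "\<omega> b' = \<omega> b"
      using a(2)[OF that(1)] b(2)[OF that(2)] by auto
    then have "a' \<le> a" "b' \<le> b"
      using a(2)[OF that(1)] b(2)[OF that(2)] by auto
    then show ?thesis
      using that(3) by (metis add_le_cancel_left add_le_cancel_right order_antisym)
  qed
  have "lookup (tm f g) (a + b) = (\<Sum>a'\<in>keys f. \<Sum>b'\<in>keys g.
      (\<chi> a' b' * (lookup f a' * lookup g b') when a' + b' = a + b))"
    by (simp add: tm_def lookup_sum lookup_single)
  also have "\<dots> = (\<Sum>a'\<in>keys f. \<Sum>b'\<in>keys g. if a' = a then
      (if b' = b then \<chi> a b * (lookup f a * lookup g b) else 0) else 0)"
    using uniq by (intro sum.cong) (auto simp: when_def)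
  also have "\<dots> = (\<Sum>a'\<in>keys f. if a' = a then \<chi> a b * (lookup f a * lookup g b) else 0)"
    using b(1) by (intro sum.cong) auto
  also have "\<dots> = \<chi> a b * (lookup f a * lookup g b)"
    using a(1) by simp
  also have "\<dots> \<noteq> 0"
    using a(1) b(1) by (simp add: in_keys_iff)
  finally have "a + b \<in> keys (tm f g)"
    by (simp add: in_keys_iff)
  then show ?thesis
    using that a b by blast
qed

lemma tm_eq_0_iff: "tm f g = 0 \<longleftrightarrow> f = 0 \<or> g = 0"
proof -
  have "tm f g \<noteq> 0" if "f \<noteq> 0" "g \<noteq> 0"
    \<comment> \<open>With the constant weight 0 the order of the group alone decides.\<close>
    by (rule tm_top[OF that, of "\<lambda>_. 0"]) auto
  then show ?thesis
    by auto
qed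

lemma tm_right_cancel: "h \<noteq> 0 \<Longrightarrow> tm f h = tm g h \<longleftrightarrow> f = g"
  using tm_eq_0_iff[of "f - g" h] by (simp add: mu_diff_left)

lemma tm_commute:
  assumes "\<And>a b. a \<in> keys f \<Longrightarrow> b \<in> keys g \<Longrightarrow> \<chi> a b = c * \<chi> b a"
  shows "tm f g = tsc c (tm g f)"
proof -
  have "tm f g = (\<Sum>a\<in>keys f. \<Sum>b\<in>keys g.
      tsc c (single (b + a) (\<chi> b a * (lookup g b * lookup f a))))"
    unfolding tm_def by (intro sum.cong) (auto simp: assms ac_simps)
  also have "\<dots> = tsc c (tm g f)"
    unfolding tm_def by (subst sum.swap) (simp add: sc_sum)
  finally show ?thesis .
qed

text \<open>The source of the equations between the parameters of the two algebras: in a domain the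
  factor in a commutation rule is unique, so it can be computed from the supports.\<close>

lemma tm_commute_unique:
  assumes "\<And>a b. a \<in> keys f \<Longrightarrow> b \<in> keys g \<Longrightarrow> \<chi> a b = c * \<chi> b a"
    and "f \<noteq> 0" "g \<noteq> 0" "tm f g = tsc d (tm g f)"
  shows "d = c"
proof -
  have "tsc (d - c) (tm g f) = 0"
    using tm_commute[OF assms(1)] assms(4) by (simp add: sc_diff_left)
  then show ?thesis
    using assms by (simp add: tsc_eq_0_iff tm_eq_0_iff)
qed

text \<open>A monomial factor merely shifts the support, so the two sides can be compared
  coefficient by coefficient.\<close>

lemma chi_of_commute_single:
  assumes "tm f (single e 1) = tsc c (tm (single e 1) f)" "a \<in> keys f"
  shows "\<chi> a e = c * \<chi> e a"
proof -
  have "lookup (tm f (single e 1)) (a + e) = c * lookup (tm (single e 1) f) (e + a)"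
    by (simp only: assms(1) lookup_tsc add.commute)
  then show ?thesis
    using assms(2) by (simp add: in_keys_iff)
qed

text \<open>Homogeneous products in a domain have homogeneous factors: the top weights and the
  bottom weights of f and g both add up to d, so in each factor top and bottom agree.\<close>

lemma tm_keys_const:
  fixes \<omega> :: "'i \<Rightarrow> int"
  assumes "f \<noteq> 0" "g \<noteq> 0" and add: "\<And>a b. \<omega> (a + b) = \<omega> a + \<omega> b"
    and const: "\<And>c. c \<in> keys (tm f g) \<Longrightarrow> \<omega> c = d"
  obtains r where "\<And>a. a \<in> keys f \<Longrightarrow> \<omega> a = r" "\<And>b. b \<in> keys g \<Longrightarrow> \<omega> b = d - r"
proof -
  obtain a b where ab: "a + b \<in> keys (tm f g)"
    "\<And>a'. a' \<in> keys f \<Longrightarrow> \<omega> a' \<le> \<omega> a" "\<And>b'. b' \<in> keys g \<Longrightarrow> \<omega> b' \<le> \<omega> b"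
    using tm_top[OF assms(1-3)] by metis
  have "- \<omega> (x + y) = - \<omega> x + - \<omega> y" for x y
    by (simp add: add)
  then obtain a' b' where ab': "a' + b' \<in> keys (tm f g)"
    "\<And>x. x \<in> keys f \<Longrightarrow> - \<omega> x \<le> - \<omega> a'" "\<And>x. x \<in> keys g \<Longrightarrow> - \<omega> x \<le> - \<omega> b'"
    "a' \<in> keys f" "b' \<in> keys g"
    using tm_top[OF assms(1,2), of "\<lambda>x. - \<omega> x"] by metis
  have "\<omega> a + \<omega> b = d" "\<omega> a' + \<omega> b' = d"
    using const[OF ab(1)] const[OF ab'(1)] add by auto
  then have "\<omega> a = \<omega> a'" "\<omega> b = \<omega> b'"
    using ab(2)[OF ab'(4)] ab(3)[OF ab'(5)] by auto
  then show ?thesis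
    using ab(2,3) ab'(2,3) \<open>\<omega> a + \<omega> b = d\<close>
    by (intro that[of "\<omega> a"]) (force simp: order_antisym)+
qed

definition has_lead :: "('i \<Rightarrow> int) \<Rightarrow> ('i \<Rightarrow>\<^sub>0 'k) \<Rightarrow> 'i \<Rightarrow> bool" where
  "has_lead \<omega> f a \<longleftrightarrow> a \<in> keys f \<and> (\<forall>b\<in>keys f. b \<noteq> a \<longrightarrow> \<omega> b < \<omega> a)"

lemma has_lead_tm:
  assumes f: "has_lead \<omega> f a" and g: "has_lead \<omega> g b" and add: "\<And>a b. \<omega> (a + b) = \<omega> a + \<omega> b"
  shows "has_lead \<omega> (tm f g) (a + b)"
proof -
  have "f \<noteq> 0" "g \<noteq> 0"
    using f g by (auto simp: has_lead_def)
  then obtain a' b' where ab': "a' \<in> keys f" "b' \<in> keys g" "a' + b' \<in> keys (tm f g)"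
    "\<And>x. x \<in> keys f \<Longrightarrow> \<omega> x \<le> \<omega> a'" "\<And>y. y \<in> keys g \<Longrightarrow> \<omega> y \<le> \<omega> b'"
    using tm_top[of f g \<omega>] add by metis
  have "a' = a" "b' = b"
    using f g ab' unfolding has_lead_def by (metis leD)+
  moreover have "\<omega> c < \<omega> (a + b)" if "c \<in> keys (tm f g)" "c \<noteq> a + b" for c
  proof -
    obtain x y where xy: "x \<in> keys f" "y \<in> keys g" "c = x + y"
      using keys_tm[OF \<open>c \<in> keys (tm f g)\<close>] by metis
    have "\<omega> x < \<omega> a \<or> x = a" "\<omega> y < \<omega> b \<or> y = b"
      using f g xy by (auto simp: has_lead_def)
    then show ?thesis
      using xy that by (auto simp: add)
  qed
  ultimately show ?thesis
    using ab' by (auto simp: has_lead_def)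
qed

end

section \<open>The quantum torus containing \<open>A[t]\<close>\<close>

lemma not_root_of_unity_powi:
  assumes "not_root_of_unity c" "c powi r = 1"
  shows "r = 0"
proof (rule ccontr)
  assume "r \<noteq> 0"
  have "c ^ nat \<bar>r\<bar> = 1"
    using assms(2) by (cases "r \<ge> 0") (auto simp: power_int_def power_inverse)
  then show False
    using assms(1) \<open>r \<noteq> 0\<close> by (auto simp: not_root_of_unity_def)
qed

type_synonym expo = "qgen \<Rightarrow>\<^sub>0 int"

abbreviation ep :: "qgen \<Rightarrow> expo" where "ep g \<equiv> single g 1"

locale qweyl = qparams +
  assumes nru: "\<forall>i\<in>{1..n}. not_root_of_unity (q i)"
begin

lemma q_ne_1: "i \<in> {1..n} \<Longrightarrow> q i \<noteq> 1"
  using nru[rule_format, of i] spec[of "\<lambda>k. k > 0 \<longrightarrow> q i ^ k \<noteq> 1" 1]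
  unfolding not_root_of_unity_def by simp

lemma q_powi_eq_1: "i \<in> {1..n} \<Longrightarrow> q i powi r = 1 \<Longrightarrow> r = 0"
  using nru not_root_of_unity_powi by blast

text \<open>In an exponent the coordinate \<open>X k\<close> belongs to \<open>x\<^sub>k\<close>, but \<open>Y k\<close> to
  \<open>z\<^sub>k = 1 + (q\<^sub>k - 1) y\<^sub>k x\<^sub>k\<close>, which satisfies \<open>x\<^sub>k z\<^sub>k = q\<^sub>k z\<^sub>k x\<^sub>k\<close> and
  commutes with the generators of other index.\<close>

definition chi :: "expo \<Rightarrow> expo \<Rightarrow> 'a" where
  "chi a b = (\<Prod>k\<in>{1..n}. q k powi (lookup a (X k) * lookup b (Y k))) *
     (\<Prod>j\<in>{1..n}. \<Prod>i\<in>{1..<j}. lam j i powi (lookup a (X j) * lookup b (X i)))"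

sublocale bichar chi
proof
  fix a b c :: expo
  have "chi (a + b) c = (\<Prod>k\<in>{1..n}. q k powi (lookup a (X k) * lookup c (Y k)) * q k powi (lookup b (X k) * lookup c (Y k))) *
     (\<Prod>j\<in>{1..n}. \<Prod>i\<in>{1..<j}. lam j i powi (lookup a (X j) * lookup c (X i)) * lam j i powi (lookup b (X j) * lookup c (X i)))"
    unfolding chi_def lookup_add distrib_right
    by (intro arg_cong2[where f = "(*)"] prod.cong refl power_int_add) (auto simp: q_nz lam_nz)
  then show "chi (a + b) c = chi a c * chi b c"
    by (simp add: chi_def prod.distrib)
  have "chi a (b + c) = (\<Prod>k\<in>{1..n}. q k powi (lookup a (X k) * lookup b (Y k)) * q k powi (lookup a (X k) * lookup c (Y k))) *
     (\<Prod>j\<in>{1..n}. \<Prod>i\<in>{1..<j}. lam j i powi (lookup a (X j) * lookup b (X i)) * lam j i powi (lookup a (X j) * lookup c (X i)))"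
    unfolding chi_def lookup_add distrib_left
    by (intro arg_cong2[where f = "(*)"] prod.cong refl power_int_add) (auto simp: q_nz lam_nz)
  then show "chi a (b + c) = chi a b * chi a c"
    by (simp add: chi_def prod.distrib)
  show "chi a b \<noteq> 0"
    using q_nz lam_nz by (auto simp: chi_def)
qed

lemma chi_left_eq_1: "(\<And>k. k \<in> {1..n} \<Longrightarrow> lookup a (X k) = 0) \<Longrightarrow> chi a b = 1"
  by (simp add: chi_def)

lemma chi_right:
  assumes "\<And>k. k \<in> {1..n} \<Longrightarrow> lookup b (X k) = 0"
  shows "chi a b = (\<Prod>k\<in>{1..n}. q k powi (lookup a (X k) * lookup b (Y k)))"
proof -
  have "(\<Prod>j\<in>{1..n}. \<Prod>i\<in>{1..<j}. lam j i powi (lookup a (X j) * lookup b (X i))) = 1"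
    using assms by (intro prod.neutral ballI) auto
  then show ?thesis
    by (simp add: chi_def)
qed

lemma chi_right_single:
  assumes "\<And>k. k \<in> {1..n} \<Longrightarrow> lookup b (X k) = 0" and j: "j \<in> {1..n}"
    and "\<And>k. k \<in> {1..n} \<Longrightarrow> k \<noteq> j \<Longrightarrow> lookup a (X k) = 0 \<or> lookup b (Y k) = 0"
  shows "chi a b = q j powi (lookup a (X j) * lookup b (Y j))"
proof -
  have "chi a b = (\<Prod>k\<in>{1..n}. q k powi (lookup a (X k) * lookup b (Y k)))"
    by (rule chi_right) (rule assms(1))
  also have "\<dots> = (\<Prod>k\<in>{1..n}. if k = j then q j powi (lookup a (X j) * lookup b (Y j)) else 1)"
  proof (intro prod.cong refl)
    fix k assume "k \<in> {1..n}"
    then show "q k powi (lookup a (X k) * lookup b (Y k))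
        = (if k = j then q j powi (lookup a (X j) * lookup b (Y j)) else 1)"
      using assms(3)[of k] by (cases "k = j") auto
  qed
  finally show ?thesis
    using j by simp
qed

lemma chi_cross_aux:
  assumes ij: "i \<in> {1..n}" "j \<in> {1..n}"
    and a: "\<And>k. k \<in> {1..n} \<Longrightarrow> k \<noteq> i \<Longrightarrow> lookup a (X k) = 0"
    and b: "\<And>k. k \<in> {1..n} \<Longrightarrow> k \<noteq> j \<Longrightarrow> lookup b (X k) = 0" "lookup b (Y i) = 0"
  shows "chi a b = (if j < i then lam i j powi (lookup a (X i) * lookup b (X j)) else 1)"
proof -
  have "(\<Prod>k\<in>{1..n}. q k powi (lookup a (X k) * lookup b (Y k))) = 1"
  proof (intro prod.neutral ballI)
    fix k assume "k \<in> {1..n}"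
    then show "q k powi (lookup a (X k) * lookup b (Y k)) = 1"
      using a[of k] b(2) by (cases "k = i") auto
  qed
  moreover have "(\<Prod>j'\<in>{1..n}. \<Prod>i'\<in>{1..<j'}. lam j' i' powi (lookup a (X j') * lookup b (X i')))
      = (\<Prod>j'\<in>{1..n}. if j' = i then
          (\<Prod>i'\<in>{1..<i}. if i' = j then lam i j powi (lookup a (X i) * lookup b (X j)) else 1) else 1)"
  proof (intro prod.cong refl)
    fix j' assume j': "j' \<in> {1..n}"
    show "(\<Prod>i'\<in>{1..<j'}. lam j' i' powi (lookup a (X j') * lookup b (X i')))
      = (if j' = i then
          (\<Prod>i'\<in>{1..<i}. if i' = j then lam i j powi (lookup a (X i) * lookup b (X j)) else 1) else 1)"
    proof (cases "j' = i")
      case True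
      have "(\<Prod>i'\<in>{1..<i}. lam i i' powi (lookup a (X i) * lookup b (X i')))
          = (\<Prod>i'\<in>{1..<i}. if i' = j then lam i j powi (lookup a (X i) * lookup b (X j)) else 1)"
        using b(1) ij by (intro prod.cong) auto
      then show ?thesis
        by (simp only: True simp_thms if_True)
    qed (use a j' in simp)
  qed
  ultimately show ?thesis
    using ij by (simp add: chi_def)
qed

text \<open>\<open>chi\<close> corresponds to writing the x's in order of their index, so a pair of
  indices contributes to only one of \<open>chi a b\<close> and \<open>chi b a\<close>: to the left
  side for j < i, and by the inverse entry to the right side for i < j. The conditions on the Y
  coordinates remove the powers of q.\<close>

lemma chi_cross:
  assumes ij: "i \<in> {1..n}" "j \<in> {1..n}" "i \<noteq> j"
    and a: "\<And>k. k \<in> {1..n} \<Longrightarrow> k \<noteq> i \<Longrightarrow> lookup a (X k) = 0" "lookup a (Y j) = 0"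
    and b: "\<And>k. k \<in> {1..n} \<Longrightarrow> k \<noteq> j \<Longrightarrow> lookup b (X k) = 0" "lookup b (Y i) = 0"
  shows "chi a b = lam i j powi (lookup a (X i) * lookup b (X j)) * chi b a"
proof (cases "j < i")
  case True
  then show ?thesis
    using chi_cross_aux[OF ij(1,2) a(1) b] chi_cross_aux[OF ij(2,1) b(1) a] by simp
next
  case False
  then have "i < j"
    using ij by simp
  have "lam i j powi r * lam j i powi r = 1" for r
    using lam_inv[OF ij(1,2)] lam_nz[OF ij(1,2)]
    by (simp flip: power_int_mult_distrib lam_inv[OF ij(1,2)])
  then show ?thesis
    using chi_cross_aux[OF ij(1,2) a(1) b] chi_cross_aux[OF ij(2,1) b(1) a] \<open>i < j\<close>
    by (simp add: mult.commute)
qed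

section \<open>The generators of A[t] inside the torus\<close>

definition zel :: "nat \<Rightarrow> expo \<Rightarrow>\<^sub>0 'a" where
  "zel k = single (ep (Y k)) 1"

text \<open>\<open>chi\<close> is 1 when its left argument has no x-part, so with z_k on the left
  \<open>single (ep (Y k) - ep (X k)) 1\<close> is exactly z_k x_k^{-1}, without a correction
  factor.\<close>

primrec gimg :: "qgen \<Rightarrow> expo \<Rightarrow>\<^sub>0 'a" where
  "gimg (X k) = single (ep (X k)) 1"
| "gimg (Y k) = tsc (inverse (q k - 1)) (single (ep (Y k) - ep (X k)) 1 - single (- ep (X k)) 1)"
| "gimg T = single (ep T) 1"

abbreviation E :: "(qgen, 'a) fa \<Rightarrow> expo \<Rightarrow>\<^sub>0 'a" where
  "E \<equiv> ext gimg"

lemmas lookup_simps = lookup_add lookup_minus lookup_uminus lookup_single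

lemma keys_gimg_X:
  "a \<in> keys (gimg (X k)) \<Longrightarrow> lookup a (X j) = (if j = k then 1 else 0) \<and> lookup a (Y j) = 0 \<and> lookup a T = 0"
  by (auto simp: lookup_simps)

lemma keys_gimg_Y_eq: "k \<in> {1..n} \<Longrightarrow> keys (gimg (Y k)) = {ep (Y k) - ep (X k), - ep (X k)}"
proof -
  assume k: "k \<in> {1..n}"
  have "ep (Y k) \<noteq> 0"
    by (metis lookup_single_eq lookup_zero zero_neq_one)
  then have ne: "ep (Y k) - ep (X k) \<noteq> - ep (X k)"
    by (simp add: diff_conv_add_uminus del: add_uminus_conv_diff)
  have "keys (gimg (Y k)) = keys (single (ep (Y k) - ep (X k)) 1 - single (- ep (X k)) (1::'a))"
    using q_ne_1[OF k] by (simp add: keys_tsc)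
  also have "\<dots> = {ep (Y k) - ep (X k), - ep (X k)}"
    using ne by (auto simp: in_keys_iff lookup_simps when_def split: if_splits)
  finally show ?thesis .
qed

lemma keys_gimg_Y:
  "k \<in> {1..n} \<Longrightarrow> a \<in> keys (gimg (Y k)) \<Longrightarrow>
     lookup a (X j) = (if j = k then -1 else 0) \<and> (j \<noteq> k \<longrightarrow> lookup a (Y j) = 0) \<and> lookup a T = 0"
  by (auto simp: keys_gimg_Y_eq lookup_simps simp del: gimg.simps)

lemma chi_X_Y: "k \<in> {1..n} \<Longrightarrow> chi (ep (X k)) (ep (Y k)) = q k"
  by (subst chi_right_single[of _ k]) (auto simp: lookup_simps when_def)

lemma chi_X_X: "k \<in> {1..n} \<Longrightarrow> chi (ep (X k)) (ep (X k)) = 1"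
  by (subst chi_cross_aux[of k k]) (auto simp: lookup_simps when_def)

lemma chi_Y_left: "chi (ep (Y k)) a = 1"
  by (rule chi_left_eq_1) (simp add: lookup_simps)

lemma chi_minus_left: "chi (- a) b = inverse (chi a b)"
  using chi_add_left[of a "- a" b] by (simp add: inverse_unique)

lemma chi_minus_right: "chi a (- b) = inverse (chi a b)"
  using chi_add_right[of a b "- b"] by (simp add: inverse_unique)

lemma chi_diff_left: "chi (a - b) c = chi a c / chi b c"
  using chi_add_left[of a "- b" c] by (simp add: chi_minus_left divide_inverse)

lemma chi_diff_right: "chi a (b - c) = chi a b / chi a c"
  using chi_add_right[of a b "- c"] by (simp add: chi_minus_right divide_inverse)

lemma gimg_Y_X:
  assumes "k \<in> {1..n}"
  shows "tm (gimg (Y k)) (gimg (X k)) = tsc (inverse (q k - 1)) (zel k - single 0 1)"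
  using assms
  by (simp add: zel_def mu_diff_left chi_diff_left chi_minus_left chi_Y_left chi_X_X)

lemma gimg_X_Y:
  assumes "k \<in> {1..n}"
  shows "tm (gimg (X k)) (gimg (Y k)) = tsc (inverse (q k - 1)) (tsc (q k) (zel k) - single 0 1)"
  using assms
  by (simp add: zel_def mu_diff_right chi_diff_right chi_minus_right chi_X_Y chi_X_X)

lemma zel_eq:
  assumes "k \<in> {1..n}"
  shows "zel k = single 0 1 + tsc (q k - 1) (tm (gimg (Y k)) (gimg (X k)))"
  using q_ne_1[OF assms] unfolding gimg_Y_X[OF assms] by simp

text \<open>Both terms in the image of y_j have the same x-weight, and z_j commutes with the
  generators of other index, so a single factor works for all pairs of exponents. In the Weyl
  relation (q z - 1) - q (z - 1) = q - 1 cancels the denominator.\<close>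

lemma E_rels:
  assumes "r \<in> qwt_rels n q lam"
  shows "E r = 0"
proof -
  have word2: "E (fa_word [g, h] - fa_smult d (fa_word [h, g])) =
      tm (gimg g) (gimg h) - tsc d (tm (gimg h) (gimg g))" for g h d
    by (simp add: ext_diff[of _ UNIV] ext_smult[of _ UNIV])
  have *: "E (fa_word [X i, X j] - fa_smult (lam i j) (fa_word [X j, X i])) = 0"
    "E (fa_word [Y i, Y j] - fa_smult (lam i j) (fa_word [Y j, Y i])) = 0"
    "E (fa_word [X i, Y j] - fa_smult (lam j i) (fa_word [Y j, X i])) = 0"
    if ij: "i \<in> {1..n}" "j \<in> {1..n}" "i \<noteq> j" for i j
  proof -
    have "tm (gimg (X i)) (gimg (X j)) = tsc (lam i j) (tm (gimg (X j)) (gimg (X i)))"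
      using keys_gimg_X ij chi_cross[OF ij] by (intro tm_commute) fastforce
    moreover have "tm (gimg (Y i)) (gimg (Y j)) = tsc (lam i j) (tm (gimg (Y j)) (gimg (Y i)))"
      using keys_gimg_Y[OF ij(1)] keys_gimg_Y[OF ij(2)] ij chi_cross[OF ij]
      by (intro tm_commute) fastforce
    moreover have "tm (gimg (X i)) (gimg (Y j)) = tsc (lam j i) (tm (gimg (Y j)) (gimg (X i)))"
    proof (intro tm_commute)
      fix a b assume ab: "a \<in> keys (gimg (X i))" "b \<in> keys (gimg (Y j))"
      then have "chi a b = lam i j powi (lookup a (X i) * lookup b (X j)) * chi b a"
        using keys_gimg_X[of a i] keys_gimg_Y[OF ij(2), of b] ij by (intro chi_cross) auto
      then show "chi a b = lam j i * chi b a"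
        using keys_gimg_X[OF ab(1), of i] keys_gimg_Y[OF ij(2) ab(2), of j] lam_inv[OF ij(1,2)] by simp
    qed
    ultimately show "E (fa_word [X i, X j] - fa_smult (lam i j) (fa_word [X j, X i])) = 0"
      "E (fa_word [Y i, Y j] - fa_smult (lam i j) (fa_word [Y j, Y i])) = 0"
      "E (fa_word [X i, Y j] - fa_smult (lam j i) (fa_word [Y j, X i])) = 0"
      by (simp_all only: word2 diff_self)
  qed
  have weyl: "E (fa_word [X i, Y i] - fa_smult (q i) (fa_word [Y i, X i]) - fa_one) = 0"
    if i: "i \<in> {1..n}" for i
  proof -
    have "E (fa_word [X i, Y i] - fa_smult (q i) (fa_word [Y i, X i]) - fa_one) =
        tsc (inverse (q i - 1)) (tsc (q i) (zel i) - single 0 1)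
        - tsc (q i) (tsc (inverse (q i - 1)) (zel i - single 0 1)) - single 0 1"
      by (subst ext_diff[of _ UNIV]) (simp_all only: word2 gimg_X_Y[OF i] gimg_Y_X[OF i], simp_all)
    also have "\<dots> = tsc (inverse (q i - 1) * (q i - 1)) (single 0 1) - single 0 1"
      by (simp add: sc_diff_right sc_diff_left left_diff_distrib right_diff_distrib mult.commute del: tsc_single)
    also have "\<dots> = 0"
      using q_ne_1[OF i] by simp
    finally show ?thesis .
  qed
  have T: "E (fa_word [T, g] - fa_word [g, T]) = 0" for g
  proof -
    have "tm (gimg T) (gimg g) = tsc 1 (tm (gimg g) (gimg T))"
    proof (intro tm_commute)
      fix a b assume "a \<in> keys (gimg T)"
      then have "a = ep T"
        by simp
      then show "chi a b = 1 * chi b a"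
        by (subst (1 2) chi_def) (simp add: lookup_simps)
    qed
    then show ?thesis
      using word2[of T g 1] by simp
  qed
  show ?thesis
    using assms * weyl T unfolding qwt_rels_def qw_rels_def mon2_eq fa_sub_eq
    by (elim UnE CollectE exE conjE) simp_all
qed

lemma E_ideal: "f \<in> ideal_of G R \<Longrightarrow> E f = 0"
  using ext_ideal[OF qwt_rels_FA E_rels] by blast

section \<open>Leading terms and faithfulness\<close>

primrec lead :: "qgen \<Rightarrow> expo" where
  "lead (X k) = ep (X k)"
| "lead (Y k) = ep (Y k) - ep (X k)"
| "lead T = ep T"

definition wlead :: "qgen list \<Rightarrow> expo" where
  "wlead w = sum_list (map lead w)"

text \<open>This weight singles out z_k x_k^{-1} among the two terms of y_k, so that every
  generator, and hence every word, has a unique leading exponent.\<close>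

definition zdeg :: "expo \<Rightarrow> int" where
  "zdeg a = (\<Sum>k\<in>{1..n}. lookup a (Y k))"

lemma zdeg_add: "zdeg (a + b) = zdeg a + zdeg b"
  by (simp add: zdeg_def lookup_add sum.distrib)

lemma has_lead_gimg:
  assumes "g \<in> G"
  shows "has_lead zdeg (gimg g) (lead g)"
proof (cases g)
  case (Y k)
  then have "k \<in> {1..n}"
    using assms by simp
  then have "zdeg (- ep (X k)) < zdeg (ep (Y k) - ep (X k))"
    by (simp add: zdeg_def lookup_simps when_def)
  then show ?thesis
    using Y \<open>k \<in> {1..n}\<close> by (auto simp: has_lead_def keys_gimg_Y_eq simp del: gimg.simps)
qed (simp_all add: has_lead_def)

lemma has_lead_wimg: "set w \<subseteq> G \<Longrightarrow> has_lead zdeg (wimg gimg w) (wlead w)"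
proof (induction w)
  case (Cons g w)
  then show ?case
    using has_lead_tm[OF has_lead_gimg, of g] by (simp add: wlead_def zdeg_add)
qed (simp add: has_lead_def wlead_def)

lemma lookup_wlead:
  "lookup (wlead w) (X k) = int (count_list w (X k)) - int (count_list w (Y k))"
  "lookup (wlead w) (Y k) = int (count_list w (Y k))"
  "lookup (wlead w) T = int (count_list w T)"
proof -
  have "lookup (wlead w) (X k) = int (count_list w (X k)) - int (count_list w (Y k)) \<and>
    lookup (wlead w) (Y k) = int (count_list w (Y k)) \<and> lookup (wlead w) T = int (count_list w T)"
  proof (induction w)
    case (Cons g w)
    then show ?case
      by (cases g) (auto simp: wlead_def lookup_simps when_def)
  qed (simp add: wlead_def)
  then show "lookup (wlead w) (X k) = int (count_list w (X k)) - int (count_list w (Y k))"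
    "lookup (wlead w) (Y k) = int (count_list w (Y k))"
    "lookup (wlead w) T = int (count_list w T)"
    by auto
qed

text \<open>The Y coordinate of the leading exponent counts the y_k, and the X coordinate counts the
  x_k minus the y_k. So it determines the multiset of letters, and a sorted word is determined by
  that.\<close>

lemma wlead_sorted_inj:
  assumes "sorted u" "sorted v" "wlead u = wlead v"
  shows "u = v"
proof -
  have "count_list u g = count_list v g" for g
  proof (cases g)
    case (X k)
    then show ?thesis
      using lookup_wlead(1,2)[of u k] lookup_wlead(1,2)[of v k] assms(3) by simp
  next
    case (Y k)
    then show ?thesis
      using lookup_wlead(2)[of u k] lookup_wlead(2)[of v k] assms(3) by simp
  next
    case T
    then show ?thesis
      using lookup_wlead(3)[of u] lookup_wlead(3)[of v] assms(3) by simp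
  qed
  then have "mset u = mset v"
    by (simp add: multiset_eq_iff count_mset)
  then show ?thesis
    using assms properties_for_sort by metis
qed

text \<open>Faithfulness in a sharper form: the key obtained has the shape \<open>wlead w\<close>,
  whose coordinates satisfy the inequalities read off in \<open>S_lead\<close>.\<close>

lemma E_lead:
  assumes "f \<in> FA G" "f \<notin> ideal_of G R"
  obtains w where "wlead w \<in> keys (E f)"
proof -
  obtain h where h: "h \<in> FA G" "f \<approx> h" "\<And>u. h u \<noteq> 0 \<Longrightarrow> sorted u"
    using eqv_sorted[OF assms(1)] by metis
  have "h \<noteq> 0"
    using h(2) assms(2) by (auto simp: cong_iff)
  then have ne: "{u. h u \<noteq> 0} \<noteq> {}"
    by (auto simp: fun_eq_iff fun_apply)
  have fin: "finite {u. h u \<noteq> 0}"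
    using h(1) by (rule FA_finite)
  define M where "M = Max ((\<lambda>u. zdeg (wlead u)) ` {u. h u \<noteq> 0})"
  have "M \<in> (\<lambda>u. zdeg (wlead u)) ` {u. h u \<noteq> 0}"
    unfolding M_def using fin ne by (intro Max_in) auto
  then obtain w where w: "h w \<noteq> 0" "zdeg (wlead w) = M"
    by auto
  have le: "zdeg (wlead u) \<le> M" if "h u \<noteq> 0" for u
    unfolding M_def using fin that by (intro Max_ge) auto
  have lead: "has_lead zdeg (wimg gimg u) (wlead u)" if "h u \<noteq> 0" for u
    using has_lead_wimg[of u] h(1) that by (simp add: FA_def)
  \<comment> \<open>Another word u could contain \<open>wlead w\<close> only strictly below its own
    leading degree, but w was chosen with the greatest leading degree M.\<close>
  have other: "lookup (wimg gimg u) (wlead w) = 0" if "h u \<noteq> 0" "u \<noteq> w" for u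
  proof (rule ccontr)
    assume "lookup (wimg gimg u) (wlead w) \<noteq> 0"
    then have "wlead w \<in> keys (wimg gimg u)"
      by (simp add: in_keys_iff)
    moreover have "wlead w \<noteq> wlead u"
      using wlead_sorted_inj[of w u] h(3) w(1) that by auto
    ultimately have "zdeg (wlead w) < zdeg (wlead u)"
      using lead[OF that(1)] by (auto simp: has_lead_def)
    then show False
      using le[OF that(1)] w(2) by simp
  qed
  have "lookup (E h) (wlead w) = (\<Sum>u\<in>{u. h u \<noteq> 0}. h u * lookup (wimg gimg u) (wlead w))"
    by (simp add: ext_def lookup_sum)
  also have "\<dots> = (\<Sum>u\<in>{u. h u \<noteq> 0}. if u = w then h w * lookup (wimg gimg w) (wlead w) else 0)"
    using other by (intro sum.cong) auto
  also have "\<dots> = h w * lookup (wimg gimg w) (wlead w)"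
    using fin w(1) by simp
  also have "\<dots> \<noteq> 0"
    using w(1) lead[OF w(1)] by (simp add: has_lead_def in_keys_iff)
  finally have "wlead w \<in> keys (E h)"
    by (simp add: in_keys_iff)
  moreover have "E f = E h"
    using E_ideal[of "f - h"] h(2) ext_diff[OF assms(1) h(1)] by (simp add: cong_iff)
  ultimately show ?thesis
    using that by simp
qed

lemma E_eq_0_iff:
  assumes "f \<in> FA G"
  shows "E f = 0 \<longleftrightarrow> f \<in> ideal_of G R"
proof -
  have "E f \<noteq> 0" if nf: "f \<notin> ideal_of G R"
  proof -
    obtain w where "wlead w \<in> keys (E f)"
      using E_lead[OF assms nf] by blast
    then show ?thesis
      by auto
  qed
  then show ?thesis
    using E_ideal by blast
qed

lemma E_eq_iff:
  assumes "f \<in> FA G" "g \<in> FA G"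
  shows "E f = E g \<longleftrightarrow> f \<approx> g"
  using E_eq_0_iff[of "f - g"] ext_diff[OF assms, of gimg] assms by (simp add: cong_iff)

section \<open>The image of A[t] and the exponents that occur in it\<close>

definition S :: "(expo \<Rightarrow>\<^sub>0 'a) set" where
  "S = E ` FA G"

lemma S_tsc: "s \<in> S \<Longrightarrow> tsc c s \<in> S"
  by (auto simp: S_def ext_smult[symmetric, of _ G] intro!: imageI)

lemma
  assumes "s \<in> S" "t \<in> S"
  shows S_add: "s + t \<in> S" and S_diff: "s - t \<in> S" and S_tm: "tm s t \<in> S"
proof -
  obtain f g where fg: "f \<in> FA G" "g \<in> FA G" "s = E f" "t = E g"
    using assms by (auto simp: S_def)
  have "E (f + g) \<in> S" "E (f - g) \<in> S" "E (fa_mult f g) \<in> S"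
    unfolding S_def using fg by (auto intro!: imageI)
  then show "s + t \<in> S" "s - t \<in> S" "tm s t \<in> S"
    using fg by (simp_all add: ext_add[of _ G] ext_diff[of _ G] ext_mult[of _ G])
qed

lemma S_0: "0 \<in> S"
  unfolding S_def by (rule image_eqI[of _ _ 0]) simp_all

lemma S_one: "single 0 1 \<in> S"
  unfolding S_def by (rule image_eqI[of _ _ fa_one]) simp_all

lemma S_gimg: "g \<in> G \<Longrightarrow> gimg g \<in> S"
  unfolding S_def by (rule image_eqI[of _ _ "fa_word [g]"]) simp_all

lemma S_zel: "k \<in> {1..n} \<Longrightarrow> zel k \<in> S"
  by (subst zel_eq) (auto intro!: S_add S_tsc S_tm S_one S_gimg simp del: gimg.simps)

text \<open>The lower bound on the \<open>z\<^sub>k\<close>-exponent keeps \<open>x\<^sub>k\<^sup>-\<^sup>1\<close> out of \<open>A[t]\<close>.\<close>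

lemma S_lead:
  assumes "s \<in> S" "s \<noteq> 0"
  obtains a where "a \<in> keys s" "\<And>k. lookup a (Y k) \<ge> 0" "\<And>k. lookup a (Y k) \<ge> - lookup a (X k)"
proof -
  obtain f where f: "f \<in> FA G" "s = E f"
    using assms by (auto simp: S_def)
  then have "f \<notin> ideal_of G R"
    using E_ideal assms(2) by blast
  then obtain w where "wlead w \<in> keys s"
    using E_lead[OF f(1)] f(2) by blast
  then show ?thesis
    using that[of "wlead w"] by (simp add: lookup_wlead)
qed

text \<open>X coordinates may be negative, because of y_k. The last clause confines an exponent to
  the generators in use, as the type \<open>expo\<close> has coordinates for all indices.\<close>

definition nonneg :: "expo \<Rightarrow> bool" where
  "nonneg a \<longleftrightarrow> (\<forall>k. lookup a (Y k) \<ge> 0) \<and> lookup a T \<ge> 0 \<and> (\<forall>g. g \<notin> G \<longrightarrow> lookup a g = 0)"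

lemma S_nonneg:
  assumes "s \<in> S" "a \<in> keys s"
  shows "nonneg a"
proof -
  have add: "nonneg (a + b)" if "nonneg a" "nonneg b" for a b
    using that by (auto simp: nonneg_def lookup_add)
  have gen: "nonneg a" if g: "g \<in> G" and a: "a \<in> keys (gimg g)" for g a
  proof (cases g)
    case (X k)
    then show ?thesis
      using g a by (auto simp: nonneg_def lookup_simps when_def)
  next
    case (Y k)
    then show ?thesis
      using g a keys_gimg_Y_eq[of k] by (auto simp: nonneg_def lookup_simps when_def)
  next
    case T
    then show ?thesis
      using g a by (auto simp: nonneg_def lookup_simps when_def)
  qed
  have word: "nonneg a" if "set w \<subseteq> G" "a \<in> keys (wimg gimg w)" for w a
    using that
  proof (induction w arbitrary: a)
    case (Cons g w)
    obtain b c where "b \<in> keys (gimg g)" "c \<in> keys (wimg gimg w)" "a = b + c"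
      using Cons.prems(2) keys_tm by (metis wimg_Cons)
    then show ?case
      using Cons.prems(1) Cons.IH[of c] gen[of g b] by (auto intro!: add)
  qed (simp add: nonneg_def)
  obtain f where f: "f \<in> FA G" "s = E f"
    using assms by (auto simp: S_def)
  have "\<exists>w. f w \<noteq> 0 \<and> lookup (wimg gimg w) a \<noteq> 0"
  proof (rule ccontr)
    assume "\<not> ?thesis"
    then have "lookup s a = 0"
      unfolding f(2) ext_def lookup_sum by (intro sum.neutral) auto
    then show False
      using assms(2) by (simp add: in_keys_iff)
  qed
  then show ?thesis
    using word f(1) by (auto simp: FA_def in_keys_iff)
qed

text \<open>One letter z_k or t is split off at a time, at the cost of a nonzero factor from
  \<open>chi\<close>. Together with \<open>S_poly\<close> this is a converse of
  \<open>S_nonneg\<close> on exponents without x-part; it shows that quotients by z_j stay in the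
  algebra.\<close>

lemma S_monomial:
  assumes "nonneg a" "\<And>k. k \<in> {1..n} \<Longrightarrow> lookup a (X k) = 0"
  shows "single a 1 \<in> S"
  using assms
proof (induction "nat (zdeg a + lookup a T)" arbitrary: a rule: less_induct)
  case less
  have X: "lookup a (X k) = 0" for k
    using less.prems by (cases "k \<in> {1..n}") (auto simp: nonneg_def)
  show ?case
  proof (cases "a = 0")
    case False
    then obtain g where g: "lookup a g \<noteq> 0"
      by (auto simp: poly_mapping_eq_iff fun_eq_iff)
    have gG: "g \<in> G" "\<And>k. g \<noteq> X k"
      using g X less.prems by (auto simp: nonneg_def)
    have "lookup a g \<ge> 0"
      using less.prems(1) gG by (cases g) (auto simp: nonneg_def)
    then have pos: "lookup a g \<ge> 1"
      using g by simp
    define b where "b = a - ep g"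
    have b: "nonneg b" "\<And>k. k \<in> {1..n} \<Longrightarrow> lookup b (X k) = 0"
      using less.prems pos gG X by (auto simp: nonneg_def b_def lookup_simps when_def)
    have zd: "zdeg (ep g) + lookup (ep g) T = 1"
      using gG by (cases g) (auto simp: zdeg_def lookup_simps when_def)
    have "zdeg a = zdeg b + zdeg (ep g)" "lookup a T = lookup b T + lookup (ep g) T"
      using zdeg_add[of b "ep g"] lookup_add[of b "ep g" T] by (simp_all add: b_def)
    moreover have "zdeg b \<ge> 0" "lookup b T \<ge> 0"
      using b(1) by (auto simp: nonneg_def zdeg_def intro!: sum_nonneg)
    ultimately have "nat (zdeg b + lookup b T) < nat (zdeg a + lookup a T)"
      using zd by linarith
    then have "single b 1 \<in> S"
      using less.hyps b by blast
    moreover have "single (ep g) 1 \<in> S"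
      using gG S_gimg[of T] S_zel by (cases g) (auto simp: zel_def)
    ultimately have "tm (single (ep g) 1) (single b 1) \<in> S"
      by (intro S_tm)
    moreover have "tm (single (ep g) 1) (single b 1) = tsc (chi (ep g) b) (single a 1)"
      by (simp add: b_def)
    ultimately show ?thesis
      using S_tsc[of "tsc (chi (ep g) b) (single a 1)" "inverse (chi (ep g) b)"] by simp
  qed (simp add: S_one)
qed

lemma S_poly:
  assumes "\<And>a. a \<in> keys s \<Longrightarrow> nonneg a" "\<And>a k. a \<in> keys s \<Longrightarrow> k \<in> {1..n} \<Longrightarrow> lookup a (X k) = 0"
  shows "s \<in> S"
proof -
  have "(\<Sum>a\<in>A. tsc (lookup s a) (single a 1)) \<in> S" if "A \<subseteq> keys s" "finite A" for A
    using that(2,1) by (induction rule: finite_induct) (auto intro!: S_0 S_add S_tsc S_monomial assms simp del: tsc_single)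
  from this[of "keys s"] have "(\<Sum>a\<in>keys s. single a (lookup s a)) \<in> S"
    by simp
  then show ?thesis
    by (simp only: poly_mapping_sum_single[symmetric])
qed

end

section \<open>Normal elements\<close>

context qweyl
begin

text \<open>Words grow by one generator on the left, so a commutation property has to be checked
  against single generators only.\<close>

lemma S_induct [consumes 1, case_names zero one gen tsc add]:
  assumes "s \<in> S" and "P 0" and one: "P (single 0 1)"
    and gen: "\<And>g s. g \<in> G \<Longrightarrow> s \<in> S \<Longrightarrow> P s \<Longrightarrow> P (tm (gimg g) s)"
    and tsc: "\<And>c s. s \<in> S \<Longrightarrow> P s \<Longrightarrow> P (tsc c s)"
    and add: "\<And>s t. s \<in> S \<Longrightarrow> t \<in> S \<Longrightarrow> P s \<Longrightarrow> P t \<Longrightarrow> P (s + t)"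
  shows "P s"
proof -
  have word: "wimg gimg w \<in> S \<and> P (wimg gimg w)" if "set w \<subseteq> G" for w
    using that by (induction w) (auto intro: S_one S_tm S_gimg one gen simp del: gimg.simps)
  obtain f where f: "f \<in> FA G" "s = E f"
    using assms(1) by (auto simp: S_def)
  from f(1) have "E f \<in> S \<and> P (E f)"
  proof (induction rule: FA_induct)
    case (word c w)
    then show ?case
      using \<open>\<And>w. set w \<subseteq> G \<Longrightarrow> wimg gimg w \<in> S \<and> P (wimg gimg w)\<close>[of w]
      by (simp add: ext_smult[of _ G] S_tsc tsc)
  qed (simp_all add: S_0 \<open>P 0\<close> ext_add[of _ G] S_add add)
  then show ?thesis
    using f by simp
qed

text \<open>The inclusion of Z S in S Z: conjugation by Z, made sense of by cancellation, maps the
  algebra into itself.\<close>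

definition normal_el :: "(expo \<Rightarrow>\<^sub>0 'a) \<Rightarrow> bool" where
  "normal_el Z \<longleftrightarrow> Z \<in> S \<and> Z \<noteq> 0 \<and> (\<forall>s\<in>S. \<exists>s'\<in>S. tm Z s = tm s' Z)"

lemma zel_nz: "zel k \<noteq> 0"
  by (metis zel_def lookup_single_eq lookup_zero zero_neq_one)

lemma tm_gimg_zel:
  assumes "k \<in> {1..n}" and r: "\<And>a. a \<in> keys f \<Longrightarrow> lookup a (X k) = r"
  shows "tm f (zel k) = tsc (q k powi r) (tm (zel k) f)"
proof (rule tm_commute)
  fix a b assume ab: "a \<in> keys f" "b \<in> keys (zel k)"
  then have b: "b = ep (Y k)"
    by (simp add: zel_def)
  have "chi a b = q k powi (lookup a (X k) * lookup b (Y k))"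
    unfolding b using assms(1) by (intro chi_right_single) (auto simp: lookup_simps when_def)
  then show "chi a b = q k powi r * chi b a"
    using r[OF ab(1)] by (simp add: b chi_Y_left)
qed

lemma gimg_weight: "g \<in> G \<Longrightarrow> \<exists>r. \<forall>a\<in>keys (gimg g). lookup a (X k) = r"
proof (cases g)
  case (X i)
  then show ?thesis
    using keys_gimg_X by blast
next
  case (Y i)
  assume "g \<in> G"
  then show ?thesis
    using keys_gimg_Y[of i] Y by (simp del: gimg.simps)
qed auto

text \<open>Each generator is homogeneous in x_k, so z_k commutes with it up to a power of q_k;
  products and sums inherit the existence of s'.\<close>

lemma normal_zel:
  assumes k: "k \<in> {1..n}"
  shows "normal_el (zel k)"
proof -
  have "\<exists>s'\<in>S. tm (zel k) s = tm s' (zel k)" if "s \<in> S" for s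
    using that
  proof (induction rule: S_induct)
    case zero
    show ?case
      by (rule bexI[OF _ S_0]) simp
  next
    case one
    show ?case
      by (rule bexI[OF _ S_one]) simp
  next
    case (gen g s)
    obtain s' where s': "s' \<in> S" "tm (zel k) s = tm s' (zel k)"
      using gen by blast
    obtain r where "\<And>a. a \<in> keys (gimg g) \<Longrightarrow> lookup a (X k) = r"
      using gimg_weight[OF gen(1)] by blast
    from tm_gimg_zel[OF k this] have "tsc (inverse (q k powi r)) (tm (gimg g) (zel k)) = tm (zel k) (gimg g)"
      using q_nz[OF k] by simp
    then have "tm (zel k) (tm (gimg g) s) = tm (tsc (inverse (q k powi r)) (tm (gimg g) (zel k))) s"
      by (simp only: mu_assoc[symmetric])
    also have "\<dots> = tm (tsc (inverse (q k powi r)) (tm (gimg g) s')) (zel k)"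
      by (simp add: mu_assoc s'(2) del: gimg.simps)
    finally show ?case
      by (rule bexI) (intro S_tsc S_tm S_gimg gen s')
  next
    case (tsc c s)
    then obtain s' where "s' \<in> S" "tm (zel k) s = tm s' (zel k)"
      by blast
    then show ?case
      by (intro bexI[of _ "tsc c s'"]) (simp_all add: S_tsc)
  next
    case (add s t)
    then obtain s' t' where "s' \<in> S" "tm (zel k) s = tm s' (zel k)" "t' \<in> S" "tm (zel k) t = tm t' (zel k)"
      by blast
    then show ?case
      by (intro bexI[of _ "s' + t'"]) (simp_all add: S_add tm_add_left tm_add_right)
  qed
  then show ?thesis
    using S_zel[OF k] zel_nz by (simp add: normal_el_def)
qed

text \<open>For every additive weight, the top weight of w is at most that of e, since the top
  weight of Z cancels. Using each coordinate and its negative as the weight leaves e as the only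
  exponent of w.\<close>

lemma commute_past_monomial:
  assumes Z: "Z \<noteq> 0" and eq: "tm Z (single e 1) = tm w Z"
  obtains c where "c \<noteq> 0" "w = single e c"
proof -
  have e: "single e (1::'a) \<noteq> 0"
    by (metis lookup_single_eq lookup_zero zero_neq_one)
  have w: "w \<noteq> 0"
    using eq Z e tm_eq_0_iff[of Z "single e 1"] by auto
  have le: "\<omega> d \<le> \<omega> e" if "d \<in> keys w" and add: "\<And>a b. \<omega> (a + b) = \<omega> a + \<omega> b" for d and \<omega> :: "expo \<Rightarrow> int"
  proof -
    obtain a b where ab: "a + b \<in> keys (tm w Z)" "\<And>a'. a' \<in> keys w \<Longrightarrow> \<omega> a' \<le> \<omega> a"
      "\<And>b'. b' \<in> keys Z \<Longrightarrow> \<omega> b' \<le> \<omega> b"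
      using tm_top[OF w Z add] by metis
    from ab(1) obtain b' where b': "b' \<in> keys Z" "a + b = b' + e"
      unfolding eq[symmetric] by (auto elim!: keys_tm)
    show ?thesis
      using ab(2)[OF that(1)] ab(3)[OF b'(1)] add[of a b] add[of b' e] b'(2) by simp
  qed
  have "d = e" if "d \<in> keys w" for d
  proof (rule poly_mapping_eqI)
    fix g
    show "lookup d g = lookup e g"
      using le[OF that, of "\<lambda>a. lookup a g"] le[OF that, of "\<lambda>a. - lookup a g"]
      by (simp add: lookup_add)
  qed
  then have "w = single e (lookup w e)"
    by (intro poly_mapping_eqI) (auto simp: lookup_single when_def in_keys_iff)
  then show ?thesis
    using that w by (metis single_zero)
qed

lemma inverse_X_notin_S:
  assumes "k \<in> {1..n}"
  shows "single (- ep (X k)) 1 \<notin> S"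
proof
  assume "single (- ep (X k)) 1 \<in> S"
  moreover have "single (- ep (X k)) (1::'a) \<noteq> 0"
    by (metis lookup_single_eq lookup_zero zero_neq_one)
  ultimately obtain a where a: "a \<in> keys (single (- ep (X k)) (1::'a))" "lookup a (Y k) \<ge> - lookup a (X k)"
    using S_lead by metis
  then show False
    by (simp add: lookup_simps when_def)
qed

text \<open>Moving Z past z_k gives a scalar c, past x_k a scalar \<gamma>, past y_k an element v of
  \<open>S\<close>. Inserting z_k = 1 + (q_k - 1) y_k x_k into the first rule yields c z_k = 1 +
  (q_k - 1) \<gamma> v x_k. Multiplied by x_k^{-1}, this expresses (1 - c) x_k^{-1} by elements of
  \<open>S\<close>, so c = 1 and the x_k-weight is 0. The scalar for x_k then determines the
  exponent of z_k, which is therefore the same on the whole support.\<close>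

lemma normal_keys:
  assumes Z: "normal_el Z"
  obtains \<kappa> where "\<And>a k. a \<in> keys Z \<Longrightarrow> k \<in> {1..n} \<Longrightarrow> lookup a (X k) = 0"
    "\<And>a k. a \<in> keys Z \<Longrightarrow> k \<in> {1..n} \<Longrightarrow> lookup a (Y k) = \<kappa> k"
proof -
  have Z0: "Z \<noteq> 0"
    using Z by (simp add: normal_el_def)
  have comm_x: "\<exists>c. c \<noteq> 0 \<and> tm Z (gimg (X k)) = tsc c (tm (gimg (X k)) Z)" if k: "k \<in> {1..n}" for k
  proof -
    obtain w where w: "tm Z (gimg (X k)) = tm w Z"
      using Z S_gimg[of "X k"] k unfolding normal_el_def by (auto simp del: gimg.simps)
    then obtain c where "c \<noteq> 0" "w = single (ep (X k)) c"
      using commute_past_monomial[OF Z0, of "ep (X k)" w] by auto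
    moreover from this have "w = tsc c (gimg (X k))"
      by simp
    ultimately show ?thesis
      using w by (metis mu_sc_left)
  qed
  have X: "lookup a (X k) = 0" if a: "a \<in> keys Z" and k: "k \<in> {1..n}" for a k
  proof -
    obtain w where w: "tm Z (zel k) = tm w Z"
      using Z S_zel[OF k] unfolding normal_el_def by blast
    then obtain c where "w = single (ep (Y k)) c"
      using commute_past_monomial[OF Z0, of "ep (Y k)" w] unfolding zel_def by metis
    then have "w = tsc c (zel k)"
      by (simp add: zel_def)
    then have wz: "tm Z (zel k) = tsc c (tm (zel k) Z)"
      using w by simp
    obtain \<gamma> where \<gamma>: "\<gamma> \<noteq> 0" "tm Z (gimg (X k)) = tsc \<gamma> (tm (gimg (X k)) Z)"
      using comm_x[OF k] by blast
    obtain v where v: "v \<in> S" "tm Z (gimg (Y k)) = tm v Z"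
      using Z S_gimg[of "Y k"] k unfolding normal_el_def by (auto simp del: gimg.simps)
    define xi where "xi = single (- ep (X k)) (1::'a)"
    have "tm Z (zel k) = Z + tsc (q k - 1) (tm (tm Z (gimg (Y k))) (gimg (X k)))"
      by (simp add: zel_eq[OF k] tm_add_right mu_assoc del: gimg.simps)
    also have "\<dots> = Z + tsc (q k - 1) (tm v (tm Z (gimg (X k))))"
      by (simp add: v(2) mu_assoc del: gimg.simps)
    also have "\<dots> = tm (single 0 1 + tsc ((q k - 1) * \<gamma>) (tm v (gimg (X k)))) Z"
      by (simp add: \<gamma>(2) tm_add_left mu_assoc del: gimg.simps)
    finally have "tm (tsc c (zel k)) Z = tm (single 0 1 + tsc ((q k - 1) * \<gamma>) (tm v (gimg (X k)))) Z"
      by (simp add: wz del: gimg.simps)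
    then have "tsc c (zel k) = single 0 1 + tsc ((q k - 1) * \<gamma>) (tm v (gimg (X k)))"
      using tm_right_cancel[OF Z0] by blast
    then have "tm (tsc c (zel k)) xi = tm (single 0 1 + tsc ((q k - 1) * \<gamma>) (tm v (gimg (X k)))) xi"
      by simp
    moreover have "tm (gimg (X k)) xi = single 0 1"
      using k by (simp add: xi_def chi_minus_right chi_X_X)
    ultimately have 1: "tsc c (tm (zel k) xi) = xi + tsc ((q k - 1) * \<gamma>) v"
      by (simp add: tm_add_left mu_assoc del: gimg.simps)
    have 2: "tsc (q k - 1) (gimg (Y k)) = tm (zel k) xi - xi"
      using q_ne_1[OF k] by (simp add: zel_def xi_def chi_Y_left del: tsc_single)
    have "tsc c (tsc (q k - 1) (gimg (Y k))) = xi + tsc ((q k - 1) * \<gamma>) v - tsc c xi"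
      by (simp only: 2 sc_diff_right 1)
    then have "tsc (1 - c) xi = tsc c (tsc (q k - 1) (gimg (Y k))) - tsc ((q k - 1) * \<gamma>) v"
      by (simp only: sc_diff_left sc_one) simp
    then have "tsc (1 - c) xi \<in> S"
      using S_gimg[of "Y k"] k v(1) by (auto intro!: S_diff S_tsc simp del: gimg.simps sc_sc)
    \<comment> \<open>Otherwise division by 1 - c would place x_k^{-1} in \<open>S\<close>.\<close>
    then have "c = 1"
      using S_tsc[of "tsc (1 - c) xi" "inverse (1 - c)"] inverse_X_notin_S[OF k]
      by (cases "c = 1") (auto simp: xi_def simp del: tsc_single)
    then have "chi a (ep (Y k)) = 1"
      using chi_of_commute_single[of Z "ep (Y k)" c a] wz a by (simp add: zel_def chi_Y_left)
    moreover have "chi a (ep (Y k)) = q k powi (lookup a (X k) * lookup (ep (Y k)) (Y k))"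
      using k by (intro chi_right_single) (auto simp: lookup_simps when_def)
    ultimately show ?thesis
      using q_powi_eq_1[OF k] by simp
  qed
  have Y: "lookup a (Y k) = lookup b (Y k)" if ab: "a \<in> keys Z" "b \<in> keys Z" and k: "k \<in> {1..n}" for a b k
  proof -
    obtain c where c: "c \<noteq> 0" "tm Z (gimg (X k)) = tsc c (tm (gimg (X k)) Z)"
      using comm_x[OF k] by blast
    have "c * q k powi lookup d (Y k) = 1" if d: "d \<in> keys Z" for d
    proof -
      have "chi d (ep (X k)) = c * chi (ep (X k)) d"
        using chi_of_commute_single[of Z "ep (X k)" c d] c(2) d by simp
      moreover have "chi d (ep (X k)) = 1"
        using X[OF d] by (intro chi_left_eq_1)
      moreover have "chi (ep (X k)) d = q k powi (lookup (ep (X k)) (X k) * lookup d (Y k))"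
        using k X[OF d] by (intro chi_right_single) (auto simp: lookup_simps when_def)
      ultimately show ?thesis
        by simp
    qed
    from this[OF ab(1)] this[OF ab(2)] c(1) have "q k powi lookup a (Y k) = q k powi lookup b (Y k)"
      by (metis mult_left_cancel)
    then have "q k powi (lookup a (Y k) - lookup b (Y k)) = 1"
      using q_nz[OF k] by (simp add: power_int_diff)
    then show ?thesis
      using q_powi_eq_1[OF k] by fastforce
  qed
  obtain a0 where "a0 \<in> keys Z"
    using Z0 by (metis ex_in_conv keys_eq_empty)
  then show ?thesis
    using that[of "\<lambda>k. lookup a0 (Y k)"] X Y by blast
qed

text \<open>Division by z_j only shifts the exponents; the hypotheses keep them in the range where
  \<open>S_poly\<close> gives membership.\<close>

lemma zel_factor:
  assumes s: "s \<in> S" "s \<noteq> 0" and j: "j \<in> {1..n}"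
    and X: "\<And>a k. a \<in> keys s \<Longrightarrow> k \<in> {1..n} \<Longrightarrow> lookup a (X k) = 0"
    and Y: "\<And>a. a \<in> keys s \<Longrightarrow> lookup a (Y j) \<ge> 1"
  obtains W where "W \<in> S" "W \<noteq> 0" "s = tm (zel j) W"
    "\<And>b. b \<in> keys W \<Longrightarrow> \<exists>a\<in>keys s. b = a - ep (Y j)"
proof -
  define W where "W = tm (single (- ep (Y j)) 1) s"
  have keys: "\<exists>a\<in>keys s. b = a - ep (Y j)" if "b \<in> keys W" for b
    using keys_tm[OF that[unfolded W_def]] by force
  have sW: "s = tm (zel j) W"
    by (simp add: W_def zel_def chi_Y_left flip: mu_assoc)
  then have "W \<noteq> 0"
    using s(2) by auto
  have "W \<in> S"
  proof (rule S_poly)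
    fix b assume "b \<in> keys W"
    then obtain a where a: "a \<in> keys s" "b = a - ep (Y j)"
      using keys by blast
    have "nonneg a"
      using S_nonneg[OF s(1) a(1)] .
    then show "nonneg b"
      using Y[OF a(1)] j by (auto simp: nonneg_def a(2) lookup_simps when_def)
    show "lookup b (X k) = 0" if "k \<in> {1..n}" for k
      using X[OF a(1) that] by (simp add: a(2) lookup_simps)
  qed
  then show ?thesis
    using that[OF _ \<open>W \<noteq> 0\<close> sW] keys by blast
qed

lemma gimg_nz:
  assumes "g \<in> G"
  shows "gimg g \<noteq> 0"
  using has_lead_gimg[OF assms] by (auto simp: has_lead_def)

lemma gimg_X_X:
  assumes "i \<in> {1..n}" "j \<in> {1..n}" "i \<noteq> j"
  shows "tm (gimg (X i)) (gimg (X j)) = tsc (lam i j) (tm (gimg (X j)) (gimg (X i)))"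
  using keys_gimg_X assms chi_cross[OF assms] by (intro tm_commute) fastforce

end

section \<open>Isomorphisms\<close>

text \<open>The isomorphism is placed between the two images, where congruence has become equality.
  Outside \<open>A.S\<close> nothing is assumed about \<Phi>.\<close>

locale qw_iso = A: qweyl n q lam + C: qweyl m q' lam'
  for n q and lam :: "nat \<Rightarrow> nat \<Rightarrow> 'a::field" and m q' and lam' :: "nat \<Rightarrow> nat \<Rightarrow> 'a" +
  fixes \<Phi> :: "(expo \<Rightarrow>\<^sub>0 'a) \<Rightarrow> (expo \<Rightarrow>\<^sub>0 'a)"
  assumes Phi_add: "s \<in> A.S \<Longrightarrow> t \<in> A.S \<Longrightarrow> \<Phi> (s + t) = \<Phi> s + \<Phi> t"
    and Phi_tsc: "s \<in> A.S \<Longrightarrow> \<Phi> (A.tsc c s) = C.tsc c (\<Phi> s)"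
    and Phi_tm: "s \<in> A.S \<Longrightarrow> t \<in> A.S \<Longrightarrow> \<Phi> (A.tm s t) = C.tm (\<Phi> s) (\<Phi> t)"
    and Phi_one: "\<Phi> (single 0 1) = single 0 1"
    and Phi_bij: "bij_betw \<Phi> A.S C.S"
begin

section \<open>Transport along the isomorphism and its inverse\<close>

definition \<Psi> :: "(expo \<Rightarrow>\<^sub>0 'a) \<Rightarrow> (expo \<Rightarrow>\<^sub>0 'a)" where
  "\<Psi> = inv_into A.S \<Phi>"

lemma Phi_S: "s \<in> A.S \<Longrightarrow> \<Phi> s \<in> C.S"
  using Phi_bij by (rule bij_betw_apply)

lemma Psi_Phi: "s \<in> A.S \<Longrightarrow> \<Psi> (\<Phi> s) = s"
  unfolding \<Psi>_def using Phi_bij by (rule bij_betw_inv_into_left)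

lemma Phi_Psi: "s \<in> C.S \<Longrightarrow> \<Phi> (\<Psi> s) = s"
  unfolding \<Psi>_def using Phi_bij by (rule bij_betw_inv_into_right)

lemma Psi_bij: "bij_betw \<Psi> C.S A.S"
  unfolding \<Psi>_def using Phi_bij by (rule bij_betw_inv_into)

lemma Psi_S: "s \<in> C.S \<Longrightarrow> \<Psi> s \<in> A.S"
  using Psi_bij by (rule bij_betw_apply)

lemma inverse_iso: "qw_iso m q' lam' n q lam \<Psi>"
proof unfold_locales
  show "\<Psi> (s + t) = \<Psi> s + \<Psi> t" "\<Psi> (C.tm s t) = A.tm (\<Psi> s) (\<Psi> t)" if "s \<in> C.S" "t \<in> C.S" for s t
    using that Psi_Phi[of "\<Psi> s + \<Psi> t"] Psi_Phi[of "A.tm (\<Psi> s) (\<Psi> t)"]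
    by (simp_all add: Phi_add Phi_tm Phi_Psi Psi_S A.S_add A.S_tm)
  show "\<Psi> (C.tsc c s) = A.tsc c (\<Psi> s)" if "s \<in> C.S" for s c
    using that Psi_Phi[of "A.tsc c (\<Psi> s)"] by (simp add: Phi_tsc Phi_Psi Psi_S A.S_tsc)
  show "\<Psi> (single 0 1) = single 0 1"
    using Psi_Phi[OF A.S_one] by (simp add: Phi_one)
  show "bij_betw \<Psi> C.S A.S"
    by (rule Psi_bij)
qed

lemma Phi_eq_iff: "s \<in> A.S \<Longrightarrow> t \<in> A.S \<Longrightarrow> \<Phi> s = \<Phi> t \<longleftrightarrow> s = t"
  using Psi_Phi by metis

lemma Phi_0: "\<Phi> 0 = 0"
  using Phi_tsc[OF A.S_0, of 0] by simp

lemma Phi_nz: "s \<in> A.S \<Longrightarrow> s \<noteq> 0 \<Longrightarrow> \<Phi> s \<noteq> 0"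
  using Phi_eq_iff[OF _ A.S_0] Phi_0 by simp

lemma normal_Phi:
  assumes "A.normal_el Z"
  shows "C.normal_el (\<Phi> Z)"
proof -
  have Z: "Z \<in> A.S" "Z \<noteq> 0"
    using assms by (auto simp: A.normal_el_def)
  have "\<exists>s'\<in>C.S. C.tm (\<Phi> Z) s = C.tm s' (\<Phi> Z)" if s: "s \<in> C.S" for s
  proof -
    obtain s' where s': "s' \<in> A.S" "A.tm Z (\<Psi> s) = A.tm s' Z"
      using assms Psi_S[OF s] unfolding A.normal_el_def by blast
    have "C.tm (\<Phi> Z) s = C.tm (\<Phi> s') (\<Phi> Z)"
      using arg_cong[OF s'(2), of \<Phi>] by (simp add: Phi_tm Phi_Psi Psi_S Z s'(1) s)
    then show ?thesis
      using Phi_S[OF s'(1)] by blast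
  qed
  then show ?thesis
    using Z Phi_S Phi_nz by (simp add: C.normal_el_def)
qed

text \<open>\<open>normal_keys\<close> leaves open that the image of z_i might involve t only. It
  would then be central, whereas x_i z_i = q_i z_i x_i with q_i not 1; so some exponent is
  positive.\<close>

lemma zel_exponents:
  assumes i: "i \<in> {1..n}"
  obtains \<kappa> where
    "\<forall>a\<in>keys (\<Phi> (A.zel i)). \<forall>k\<in>{1..m}. lookup a (X k) = 0 \<and> lookup a (Y k) = \<kappa> k"
    "\<forall>k\<in>{1..m}. \<kappa> k \<ge> 0" "\<exists>k\<in>{1..m}. \<kappa> k \<ge> 1"
proof -
  let ?Z = "\<Phi> (A.zel i)"
  have SZ: "?Z \<in> C.S" "?Z \<noteq> 0"
    using normal_Phi[OF A.normal_zel[OF i]] by (auto simp: C.normal_el_def)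
  obtain \<kappa> where \<kappa>: "\<And>a k. a \<in> keys ?Z \<Longrightarrow> k \<in> {1..m} \<Longrightarrow> lookup a (X k) = 0"
    "\<And>a k. a \<in> keys ?Z \<Longrightarrow> k \<in> {1..m} \<Longrightarrow> lookup a (Y k) = \<kappa> k"
    using C.normal_keys[OF normal_Phi[OF A.normal_zel[OF i]]] by metis
  obtain a0 where a0: "a0 \<in> keys ?Z"
    using SZ(2) by (metis ex_in_conv keys_eq_empty)
  have nn: "\<kappa> k \<ge> 0" if "k \<in> {1..m}" for k
    using C.S_nonneg[OF SZ(1) a0] \<kappa>(2)[OF a0 that] unfolding C.nonneg_def by metis
  have "\<exists>k\<in>{1..m}. \<kappa> k \<ge> 1"
  proof (rule ccontr)
    assume "\<not> ?thesis"
    then have \<kappa>0: "\<kappa> k = 0" if "k \<in> {1..m}" for k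
      using nn[OF that] that by force
    let ?x = "A.gimg (X i)"
    have xS: "?x \<in> A.S" "A.zel i \<in> A.S"
      using i A.S_gimg[of "X i"] A.S_zel by auto
    have "C.tm ?Z (\<Phi> ?x) = C.tsc 1 (C.tm (\<Phi> ?x) ?Z)"
    proof (rule C.tm_commute)
      fix a b assume "a \<in> keys ?Z"
      then show "C.chi a b = 1 * C.chi b a"
        using \<kappa> \<kappa>0 C.chi_left_eq_1[of a b] C.chi_right[of a b] by simp
    qed
    then have "\<Phi> (A.tm (A.zel i) ?x) = \<Phi> (A.tm ?x (A.zel i))"
      using xS by (simp add: Phi_tm)
    then have "A.tm (A.zel i) ?x = A.tm ?x (A.zel i)"
      using xS Phi_eq_iff A.S_tm by blast
    also have "\<dots> = A.tsc (q i powi 1) (A.tm (A.zel i) ?x)"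
      using i A.keys_gimg_X by (intro A.tm_gimg_zel) auto
    finally have "A.tsc (q i - 1) (A.tm (A.zel i) ?x) = 0"
      by (simp add: A.sc_diff_left del: A.gimg.simps)
    then show False
      using A.q_ne_1[OF i] A.zel_nz A.gimg_nz[of "X i"] i
      by (simp add: A.tsc_eq_0_iff A.tm_eq_0_iff del: A.gimg.simps)
  qed
  then show ?thesis
    using that \<kappa> nn by blast
qed

text \<open>z_i has total z-degree 1, and by \<open>zel_exponents\<close> for the inverse every
  factor z'_j split off from the image of z_i pulls back to z-degree at least 1. So exactly one such
  factor exists, and it pulls back to exponent 1 at i and 0 elsewhere. The conclusion about \<Psi>
  is what makes the assignment of j to i injective.\<close>

lemma zel_permutation:
  assumes i: "i \<in> {1..n}"
  obtains j where "j \<in> {1..m}"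
    "\<And>a k. a \<in> keys (\<Phi> (A.zel i)) \<Longrightarrow> k \<in> {1..m} \<Longrightarrow> lookup a (X k) = 0"
    "\<And>a k. a \<in> keys (\<Phi> (A.zel i)) \<Longrightarrow> k \<in> {1..m} \<Longrightarrow> lookup a (Y k) = (if k = j then 1 else 0)"
    "\<And>b k. b \<in> keys (\<Psi> (C.zel j)) \<Longrightarrow> k \<in> {1..n} \<Longrightarrow> lookup b (Y k) = (if k = i then 1 else 0)"
proof -
  interpret I: qw_iso m q' lam' n q lam \<Psi>
    by (rule inverse_iso)
  let ?Z = "\<Phi> (A.zel i)"
  have SZ: "?Z \<in> C.S" "?Z \<noteq> 0"
    using normal_Phi[OF A.normal_zel[OF i]] by (auto simp: C.normal_el_def)
  obtain \<kappa> where exps: "\<forall>a\<in>keys ?Z. \<forall>k\<in>{1..m}. lookup a (X k) = 0 \<and> lookup a (Y k) = \<kappa> k"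
    "\<forall>k\<in>{1..m}. \<kappa> k \<ge> 0" "\<exists>k\<in>{1..m}. \<kappa> k \<ge> 1"
    by (rule zel_exponents[OF i])
  then have \<kappa>: "\<And>a k. a \<in> keys ?Z \<Longrightarrow> k \<in> {1..m} \<Longrightarrow> lookup a (X k) = 0"
    "\<And>a k. a \<in> keys ?Z \<Longrightarrow> k \<in> {1..m} \<Longrightarrow> lookup a (Y k) = \<kappa> k"
    "\<And>k. k \<in> {1..m} \<Longrightarrow> \<kappa> k \<ge> 0"
    by blast+
  have factor: "\<exists>W\<in>C.S. W \<noteq> 0 \<and> ?Z = C.tm (C.zel j) W \<and> (\<forall>b\<in>keys W. \<exists>a\<in>keys ?Z. b = a - ep (Y j))"
    if j: "j \<in> {1..m}" "\<kappa> j \<ge> 1" for j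
    by (rule C.zel_factor[OF SZ j(1)]) (use \<kappa> j in auto)
  have zS: "A.zel i \<in> A.S"
    using i by (rule A.S_zel)
  have SY: "lookup b (Y k) \<ge> 0" if "s \<in> A.S" "b \<in> keys s" for s b k
    using A.S_nonneg[OF that] by (simp add: A.nonneg_def)
  \<comment> \<open>Holds for every z'_j that can be split off: the z-exponents of the two factors
    of z_i are nonnegative and add up to those of z_i.\<close>
  have 1: "lookup b (Y k) = (if k = i then 1 else 0)"
    if j: "j \<in> {1..m}" "\<kappa> j \<ge> 1" and b: "b \<in> keys (\<Psi> (C.zel j))" and k: "k \<in> {1..n}" for j b k
  proof -
    obtain W where W: "W \<in> C.S" "W \<noteq> 0" "?Z = C.tm (C.zel j) W"
      using factor[OF j] by blast
    have "A.zel i = \<Psi> (C.tm (C.zel j) W)"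
      using W(3) Psi_Phi[OF zS] by simp
    also have "\<dots> = A.tm (\<Psi> (C.zel j)) (\<Psi> W)"
      using C.S_zel[OF j(1)] W(1) by (rule I.Phi_tm)
    finally have eq: "A.zel i = A.tm (\<Psi> (C.zel j)) (\<Psi> W)" .
    obtain l where exps': "\<forall>a\<in>keys (\<Psi> (C.zel j)). \<forall>k\<in>{1..n}. lookup a (X k) = 0 \<and> lookup a (Y k) = l k"
      "\<forall>k\<in>{1..n}. l k \<ge> 0" "\<exists>k\<in>{1..n}. l k \<ge> 1"
      by (rule I.zel_exponents[OF j(1)])
    then have l: "\<And>a k. a \<in> keys (\<Psi> (C.zel j)) \<Longrightarrow> k \<in> {1..n} \<Longrightarrow> lookup a (Y k) = l k"
      "\<And>k. k \<in> {1..n} \<Longrightarrow> l k \<ge> 0"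
      by blast+
    have "\<Psi> (C.zel j) \<noteq> 0" "\<Psi> W \<noteq> 0"
      using I.Phi_nz C.S_zel[OF j(1)] C.zel_nz W by auto
    then obtain a c where ac: "a \<in> keys (\<Psi> (C.zel j))" "c \<in> keys (\<Psi> W)" "a + c \<in> keys (A.zel i)"
      unfolding eq using A.tm_top[of "\<Psi> (C.zel j)" "\<Psi> W" "\<lambda>_. 0"] by (metis add_0)
    have "a + c = ep (Y i)"
      using ac(3) by (simp add: A.zel_def)
    then have sum: "lookup a (Y k) + lookup c (Y k) = (if k = i then 1 else 0)" for k
      using lookup_add[of a c "Y k"] by (simp add: lookup_single when_def)
    have le: "l k \<le> (if k = i then 1 else 0)" if "k \<in> {1..n}" for k
      using sum[of k] l(1)[OF ac(1) that] SY[OF Psi_S[OF W(1)] ac(2), of k] by simp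
    obtain k0 where k0: "k0 \<in> {1..n}" "l k0 \<ge> 1"
      using exps'(3) by blast
    then have "k0 = i"
      using le[OF k0(1)] by (cases "k0 = i") auto
    then have "l k = (if k = i then 1 else 0)"
      using le[OF k] l(2)[OF k] k0 by (cases "k = i") auto
    then show ?thesis
      using l(1)[OF b k] by simp
  qed
  obtain j where j: "j \<in> {1..m}" "\<kappa> j \<ge> 1"
    using exps(3) by blast
  have "\<kappa> k = (if k = j then 1 else 0)" if k: "k \<in> {1..m}" for k
  proof (rule ccontr)
    assume neq: "\<kappa> k \<noteq> (if k = j then 1 else 0)"
    \<comment> \<open>A wrong exponent means that k differs from j or that \<kappa> j is at least 2.
      Either way z'_k can be split off after z'_j, and the two pull back to exponent at least 2 at
      i.\<close>
    have kpos: "\<kappa> k \<ge> 1"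
      using neq \<kappa>(3)[OF k] j(2) by (cases "k = j") auto
    obtain W where W: "W \<in> C.S" "W \<noteq> 0" "?Z = C.tm (C.zel j) W"
      "\<forall>b\<in>keys W. \<exists>a\<in>keys ?Z. b = a - ep (Y j)"
      using factor[OF j] by blast
    have WX: "lookup b (X k') = 0" if b: "b \<in> keys W" and k': "k' \<in> {1..m}" for b k'
    proof -
      obtain a where a: "a \<in> keys ?Z" "b = a - ep (Y j)"
        using W(4) b by blast
      then show ?thesis
        using \<kappa>(1)[OF a(1) k'] by (simp add: A.lookup_simps)
    qed
    have WY: "lookup b (Y k) \<ge> 1" if b: "b \<in> keys W" for b
    proof -
      obtain a where a: "a \<in> keys ?Z" "b = a - ep (Y j)"
        using W(4) b by blast
      have "lookup b (Y k) = \<kappa> k - (if k = j then 1 else 0)"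
        using \<kappa>(2)[OF a(1) k] by (simp add: a(2) A.lookup_simps when_def)
      then show ?thesis
        using neq kpos by (cases "k = j") simp_all
    qed
    have "\<exists>V\<in>C.S. W = C.tm (C.zel k) V"
      by (rule C.zel_factor[OF W(1,2) k]) (use WX WY in blast)+
    then obtain V where V: "V \<in> C.S" "W = C.tm (C.zel k) V"
      by blast
    have S: "C.zel j \<in> C.S" "C.zel k \<in> C.S"
      using C.S_zel j k by auto
    have "A.zel i = \<Psi> (C.tm (C.zel j) (C.tm (C.zel k) V))"
      using W(3) V(2) Psi_Phi[OF zS] by simp
    also have "\<dots> = A.tm (\<Psi> (C.zel j)) (A.tm (\<Psi> (C.zel k)) (\<Psi> V))"
      using S V(1) by (simp add: I.Phi_tm C.S_tm)
    finally have "ep (Y i) \<in> keys (A.tm (\<Psi> (C.zel j)) (A.tm (\<Psi> (C.zel k)) (\<Psi> V)))"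
      by (metis A.zel_def keys_single insertI1 zero_neq_one)
    then obtain a b c where abc: "a \<in> keys (\<Psi> (C.zel j))" "b \<in> keys (\<Psi> (C.zel k))" "c \<in> keys (\<Psi> V)"
      "ep (Y i) = a + (b + c)"
      by (metis A.keys_tm)
    have "lookup (ep (Y i)) (Y i) = lookup a (Y i) + (lookup b (Y i) + lookup c (Y i))"
      by (simp only: abc(4) lookup_add)
    then show False
      using 1[OF j abc(1) i] 1[OF k kpos abc(2) i] SY[OF Psi_S[OF V(1)] abc(3), of i] by simp
  qed
  then show ?thesis
    using that[OF j(1)] \<kappa>(1,2) 1[OF j] by simp
qed

lemma permutation_exists:
  obtains \<sigma> where "inj_on \<sigma> {1..n}" "\<sigma> ` {1..n} \<subseteq> {1..m}"
    "\<forall>i\<in>{1..n}. \<forall>a\<in>keys (\<Phi> (A.zel i)). \<forall>k\<in>{1..m}.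
       lookup a (X k) = 0 \<and> lookup a (Y k) = (if k = \<sigma> i then 1 else 0)"
proof -
  interpret I: qw_iso m q' lam' n q lam \<Psi>
    by (rule inverse_iso)
  have "\<forall>i\<in>{1..n}. \<exists>j. j \<in> {1..m} \<and>
    (\<forall>a\<in>keys (\<Phi> (A.zel i)). \<forall>k\<in>{1..m}. lookup a (X k) = 0 \<and> lookup a (Y k) = (if k = j then 1 else 0)) \<and>
    (\<forall>b\<in>keys (\<Psi> (C.zel j)). \<forall>k\<in>{1..n}. lookup b (Y k) = (if k = i then 1 else 0))"
  proof
    fix i assume i: "i \<in> {1..n}"
    show "\<exists>j. j \<in> {1..m} \<and>
    (\<forall>a\<in>keys (\<Phi> (A.zel i)). \<forall>k\<in>{1..m}. lookup a (X k) = 0 \<and> lookup a (Y k) = (if k = j then 1 else 0)) \<and>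
    (\<forall>b\<in>keys (\<Psi> (C.zel j)). \<forall>k\<in>{1..n}. lookup b (Y k) = (if k = i then 1 else 0))"
      by (rule zel_permutation[OF i]) blast
  qed
  from bchoice[OF this] obtain \<sigma> where \<sigma>: "\<forall>i\<in>{1..n}. \<sigma> i \<in> {1..m} \<and>
    (\<forall>a\<in>keys (\<Phi> (A.zel i)). \<forall>k\<in>{1..m}. lookup a (X k) = 0 \<and> lookup a (Y k) = (if k = \<sigma> i then 1 else 0)) \<and>
    (\<forall>b\<in>keys (\<Psi> (C.zel (\<sigma> i))). \<forall>k\<in>{1..n}. lookup b (Y k) = (if k = i then 1 else 0))"
    by blast
  have "inj_on \<sigma> {1..n}"
  proof (rule inj_onI)
    fix i i' assume ii': "i \<in> {1..n}" "i' \<in> {1..n}" "\<sigma> i = \<sigma> i'"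
    have "\<sigma> i \<in> {1..m}"
      using \<sigma> ii'(1) by blast
    then have "\<Psi> (C.zel (\<sigma> i)) \<noteq> 0"
      using I.Phi_nz C.S_zel C.zel_nz by blast
    then obtain b where b: "b \<in> keys (\<Psi> (C.zel (\<sigma> i)))"
      by (metis ex_in_conv keys_eq_empty)
    have "lookup b (Y i) = 1" "lookup b (Y i) = (if i = i' then 1 else 0)"
      using \<sigma> ii' b by (simp, metis)
    then show "i = i'"
      by (metis zero_neq_one)
  qed
  then show ?thesis
    using that[of \<sigma>] \<sigma> by blast
qed

lemma le_of_iso: "n \<le> m"
proof -
  obtain \<sigma> where "inj_on \<sigma> {1..n}" "\<sigma> ` {1..n} \<subseteq> {1..m}"
    using permutation_exists by metis
  then show ?thesis
    using card_inj_on_le[of \<sigma> "{1..n}" "{1..m}"] by simp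
qed

lemma eq_of_iso: "m = n"
  using le_of_iso qw_iso.le_of_iso[OF inverse_iso] by simp

text \<open>The support of \<Phi>(y_i) \<Phi>(x_i) lies in that of \<Phi>(z_i) together with 0, so
  this product has x-weight 0, and z-weight at most 1, at \<sigma> i only. Its factors are then
  homogeneous of opposite x-weights. Commutation with \<Phi>(z_j) turns the weights into exponents
  of powers of q': they vanish outside \<sigma> i and are nonzero there because q_i is not 1.
  \<open>S_lead\<close> bounds them by 1.\<close>

lemma gen_weight:
  assumes \<sigma>: "bij_betw \<sigma> {1..n} {1..m}"
    and X0: "\<And>i a k. i \<in> {1..n} \<Longrightarrow> a \<in> keys (\<Phi> (A.zel i)) \<Longrightarrow> k \<in> {1..m} \<Longrightarrow> lookup a (X k) = 0"
    and Y0: "\<And>i a k. i \<in> {1..n} \<Longrightarrow> a \<in> keys (\<Phi> (A.zel i)) \<Longrightarrow> k \<in> {1..m} \<Longrightarrow>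
       lookup a (Y k) = (if k = \<sigma> i then 1 else 0)"
    and i: "i \<in> {1..n}"
  obtains r where "r = 1 \<or> r = -1" "q i = q' (\<sigma> i) powi r"
    "\<And>a k. a \<in> keys (\<Phi> (A.gimg (X i))) \<Longrightarrow> k \<in> {1..m} \<Longrightarrow> lookup a (X k) = (if k = \<sigma> i then r else 0)"
    "\<And>a k. a \<in> keys (\<Phi> (A.gimg (X i))) \<Longrightarrow> k \<in> {1..m} \<Longrightarrow> k \<noteq> \<sigma> i \<Longrightarrow> lookup a (Y k) = 0"
proof -
  define s where "s = \<Phi> (A.gimg (X i))"
  define s' where "s' = \<Phi> (A.gimg (Y i))"
  have AS: "A.gimg (X i) \<in> A.S" "A.gimg (Y i) \<in> A.S" "A.zel i \<in> A.S"
    using i A.S_gimg[of "X i"] A.S_gimg[of "Y i"] A.S_zel by simp_all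
  have S: "s \<in> C.S" "s' \<in> C.S" "s \<noteq> 0" "s' \<noteq> 0"
    unfolding s_def s'_def using AS i A.gimg_nz[of "X i"] A.gimg_nz[of "Y i"]
    by (simp_all add: Phi_S Phi_nz del: A.gimg.simps)
  have \<sigma>i: "\<sigma> i \<in> {1..m}"
    using \<sigma> i by (rule bij_betw_apply)
  have "\<Phi> (A.zel i) = single 0 1 + C.tsc (q i - 1) (C.tm s' s)"
    unfolding s_def s'_def using AS
    by (subst A.zel_eq[OF i]) (simp add: Phi_add Phi_tsc Phi_tm Phi_one A.S_one A.S_tm A.S_tsc del: A.gimg.simps)
  then have "C.tsc (q i - 1) (C.tm s' s) = \<Phi> (A.zel i) - single 0 1"
    by simp
  then have keys_eq: "keys (C.tm s' s) = keys (\<Phi> (A.zel i) - single 0 1)"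
    using C.keys_tsc[of "q i - 1" "C.tm s' s"] A.q_ne_1[OF i] by simp
  have prod: "c \<in> keys (\<Phi> (A.zel i)) \<or> c = 0" if "c \<in> keys (C.tm s' s)" for c
    using that keys_diff[of "\<Phi> (A.zel i)" "single 0 1"] unfolding keys_eq by auto
  have PX: "lookup c (X k) = 0" if "c \<in> keys (C.tm s' s)" "k \<in> {1..m}" for c k
    using prod[OF that(1)] X0[OF i _ that(2)] by auto
  have PY: "lookup c (Y k) = 0" if "c \<in> keys (C.tm s' s)" "k \<in> {1..m}" "k \<noteq> \<sigma> i" for c k
    using prod[OF that(1)] Y0[OF i _ that(2)] that(3) by auto
  have PZ: "lookup c (Y (\<sigma> i)) \<le> 1" if "c \<in> keys (C.tm s' s)" for c
    using prod[OF that(1)] Y0[OF i _ \<sigma>i] by auto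
  have "\<forall>k\<in>{1..m}. \<exists>\<rho>. (\<forall>a\<in>keys s. lookup a (X k) = \<rho>) \<and> (\<forall>b\<in>keys s'. lookup b (X k) = - \<rho>)"
  proof
    fix k assume k: "k \<in> {1..m}"
    obtain r where "\<And>a. a \<in> keys s' \<Longrightarrow> lookup a (X k) = r" "\<And>b. b \<in> keys s \<Longrightarrow> lookup b (X k) = 0 - r"
      using C.tm_keys_const[OF S(4,3), of "\<lambda>a. lookup a (X k)" 0] PX[OF _ k] lookup_add by metis
    then show "\<exists>\<rho>. (\<forall>a\<in>keys s. lookup a (X k) = \<rho>) \<and> (\<forall>b\<in>keys s'. lookup b (X k) = - \<rho>)"
      by (intro exI[of _ "- r"]) auto
  qed
  from bchoice[OF this] obtain \<rho> where
    \<rho>: "\<And>k a. k \<in> {1..m} \<Longrightarrow> a \<in> keys s \<Longrightarrow> lookup a (X k) = \<rho> k"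
      "\<And>k b. k \<in> {1..m} \<Longrightarrow> b \<in> keys s' \<Longrightarrow> lookup b (X k) = - \<rho> k"
    by blast
  have nonneg: "lookup a (Y k) \<ge> 0" if "a \<in> keys t" "t \<in> C.S" for a k t
    using C.S_nonneg[OF that(2,1)] by (simp add: C.nonneg_def)
  \<comment> \<open>The factors are homogeneous with weights r and -r, and both are
    nonnegative.\<close>
  have Y: "lookup a (Y k) = 0" if a: "a \<in> keys s" and k: "k \<in> {1..m}" "k \<noteq> \<sigma> i" for a k
  proof -
    obtain r where r: "\<And>b. b \<in> keys s' \<Longrightarrow> lookup b (Y k) = r" "\<And>a. a \<in> keys s \<Longrightarrow> lookup a (Y k) = 0 - r"
      using C.tm_keys_const[OF S(4,3), of "\<lambda>a. lookup a (Y k)" 0] PY[OF _ k] lookup_add by metis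
    obtain b where b: "b \<in> keys s'"
      using S(4) by (metis ex_in_conv keys_eq_empty)
    show ?thesis
      using r(1)[OF b] r(2)[OF a] nonneg[OF b S(2), of k] nonneg[OF a S(1), of k] by simp
  qed
  have comm: "(if i = j then q i else 1) = q' (\<sigma> j) powi \<rho> (\<sigma> j)" if j: "j \<in> {1..n}" for j
  proof -
    have \<sigma>j: "\<sigma> j \<in> {1..m}"
      using \<sigma> j by (rule bij_betw_apply)
    have zj: "A.zel j \<in> A.S" "A.zel j \<noteq> 0"
      using A.S_zel[OF j] A.zel_nz by auto
    have "A.tm (A.gimg (X i)) (A.zel j) = A.tsc (q j powi (if i = j then 1 else 0)) (A.tm (A.zel j) (A.gimg (X i)))"
      using A.keys_gimg_X j by (intro A.tm_gimg_zel) auto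
    from arg_cong[OF this, of \<Phi>]
    have "C.tm s (\<Phi> (A.zel j)) = C.tsc (q j powi (if i = j then 1 else 0)) (C.tm (\<Phi> (A.zel j)) s)"
      using AS(1) zj(1) by (simp add: Phi_tm Phi_tsc A.S_tm s_def del: A.gimg.simps)
    then have "q j powi (if i = j then 1 else 0) = q' (\<sigma> j) powi \<rho> (\<sigma> j)"
    proof (rule C.tm_commute_unique[rotated 3])
      show "s \<noteq> 0" "\<Phi> (A.zel j) \<noteq> 0"
        using S(3) Phi_nz zj by auto
      fix a b assume ab: "a \<in> keys s" "b \<in> keys (\<Phi> (A.zel j))"
      have "C.chi a b = q' (\<sigma> j) powi (lookup a (X (\<sigma> j)) * lookup b (Y (\<sigma> j)))"
        using X0[OF j ab(2)] Y0[OF j ab(2)] \<sigma>j by (intro C.chi_right_single) auto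
      moreover have "C.chi b a = 1"
        using X0[OF j ab(2)] by (intro C.chi_left_eq_1)
      ultimately show "C.chi a b = q' (\<sigma> j) powi \<rho> (\<sigma> j) * C.chi b a"
        using Y0[OF j ab(2) \<sigma>j] \<rho>(1)[OF \<sigma>j ab(1)] by simp
    qed
    then show ?thesis
      by (auto split: if_splits)
  qed
  \<comment> \<open>For k = \<sigma> j with j not i, z_j commutes with x_i, so a power of q'_k
    equals 1.\<close>
  have \<rho>0: "\<rho> k = 0" if k: "k \<in> {1..m}" "k \<noteq> \<sigma> i" for k
  proof -
    obtain j where j: "j \<in> {1..n}" "k = \<sigma> j"
      using \<sigma> k(1) unfolding bij_betw_def by blast
    then have "i \<noteq> j"
      using k(2) by blast
    then have "q' k powi \<rho> k = 1"
      using comm[OF j(1)] j(2) by simp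
    then show ?thesis
      by (rule C.q_powi_eq_1[OF k(1)])
  qed
  let ?r = "\<rho> (\<sigma> i)"
  have qi: "q i = q' (\<sigma> i) powi ?r"
    using comm[OF i] by simp
  then have "?r \<noteq> 0"
    using A.q_ne_1[OF i] by auto
  \<comment> \<open>The top z-degrees at \<sigma> i add up to at most 1. With \<rho> the weight of s
    there, \<open>S_lead\<close> makes them at least max(0, -\<rho>) for s and max(0, \<rho>) for
    s', so the absolute value of \<rho> is at most 1.\<close>
  obtain b a where ba: "b + a \<in> keys (C.tm s' s)"
    "\<And>b'. b' \<in> keys s' \<Longrightarrow> lookup b' (Y (\<sigma> i)) \<le> lookup b (Y (\<sigma> i))"
    "\<And>a'. a' \<in> keys s \<Longrightarrow> lookup a' (Y (\<sigma> i)) \<le> lookup a (Y (\<sigma> i))"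
    using C.tm_top[OF S(4,3), of "\<lambda>a. lookup a (Y (\<sigma> i))"] lookup_add by metis
  have le1: "lookup b (Y (\<sigma> i)) + lookup a (Y (\<sigma> i)) \<le> 1"
    using PZ[OF ba(1)] by (simp add: lookup_add)
  obtain a1 where a1: "a1 \<in> keys s" "lookup a1 (Y (\<sigma> i)) \<ge> 0" "lookup a1 (Y (\<sigma> i)) \<ge> - lookup a1 (X (\<sigma> i))"
    using C.S_lead[OF S(1,3)] by metis
  obtain b1 where b1: "b1 \<in> keys s'" "lookup b1 (Y (\<sigma> i)) \<ge> 0" "lookup b1 (Y (\<sigma> i)) \<ge> - lookup b1 (X (\<sigma> i))"
    using C.S_lead[OF S(2,4)] by metis
  have "?r = 1 \<or> ?r = -1"
    using le1 ba(2)[OF b1(1)] ba(3)[OF a1(1)] a1(2,3) b1(2,3) \<rho>(1)[OF \<sigma>i a1(1)] \<rho>(2)[OF \<sigma>i b1(1)] \<open>?r \<noteq> 0\<close>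
    by linarith
  then show ?thesis
    using that[OF _ qi] \<rho>(1) \<rho>0 Y unfolding s_def by (metis (full_types))
qed

lemma compatible_exists:
  obtains P1 P2 \<sigma> where "compatible n q lam q' lam' P1 P2 \<sigma>"
proof -
  note mn = eq_of_iso
  obtain \<sigma> where \<sigma>: "inj_on \<sigma> {1..n}" "\<sigma> ` {1..n} \<subseteq> {1..m}"
    "\<forall>i\<in>{1..n}. \<forall>a\<in>keys (\<Phi> (A.zel i)). \<forall>k\<in>{1..m}.
       lookup a (X k) = 0 \<and> lookup a (Y k) = (if k = \<sigma> i then 1 else 0)"
    by (rule permutation_exists)
  then have X0: "\<And>i a k. i \<in> {1..n} \<Longrightarrow> a \<in> keys (\<Phi> (A.zel i)) \<Longrightarrow> k \<in> {1..m} \<Longrightarrow> lookup a (X k) = 0"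
    and Y0: "\<And>i a k. i \<in> {1..n} \<Longrightarrow> a \<in> keys (\<Phi> (A.zel i)) \<Longrightarrow> k \<in> {1..m} \<Longrightarrow>
       lookup a (Y k) = (if k = \<sigma> i then 1 else 0)"
    by blast+
  have bij: "bij_betw \<sigma> {1..n} {1..m}"
    using \<sigma>(1,2) mn endo_inj_surj[of "{1..n}" \<sigma>] by (simp add: bij_betw_def)
  have "\<forall>i\<in>{1..n}. \<exists>r. (r = 1 \<or> r = -1) \<and> q i = q' (\<sigma> i) powi r \<and>
     (\<forall>a\<in>keys (\<Phi> (A.gimg (X i))). \<forall>k\<in>{1..m}. lookup a (X k) = (if k = \<sigma> i then r else 0) \<and>
       (k \<noteq> \<sigma> i \<longrightarrow> lookup a (Y k) = 0))"
  proof
    fix i assume i: "i \<in> {1..n}"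
    show "\<exists>r. (r = 1 \<or> r = -1) \<and> q i = q' (\<sigma> i) powi r \<and>
     (\<forall>a\<in>keys (\<Phi> (A.gimg (X i))). \<forall>k\<in>{1..m}. lookup a (X k) = (if k = \<sigma> i then r else 0) \<and>
       (k \<noteq> \<sigma> i \<longrightarrow> lookup a (Y k) = 0))"
      by (rule gen_weight[OF bij X0 Y0 i]) blast+
  qed
  from bchoice[OF this] obtain r where r: "\<And>i. i \<in> {1..n} \<Longrightarrow> r i = 1 \<or> r i = -1"
    "\<And>i. i \<in> {1..n} \<Longrightarrow> q i = q' (\<sigma> i) powi r i"
    and rX: "\<And>i a k. i \<in> {1..n} \<Longrightarrow> a \<in> keys (\<Phi> (A.gimg (X i))) \<Longrightarrow> k \<in> {1..m} \<Longrightarrow>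
      lookup a (X k) = (if k = \<sigma> i then r i else 0)"
    and rY: "\<And>i a k. i \<in> {1..n} \<Longrightarrow> a \<in> keys (\<Phi> (A.gimg (X i))) \<Longrightarrow> k \<in> {1..m} \<Longrightarrow>
      k \<noteq> \<sigma> i \<Longrightarrow> lookup a (Y k) = 0"
    by blast
  have \<sigma>m: "\<sigma> i \<in> {1..m}" if "i \<in> {1..n}" for i
    using bij that by (rule bij_betw_apply)
  \<comment> \<open>The sign r_i will decide the part of i, so the exponent r_i r_j is 1 within a
    part and -1 across the parts.\<close>
  have lam: "lam i j = lam' (\<sigma> i) (\<sigma> j) powi (r i * r j)" if ij: "i \<in> {1..n}" "j \<in> {1..n}" for i j
  proof (cases "i = j")
    case True
    then show ?thesis
      using A.lam_diag[OF ij(1)] C.lam_diag[OF \<sigma>m[OF ij(1)]] by simp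
  next
    case False
    let ?s = "\<lambda>i. \<Phi> (A.gimg (X i))"
    have S: "A.gimg (X i) \<in> A.S" "A.gimg (X j) \<in> A.S" "?s i \<noteq> 0" "?s j \<noteq> 0"
      using ij A.S_gimg[of "X i"] A.S_gimg[of "X j"] A.gimg_nz[of "X i"] A.gimg_nz[of "X j"] Phi_nz
      by (auto simp del: A.gimg.simps)
    have ne: "\<sigma> i \<noteq> \<sigma> j"
      using \<sigma>(1) ij False by (auto dest: inj_onD)
    have "C.tm (?s i) (?s j) = C.tsc (lam i j) (C.tm (?s j) (?s i))"
      using arg_cong[OF A.gimg_X_X[OF ij False], of \<Phi>] S
      by (simp add: Phi_tm Phi_tsc A.S_tm del: A.gimg.simps)
    then show ?thesis
    proof (rule C.tm_commute_unique[rotated 3])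
      fix a b assume ab: "a \<in> keys (?s i)" "b \<in> keys (?s j)"
      have "C.chi a b = lam' (\<sigma> i) (\<sigma> j) powi (lookup a (X (\<sigma> i)) * lookup b (X (\<sigma> j))) * C.chi b a"
        using \<sigma>m ij ne rX[OF ij(1) ab(1)] rX[OF ij(2) ab(2)] rY[OF ij(1) ab(1)] rY[OF ij(2) ab(2)]
        by (intro C.chi_cross) auto
      then show "C.chi a b = lam' (\<sigma> i) (\<sigma> j) powi (r i * r j) * C.chi b a"
        using rX[OF ij(1) ab(1) \<sigma>m[OF ij(1)]] rX[OF ij(2) ab(2) \<sigma>m[OF ij(2)]] by simp
    qed (use S in auto)
  qed
  define P1 where "P1 = {i \<in> {1..n}. r i = 1}"
  define P2 where "P2 = {i \<in> {1..n}. r i = -1}"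
  have "compatible n q lam q' lam' P1 P2 \<sigma>"
    unfolding compatible_def
  proof (intro conjI ballI)
    show "P1 \<union> P2 = {1..n}"
      unfolding P1_def P2_def using r(1) by blast
    show "P1 \<inter> P2 = {}"
      by (auto simp: P1_def P2_def)
    show "bij_betw \<sigma> {1..n} {1..n}"
      using bij mn by simp
    show "q' (\<sigma> i) = q i" if "i \<in> P1" for i
      using that r(2)[of i] by (simp add: P1_def)
    show "q' (\<sigma> i) = inverse (q i)" if "i \<in> P2" for i
      using that r(2)[of i] by (simp add: P2_def)
    show "lam' (\<sigma> i) (\<sigma> j) = lam i j" if "i \<in> P1" "j \<in> P1" for i j
      using that lam[of i j] by (simp add: P1_def)
    show "lam' (\<sigma> i) (\<sigma> j) = lam i j" if "i \<in> P2" "j \<in> P2" for i j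
      using that lam[of i j] by (simp add: P2_def)
    show "lam' (\<sigma> j) (\<sigma> i) = lam i j" if "i \<in> P1" "j \<in> P2" for i j
      using that lam[of i j] C.lam_inv[OF \<sigma>m \<sigma>m, of i j] by (simp add: P1_def P2_def)
  qed
  then show ?thesis
    using that by blast
qed

end

text \<open>\<phi> respects the operations only modulo relations. Passing to torus images removes
  this: by \<open>E_eq_iff\<close> the value does not depend on which preimage \<open>SOME\<close>
  selects.\<close>

lemma qw_iso_of_alg_iso:
  assumes "qweyl n q lam" "qweyl m q' lam'"
    and iso: "is_alg_iso (qwt_gens n) (qwt_rels n q lam) (qwt_gens m) (qwt_rels m q' lam') \<phi>"
  shows "\<exists>\<Phi>. qw_iso n q lam m q' lam' \<Phi>"
proof -
  interpret A: qweyl n q lam by fact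
  interpret C: qweyl m q' lam' by fact
  note iso' = iso[unfolded is_alg_iso_def fa_add_eq]
  have \<phi>: "\<phi> f \<in> FA C.G" if "f \<in> FA A.G" for f
    using iso' that by blast
  have eq: "C.E (\<phi> f) = C.E (\<phi> g) \<longleftrightarrow> A.E f = A.E g" if "f \<in> FA A.G" "g \<in> FA A.G" for f g
    using iso' that \<phi> A.E_eq_iff[OF that] C.E_eq_iff[OF \<phi>[OF that(1)] \<phi>[OF that(2)]] by blast
  define \<Phi> where "\<Phi> s = C.E (\<phi> (SOME f. f \<in> FA A.G \<and> A.E f = s))" for s
  have \<Phi>: "\<Phi> (A.E f) = C.E (\<phi> f)" if f: "f \<in> FA A.G" for f
  proof -
    let ?g = "SOME g. g \<in> FA A.G \<and> A.E g = A.E f"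
    have "?g \<in> FA A.G \<and> A.E ?g = A.E f"
      by (rule someI[of _ f]) (simp add: f)
    then show ?thesis
      unfolding \<Phi>_def using eq f by blast
  qed
  have cong: "C.E g = C.E h" if "C.eqv g h" "g \<in> FA C.G" "h \<in> FA C.G" for g h
    using C.E_eq_iff[OF that(2,3)] that(1) by simp
  have "qw_iso n q lam m q' lam' \<Phi>"
  proof unfold_locales
    fix s t assume "s \<in> A.S" "t \<in> A.S"
    then obtain f g where fg: "f \<in> FA A.G" "s = A.E f" "g \<in> FA A.G" "t = A.E g"
      by (auto simp: A.S_def)
    have "C.eqv (\<phi> (f + g)) (\<phi> f + \<phi> g)" "C.eqv (\<phi> (fa_mult f g)) (fa_mult (\<phi> f) (\<phi> g))"
      using iso' fg by blast+
    then have "C.E (\<phi> (f + g)) = C.E (\<phi> f + \<phi> g)" "C.E (\<phi> (fa_mult f g)) = C.E (fa_mult (\<phi> f) (\<phi> g))"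
      using fg \<phi> by (auto intro!: cong)
    then show "\<Phi> (s + t) = \<Phi> s + \<Phi> t" "\<Phi> (A.tm s t) = C.tm (\<Phi> s) (\<Phi> t)"
      using fg \<phi> \<Phi>[of "f + g"] \<Phi>[of "fa_mult f g"]
      by (simp_all add: \<Phi> A.ext_add[of _ A.G] C.ext_add[of _ C.G] A.ext_mult[of _ A.G] C.ext_mult[of _ C.G])
  next
    fix s c assume "s \<in> A.S"
    then obtain f where f: "f \<in> FA A.G" "s = A.E f"
      by (auto simp: A.S_def)
    have "C.eqv (\<phi> (fa_smult c f)) (fa_smult c (\<phi> f))"
      using iso' f by blast
    then have "C.E (\<phi> (fa_smult c f)) = C.E (fa_smult c (\<phi> f))"
      using f \<phi> by (auto intro!: cong)
    then show "\<Phi> (A.tsc c s) = C.tsc c (\<Phi> s)"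
      using f \<phi> \<Phi>[of "fa_smult c f"] by (simp add: \<Phi> A.ext_smult[of _ A.G] C.ext_smult[of _ C.G])
  next
    have "C.eqv (\<phi> fa_one) fa_one"
      using iso' by blast
    then have "C.E (\<phi> fa_one) = C.E fa_one"
      by (rule cong) (simp_all add: \<phi>)
    then show "\<Phi> (single 0 1) = single 0 1"
      using \<Phi>[of fa_one] by simp
  next
    have "inj_on \<Phi> A.S"
      using eq by (auto simp: inj_on_def A.S_def \<Phi>)
    moreover have "\<Phi> ` A.S = C.S"
    proof (intro subset_antisym subsetI)
      fix s assume "s \<in> \<Phi> ` A.S"
      then show "s \<in> C.S"
        using \<phi> by (auto simp: A.S_def C.S_def \<Phi>)
    next
      fix s assume "s \<in> C.S"
      then obtain h where h: "h \<in> FA C.G" "s = C.E h"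
        by (auto simp: C.S_def)
      then obtain f where f: "f \<in> FA A.G" "C.eqv (\<phi> f) h"
        using iso' by blast
      then have "s = \<Phi> (A.E f)"
        using cong[OF f(2) \<phi>[OF f(1)] h(1)] h(2) \<Phi>[OF f(1)] by simp
      then show "s \<in> \<Phi> ` A.S"
        using f(1) by (auto simp: A.S_def)
    qed
    ultimately show "bij_betw \<Phi> A.S C.S"
      by (simp add: bij_betw_def)
  qed
  then show ?thesis
    by blast
qed

section \<open>The isomorphism theorem\<close>

theorem theorem2p6:
  fixes n m :: nat
    and q q' :: "nat \<Rightarrow> 'k::field"
    and lam lam' :: "nat \<Rightarrow> nat \<Rightarrow> 'k"
  assumes "n \<ge> 1" and "m \<ge> 1"
    and "qw_params n q lam" and "qw_params m q' lam'"
    and "\<forall>i\<in>{1..n}. not_root_of_unity (q i)"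
    and "\<forall>i\<in>{1..m}. not_root_of_unity (q' i)"
  shows
    "(alg_isomorphic (qwt_gens n) (qwt_rels n q lam) (qwt_gens m) (qwt_rels m q' lam')
      \<longleftrightarrow>
      (m = n \<and>
       (\<exists>P1 P2 (\<sigma>::nat \<Rightarrow> nat).
          P1 \<union> P2 = {1..n} \<and> P1 \<inter> P2 = {} \<and> bij_betw \<sigma> {1..n} {1..n} \<and>
          (\<forall>i\<in>P1. q' (\<sigma> i) = q i) \<and>
          (\<forall>i\<in>P2. q' (\<sigma> i) = inverse (q i)) \<and>
          (\<forall>i\<in>P1. \<forall>j\<in>P1. lam' (\<sigma> i) (\<sigma> j) = lam i j) \<and>
          (\<forall>i\<in>P2. \<forall>j\<in>P2. lam' (\<sigma> i) (\<sigma> j) = lam i j) \<and>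
          (\<forall>i\<in>P1. \<forall>j\<in>P2. lam' (\<sigma> j) (\<sigma> i) = lam i j))))
     \<and>
     (\<forall>P1 P2 (\<sigma>::nat \<Rightarrow> nat) (\<alpha>::nat \<Rightarrow> 'k) a b.
        (m = n \<and>
         P1 \<union> P2 = {1..n} \<and> P1 \<inter> P2 = {} \<and> bij_betw \<sigma> {1..n} {1..n} \<and>
         (\<forall>i\<in>P1. q' (\<sigma> i) = q i) \<and>
         (\<forall>i\<in>P2. q' (\<sigma> i) = inverse (q i)) \<and>
         (\<forall>i\<in>P1. \<forall>j\<in>P1. lam' (\<sigma> i) (\<sigma> j) = lam i j) \<and>
         (\<forall>i\<in>P2. \<forall>j\<in>P2. lam' (\<sigma> i) (\<sigma> j) = lam i j) \<and>
         (\<forall>i\<in>P1. \<forall>j\<in>P2. lam' (\<sigma> j) (\<sigma> i) = lam i j) \<and>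
         (\<forall>i\<in>{1..n}. \<alpha> i \<noteq> 0) \<and> a \<noteq> 0)
        \<longrightarrow>
        is_alg_iso (qwt_gens n) (qwt_rels n q lam) (qwt_gens m) (qwt_rels m q' lam')
          (fa_ext (\<lambda>g. case g of
               X i \<Rightarrow> if i \<in> P1 then fa_smult (\<alpha> i) (fa_gen (X (\<sigma> i)))
                      else fa_smult (\<alpha> i) (fa_gen (Y (\<sigma> i)))
             | Y i \<Rightarrow> if i \<in> P1 then fa_smult (inverse (\<alpha> i)) (fa_gen (Y (\<sigma> i)))
                      else fa_smult (- inverse (q i * \<alpha> i)) (fa_gen (X (\<sigma> i)))
             | T \<Rightarrow> fa_add (fa_smult a (fa_gen T)) (fa_smult b fa_one))))"
proof -
  let ?C = "compatible n q lam q' lam'"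
  have part2: "is_alg_iso (qwt_gens n) (qwt_rels n q lam) (qwt_gens m) (qwt_rels m q' lam')
      (fa_ext (\<lambda>g. case g of
               X i \<Rightarrow> if i \<in> P1 then fa_smult (\<alpha> i) (fa_gen (X (\<sigma> i)))
                      else fa_smult (\<alpha> i) (fa_gen (Y (\<sigma> i)))
             | Y i \<Rightarrow> if i \<in> P1 then fa_smult (inverse (\<alpha> i)) (fa_gen (Y (\<sigma> i)))
                      else fa_smult (- inverse (q i * \<alpha> i)) (fa_gen (X (\<sigma> i)))
             | T \<Rightarrow> fa_add (fa_smult a (fa_gen T)) (fa_smult b fa_one)))"
    if "m = n" "?C P1 P2 \<sigma>" "\<forall>i\<in>{1..n}. \<alpha> i \<noteq> 0" "a \<noteq> 0" for P1 P2 \<sigma> \<alpha> a b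
    using is_alg_iso_iso_gen[OF that(2) assms(3) _ that(3,4)] assms(4) that(1)
    unfolding iso_gen_def by blast
  have "m = n \<and> (\<exists>P1 P2 \<sigma>. ?C P1 P2 \<sigma>)"
    if iso: "alg_isomorphic (qwt_gens n) (qwt_rels n q lam) (qwt_gens m) (qwt_rels m q' lam')"
  proof -
    have "qweyl n q lam" "qweyl m q' lam'"
      using assms by (simp_all add: qweyl_def qweyl_axioms_def qparams_def)
    then obtain \<Phi> where "qw_iso n q lam m q' lam' \<Phi>"
      using iso qw_iso_of_alg_iso unfolding alg_isomorphic_def by blast
    then interpret qw_iso n q lam m q' lam' \<Phi> .
    show ?thesis
      using eq_of_iso compatible_exists by blast
  qed
  moreover have "alg_isomorphic (qwt_gens n) (qwt_rels n q lam) (qwt_gens m) (qwt_rels m q' lam')"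
    if "m = n" "?C P1 P2 \<sigma>" for P1 P2 \<sigma>
    using part2[OF that, of "\<lambda>_. 1" 1] unfolding alg_isomorphic_def by fastforce
  ultimately have iff: "alg_isomorphic (qwt_gens n) (qwt_rels n q lam) (qwt_gens m) (qwt_rels m q' lam')
      \<longleftrightarrow> m = n \<and> (\<exists>P1 P2 \<sigma>. ?C P1 P2 \<sigma>)"
    by blast
  show ?thesis
  proof (rule conjI[OF iff[unfolded compatible_def]], intro allI impI, elim conjE, goal_cases)
    case (1 P1 P2 \<sigma> \<alpha> a b)
    then have "?C P1 P2 \<sigma>"
      unfolding compatible_def by (intro conjI)
    with 1 show ?case
      by (intro part2)
  qed
qed

end
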